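(* There is an operator space $X$ which is isomorphic as a Banach space to $\ell_2$, which is not completely isomorphic to $OH$, and which has a closed subspace $Y$ completely isometric to $OH$ such that the quotient $X/Y$ is also completely isometric to $OH$.
   Context: Operator spaces $X$ carry matrix norms on $M_n(X)$ (Ruan's axioms); subspaces carry the restricted norms, and quotients carry $M_n(X/Y)=M_n(X)/M_n(Y)$. A linear map $T$ is completely bounded if $\sup_n\|T_n\|<\infty$, where $T_n((x_{ij}))=(T(x_{ij}))$; it is a complete isometry if each $T_n$ is an isometry, and a complete isomorphism if it is invertible with $T$, $T^{-1}$ completely bounded. $OH$ is Pisier's operator Hilbert space: the operator space structure on $\ell_2$ given by $\|\sum_k x_k\otimes e_k\|_{M_n(OH)}=\|\sum_k x_k\otimes\overline{x_k}\|^{1/2}$ for $x_k\in M_n$ and $(e_k)$ an orthonormal basis of $\ell_2$. *)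

theory Defs
  imports
    "HOL-Analysis.Abstract_Metric_Spaces"
    "HOL-Library.Extended_Nonnegative_Real"
    "HOL-Algebra.AbelCoset"
    "Jordan_Normal_Form.VS_Connect"
begin

section \<open>Operator norms of complex matrices\<close>

definition l2_vec_norm :: "complex vec \<Rightarrow> real" where
  "l2_vec_norm v = sqrt (\<Sum>i<dim_vec v. (cmod (vec_index v i))\<^sup>2)"

definition mat_op_norm :: "complex mat \<Rightarrow> real" where
  "mat_op_norm A = Sup {l2_vec_norm (A *\<^sub>v v) | v. v \<in> carrier_vec (dim_col A) \<and> l2_vec_norm v \<le> 1}"

definition kronecker_mat :: "complex mat \<Rightarrow> complex mat \<Rightarrow> complex mat" where
  "kronecker_mat A B =
    Matrix.mat (dim_row A * dim_row B) (dim_col A * dim_col B)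
      (\<lambda>(r, s). A $$ (r div dim_row B, s div dim_col B) * B $$ (r mod dim_row B, s mod dim_col B))"


section \<open>Operator spaces\<close>

text \<open>
  The single function \<open>mnorm\<close> carries the norms of all \<open>M\<^sub>n(X)\<close>, a matrix knowing its own size.
  The fields \<open>mult\<close> and \<open>one\<close> inherited from HOL-Algebra's \<open>module\<close> record play no role.
\<close>

record 'a opspace = "(complex, 'a) module" +
  mnorm :: "'a mat \<Rightarrow> real"

definition Mats :: "nat \<Rightarrow> 'a opspace \<Rightarrow> 'a mat set" where
  "Mats n X = {x \<in> carrier_mat n n. elements_mat x \<subseteq> carrier X}"

definition mat_add :: "'a opspace \<Rightarrow> 'a mat \<Rightarrow> 'a mat \<Rightarrow> 'a mat" where
  "mat_add X x y = Matrix.mat (dim_row x) (dim_col x) (\<lambda>ij. x $$ ij \<oplus>\<^bsub>X\<^esub> y $$ ij)"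

definition mat_zero :: "'a opspace \<Rightarrow> nat \<Rightarrow> nat \<Rightarrow> 'a mat" where
  "mat_zero X m n = Matrix.mat m n (\<lambda>_. \<zero>\<^bsub>X\<^esub>)"

definition mat_dsum :: "'a opspace \<Rightarrow> 'a mat \<Rightarrow> 'a mat \<Rightarrow> 'a mat" where
  "mat_dsum X x y =
    four_block_mat x (mat_zero X (dim_row x) (dim_col y)) (mat_zero X (dim_row y) (dim_col x)) y"

text \<open>The product \<open>\<alpha> x \<beta>\<close> of a matrix over \<open>X\<close> with scalar matrices on both sides.\<close>

definition mat_bimult :: "'a opspace \<Rightarrow> complex mat \<Rightarrow> 'a mat \<Rightarrow> complex mat \<Rightarrow> 'a mat" where
  "mat_bimult X \<alpha> x \<beta> =
    Matrix.mat (dim_row \<alpha>) (dim_col \<beta>)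
      (\<lambda>(i, j). \<Oplus>\<^bsub>X\<^esub>k\<in>{..<dim_row x}. \<Oplus>\<^bsub>X\<^esub>l\<in>{..<dim_col x}. (\<alpha> $$ (i, k) * \<beta> $$ (l, j)) \<odot>\<^bsub>X\<^esub> x $$ (k, l))"

locale operator_space = vectorspace "class_ring :: complex ring" X
  for X :: "'a opspace" +
  assumes mnorm_nonneg: "\<lbrakk>n \<ge> 1; x \<in> Mats n X\<rbrakk> \<Longrightarrow> mnorm X x \<ge> 0"
    and mnorm_eq_0_iff: "\<lbrakk>n \<ge> 1; x \<in> Mats n X\<rbrakk> \<Longrightarrow> mnorm X x = 0 \<longleftrightarrow> x = mat_zero X n n"
    and mnorm_triangle: "\<lbrakk>n \<ge> 1; x \<in> Mats n X; y \<in> Mats n X\<rbrakk>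
      \<Longrightarrow> mnorm X (mat_add X x y) \<le> mnorm X x + mnorm X y"
    and mnorm_scale: "\<lbrakk>n \<ge> 1; x \<in> Mats n X\<rbrakk>
      \<Longrightarrow> mnorm X (map_mat (\<lambda>v. c \<odot>\<^bsub>X\<^esub> v) x) = cmod c * mnorm X x"
    and ruan_dsum: "\<lbrakk>m \<ge> 1; n \<ge> 1; x \<in> Mats m X; y \<in> Mats n X\<rbrakk>
      \<Longrightarrow> mnorm X (mat_dsum X x y) = max (mnorm X x) (mnorm X y)"
    and ruan_bimult: "\<lbrakk>m \<ge> 1; n \<ge> 1; \<alpha> \<in> carrier_mat n m; x \<in> Mats m X; \<beta> \<in> carrier_mat m n\<rbrakk>
      \<Longrightarrow> mnorm X (mat_bimult X \<alpha> x \<beta>) \<le> mat_op_norm \<alpha> * mnorm X x * mat_op_norm \<beta>"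

definition base_norm :: "'a opspace \<Rightarrow> 'a \<Rightarrow> real" where
  "base_norm X v = mnorm X (Matrix.mat 1 1 (\<lambda>_. v))"

definition closed_subspace :: "'a set \<Rightarrow> 'a opspace \<Rightarrow> bool" where
  "closed_subspace Y X \<longleftrightarrow>
    VectorSpace.subspace (class_ring :: complex ring) Y X \<and>
    closedin (Metric_space.mtopology (carrier X) (\<lambda>u v. base_norm X (u \<ominus>\<^bsub>X\<^esub> v))) Y"

definition subspace_opspace :: "'a opspace \<Rightarrow> 'a set \<Rightarrow> 'a opspace" where
  "subspace_opspace X Y = X\<lparr>carrier := Y\<rparr>"

text \<open>
  The matrices over \<open>X\<close> that represent a matrix \<open>A\<close> of cosets entry by entry form exactly one
  coset of \<open>M\<^sub>n(Y)\<close> in \<open>M\<^sub>n(X)\<close>, so the infimum is the norm of \<open>M\<^sub>n(X) / M\<^sub>n(Y)\<close>.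
\<close>

definition quotient_opspace :: "'a opspace \<Rightarrow> 'a set \<Rightarrow> 'a set opspace" where
  "quotient_opspace X Y =
    \<lparr>carrier = a_rcosets\<^bsub>X\<^esub> Y, mult = undefined, one = undefined, zero = Y, add = set_add X,
     smult = (\<lambda>c A. \<Union>a\<in>A. Y +>\<^bsub>X\<^esub> (c \<odot>\<^bsub>X\<^esub> a)),
     mnorm = (\<lambda>A. Inf {mnorm X x | x. x \<in> carrier_mat (dim_row A) (dim_col A) \<and>
       (\<forall>i<dim_row A. \<forall>j<dim_col A. x $$ (i, j) \<in> A $$ (i, j))})\<rparr>"


section \<open>Linear maps\<close>

text \<open>The amplification \<open>T\<^sub>n\<close> is \<^term>\<open>map_mat T\<close> on \<^term>\<open>Mats n X\<close>.\<close>

definition amp_norm :: "'a opspace \<Rightarrow> 'b opspace \<Rightarrow> ('a \<Rightarrow> 'b) \<Rightarrow> nat \<Rightarrow> ennreal" where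
  "amp_norm X Z T n = (SUP x\<in>{x \<in> Mats n X. mnorm X x \<le> 1}. ennreal (mnorm Z (map_mat T x)))"

definition completely_bounded :: "'a opspace \<Rightarrow> 'b opspace \<Rightarrow> ('a \<Rightarrow> 'b) \<Rightarrow> bool" where
  "completely_bounded X Z T \<longleftrightarrow>
    linear_map (class_ring :: complex ring) X Z T \<and> (SUP n\<in>{1..}. amp_norm X Z T n) < \<infinity>"

definition complete_isometry :: "'a opspace \<Rightarrow> 'b opspace \<Rightarrow> ('a \<Rightarrow> 'b) \<Rightarrow> bool" where
  "complete_isometry X Z T \<longleftrightarrow>
    linear_map (class_ring :: complex ring) X Z T \<and>
    (\<forall>n\<ge>1. \<forall>x\<in>Mats n X. mnorm Z (map_mat T x) = mnorm X x)"

definition completely_isometric :: "'a opspace \<Rightarrow> 'b opspace \<Rightarrow> bool" where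
  "completely_isometric X Z \<longleftrightarrow>
    (\<exists>T. complete_isometry X Z T \<and> bij_betw T (carrier X) (carrier Z))"

definition complete_isomorphism :: "'a opspace \<Rightarrow> 'b opspace \<Rightarrow> ('a \<Rightarrow> 'b) \<Rightarrow> bool" where
  "complete_isomorphism X Z T \<longleftrightarrow>
    bij_betw T (carrier X) (carrier Z) \<and>
    completely_bounded X Z T \<and> completely_bounded Z X (inv_into (carrier X) T)"

definition completely_isomorphic :: "'a opspace \<Rightarrow> 'b opspace \<Rightarrow> bool" where
  "completely_isomorphic X Z \<longleftrightarrow> (\<exists>T. complete_isomorphism X Z T)"

text \<open>Normed spaces are given by a vector space \<open>V\<close> together with a norm \<open>p\<close> on it.\<close>

definition bounded_linear_map ::
    "(complex, 'a, 'm) module_scheme \<Rightarrow> ('a \<Rightarrow> real) \<Rightarrow>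
     (complex, 'b, 'k) module_scheme \<Rightarrow> ('b \<Rightarrow> real) \<Rightarrow> ('a \<Rightarrow> 'b) \<Rightarrow> bool" where
  "bounded_linear_map V p W q T \<longleftrightarrow>
    linear_map (class_ring :: complex ring) V W T \<and> (\<exists>K. \<forall>v\<in>carrier V. q (T v) \<le> p v * K)"

definition banach_isomorphic ::
    "(complex, 'a, 'm) module_scheme \<Rightarrow> ('a \<Rightarrow> real) \<Rightarrow>
     (complex, 'b, 'k) module_scheme \<Rightarrow> ('b \<Rightarrow> real) \<Rightarrow> bool" where
  "banach_isomorphic V p W q \<longleftrightarrow>
    (\<exists>T. bij_betw T (carrier V) (carrier W) \<and> bounded_linear_map V p W q T \<and>
      bounded_linear_map W q V p (inv_into (carrier V) T))"


section \<open>The Hilbert space of square-summable sequences and the operator Hilbert space\<close>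

definition ell2 :: "(complex, nat \<Rightarrow> complex) module" where
  "ell2 =
    \<lparr>carrier = {x. summable (\<lambda>k. (cmod (x k))\<^sup>2)}, mult = undefined, one = undefined,
     zero = (\<lambda>_. 0), add = (\<lambda>x y k. x k + y k), smult = (\<lambda>c x k. c * x k)\<rparr>"

definition ell2_norm :: "(nat \<Rightarrow> complex) \<Rightarrow> real" where
  "ell2_norm x = sqrt (\<Sum>k. (cmod (x k))\<^sup>2)"

text \<open>
  A matrix \<open>x\<close> over \<^const>\<open>ell2\<close> is \<open>\<Sum>\<^sub>k x\<^sub>k \<otimes> e\<^sub>k\<close> for the standard basis \<open>e\<^sub>k\<close>, where \<open>x\<^sub>k\<close> is
  the scalar matrix of \<open>k\<close>-th coordinates. The series \<open>\<Sum>\<^sub>k x\<^sub>k \<otimes> cnj x\<^sub>k\<close> lives in a finite-dimensional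
  matrix algebra, so it is summed entrywise.
\<close>

definition coord_mat :: "(nat \<Rightarrow> complex) mat \<Rightarrow> nat \<Rightarrow> complex mat" where
  "coord_mat x k = map_mat (\<lambda>v. v k) x"

definition OH_mnorm :: "(nat \<Rightarrow> complex) mat \<Rightarrow> real" where
  "OH_mnorm x =
    sqrt (mat_op_norm
      (Matrix.mat (dim_row x * dim_row x) (dim_col x * dim_col x)
        (\<lambda>rs. \<Sum>k. kronecker_mat (coord_mat x k) (map_mat cnj (coord_mat x k)) $$ rs)))"

definition OH :: "(nat \<Rightarrow> complex) opspace" where
  "OH = module.extend ell2 (opspace.fields OH_mnorm)"

end

theory Submission
  imports Defs "HOL-Complex_Analysis.Complex_Analysis"
begin

text \<open>
  \<open>OH\<close> is the midpoint \<open>(R, C)\<^bsub>1/2\<^esub>\<close> of the complex interpolation scale between the row and the column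
  Hilbert space. The space \<open>X\<close> consists of the pairs \<open>(f(1/2), f'(1/2))\<close>, where \<open>f\<close> is a bounded analytic
  function on the strip \<open>0 \<le> Re s \<le> 1\<close>, measured in \<open>R\<close> on the left and in \<open>C\<close> on the right boundary line, with
  the quotient norm. Evaluation at \<open>1/2\<close> makes \<open>OH\<close> a quotient of \<open>X\<close>. The kernel of this evaluation is again \<open>OH\<close>: a
  function vanishing at \<open>1/2\<close> can be divided by the conformal map of the strip onto the disc. On the first matrix
  level \<open>R\<close> and \<open>C\<close> are the same Hilbert space, hence \<open>X\<close> is isomorphic to \<open>\<ell>\<^sub>2\<close>.
  The function \<open>n\<^bsup>(s-1)/2\<^esup> \<Sum>\<^sub>j e\<^sub>1\<^sub>j \<otimes> e\<^sub>j\<close> has norm one, while its derivative at \<open>1/2\<close>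
  is \<open>ln n / 2\<close> times a unit vector of \<open>M\<^sub>n(OH)\<close>. So the bounded projection of \<open>X\<close> onto the kernel is not completely
  bounded, whereas on row matrices over \<open>OH\<close> every bounded operator acts boundedly.
\<close>

section \<open>Diagonalization of Hermitian matrices\<close>

text \<open>\<open>OH\<close> is given by a formula and the space X by an infimum over analytic
  functions, so the proof rests on an exact identification of \<open>OH\<close> with the midpoint at
  every matrix level. The bridge: the square of \<open>OH_mnorm x\<close> is the norm, on
  Hilbert-Schmidt matrices, of the completely positive map attached to x. One inequality is a three
  lines argument with complex powers of singular values. The other needs an extremal function, built
  from positive definite a and b that are almost fixed by the map and its adjoint, as
  Perron-Frobenius eigenvectors would be; aiming at constants strictly above the norm, a finite
  piece of a Neumann series supplies them. The obstacle is the derivative: it has to be square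
  summable in the coordinate k, although bounds are imposed on the boundary lines only. Hence the
  extremal function is kept as a finite combination of the entries of x whose scalar analytic
  coefficients do not depend on k. Rows suffice to tell X from \<open>OH\<close>, because the norm
  of a row over \<open>OH\<close> is the square root of the Hilbert-Schmidt norm of its Gram
  matrix.\<close>

definition sqn :: "nat \<Rightarrow> (nat \<Rightarrow> complex) \<Rightarrow> real" where
  "sqn n v = (\<Sum>i<n. (cmod (v i))\<^sup>2)"

lemma sqn_nonneg [simp]: "sqn n v \<ge> 0"
  by (simp add: sqn_def sum_nonneg)

lemma sqn_eq_0_iff: "sqn n v = 0 \<longleftrightarrow> (\<forall>i<n. v i = 0)"
  unfolding sqn_def by (subst sum_nonneg_eq_0_iff) auto

lemma sqn_scale: "sqn n (\<lambda>i. c * v i) = (cmod c)\<^sup>2 * sqn n v"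
  by (simp add: sqn_def norm_mult power_mult_distrib sum_distrib_left)

lemma sqn_cnj [simp]: "sqn n (\<lambda>i. cnj (v i)) = sqn n v"
  by (simp add: sqn_def)

lemma of_real_sqn: "complex_of_real (sqn n v) = (\<Sum>i<n. v i * cnj (v i))"
  by (simp add: sqn_def complex_norm_square del: of_real_power)

lemma Cauchy_Schwarz_real:
  fixes u v :: "'i \<Rightarrow> 'a::real_normed_vector"
  shows "(\<Sum>i\<in>A. norm (u i) * norm (v i)) \<le> sqrt (\<Sum>i\<in>A. (norm (u i))\<^sup>2) * sqrt (\<Sum>i\<in>A. (norm (v i))\<^sup>2)"
  using L2_set_mult_ineq[of "\<lambda>i. norm (u i)" "\<lambda>i. norm (v i)" A] by (simp add: L2_set_def)

lemma Cauchy_Schwarz_complex: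
  fixes u v :: "'i \<Rightarrow> complex"
  shows "cmod (\<Sum>i\<in>A. u i * v i) \<le> sqrt (\<Sum>i\<in>A. (cmod (u i))\<^sup>2) * sqrt (\<Sum>i\<in>A. (cmod (v i))\<^sup>2)"
proof -
  have "cmod (\<Sum>i\<in>A. u i * v i) \<le> (\<Sum>i\<in>A. norm (u i) * norm (v i))"
    by (metis (mono_tags, lifting) norm_mult norm_sum sum.cong)
  also note Cauchy_Schwarz_real
  finally show ?thesis .
qed

lemma Cauchy_Schwarz_square:
  "(cmod (\<Sum>i<n. u i * v i))\<^sup>2 \<le> sqn n u * sqn n v"
proof -
  have "(cmod (\<Sum>i<n. u i * v i))\<^sup>2 \<le> (sqrt (sqn n u) * sqrt (sqn n v))\<^sup>2"
    unfolding sqn_def by (intro power_mono Cauchy_Schwarz_complex) auto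
  then show ?thesis by (simp add: power_mult_distrib)
qed

text \<open>Antilinear in the second argument. Vectors and matrices are functions on all naturals of
  which only the indices below \<open>n\<close> count, so that the dimension can be an ordinary
  variable.\<close>

definition iprod :: "nat \<Rightarrow> (nat \<Rightarrow> complex) \<Rightarrow> (nat \<Rightarrow> complex) \<Rightarrow> complex" where
  "iprod n u v = (\<Sum>i<n. u i * cnj (v i))"

lemma iprod_cnj: "cnj (iprod n u v) = iprod n v u"
  by (simp add: iprod_def mult.commute)

lemma iprod_self: "iprod n u u = of_real (sqn n u)"
  by (simp add: of_real_sqn iprod_def)

lemma iprod_add_left: "iprod n (\<lambda>i. u i + v i) w = iprod n u w + iprod n v w"
  by (simp add: iprod_def algebra_simps sum.distrib)

lemma iprod_diff_left: "iprod n (\<lambda>i. u i - v i) w = iprod n u w - iprod n v w"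
  by (simp add: iprod_def algebra_simps sum_subtractf)

lemma iprod_add_right: "iprod n w (\<lambda>i. u i + v i) = iprod n w u + iprod n w v"
  by (simp add: iprod_def algebra_simps sum.distrib)

lemma iprod_scale_left: "iprod n (\<lambda>i. c * u i) w = c * iprod n u w"
  by (simp add: iprod_def algebra_simps sum_distrib_left)

lemma iprod_scale_right: "iprod n w (\<lambda>i. c * u i) = cnj c * iprod n w u"
  by (simp add: iprod_def algebra_simps sum_distrib_left)

lemma iprod_sum_left: "iprod n (\<lambda>i. \<Sum>l\<in>A. u l i) w = (\<Sum>l\<in>A. iprod n (u l) w)"
  by (simp add: iprod_def sum_distrib_right sum.swap[of _ A])

lemma iprod_sum_right: "iprod n w (\<lambda>i. \<Sum>l\<in>A. u l i) = (\<Sum>l\<in>A. iprod n w (u l))"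
  by (simp add: iprod_def sum_distrib_left sum.swap[of _ A])

lemma sqn_add: "sqn n (\<lambda>i. u i + v i) = sqn n u + sqn n v + 2 * Re (iprod n u v)"
proof -
  have "complex_of_real (sqn n (\<lambda>i. u i + v i)) = of_real (sqn n u) + of_real (sqn n v) + (iprod n u v + cnj (iprod n u v))"
    by (simp add: iprod_self[symmetric] iprod_add_left iprod_add_right iprod_cnj)
  also have "\<dots> = of_real (sqn n u + sqn n v + 2 * Re (iprod n u v))"
    by (simp add: complex_add_cnj)
  finally show ?thesis by (simp only: of_real_eq_iff)
qed

lemma sqn_diff: "sqn n (\<lambda>i. u i - v i) = sqn n u + sqn n v - 2 * Re (iprod n u v)"
  using sqn_add[of n u "\<lambda>i. (-1) * v i"] sqn_scale[of n "-1" v] iprod_scale_right[of n u "-1" v] by simp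

lemma sqn_sum_orthogonal:
  assumes "finite A" and "\<And>l m. l \<in> A \<Longrightarrow> m \<in> A \<Longrightarrow> l \<noteq> m \<Longrightarrow> iprod n (u l) (u m) = 0"
  shows "sqn n (\<lambda>i. \<Sum>l\<in>A. c l * u l i) = (\<Sum>l\<in>A. (cmod (c l))\<^sup>2 * sqn n (u l))"
proof -
  have "complex_of_real (sqn n (\<lambda>i. \<Sum>l\<in>A. c l * u l i))
      = (\<Sum>l\<in>A. c l * (\<Sum>m\<in>A. cnj (c m) * iprod n (u l) (u m)))"
    by (simp add: iprod_self[symmetric] iprod_sum_left iprod_sum_right iprod_scale_left iprod_scale_right sum_distrib_left)
  also have "\<dots> = (\<Sum>l\<in>A. c l * (cnj (c l) * iprod n (u l) (u l)))"
  proof (intro sum.cong refl)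
    fix l assume l: "l \<in> A"
    have "(\<Sum>m\<in>A. cnj (c m) * iprod n (u l) (u m)) = (\<Sum>m\<in>A. if m = l then cnj (c l) * iprod n (u l) (u l) else 0)"
      using assms l by (intro sum.cong) auto
    then show "c l * (\<Sum>m\<in>A. cnj (c m) * iprod n (u l) (u m)) = c l * (cnj (c l) * iprod n (u l) (u l))"
      using assms l by simp
  qed
  also have "\<dots> = of_real (\<Sum>l\<in>A. (cmod (c l))\<^sup>2 * sqn n (u l))"
    by (simp add: iprod_self complex_norm_square[symmetric] mult.assoc[symmetric] flip: of_real_power)
  finally show ?thesis by (simp only: of_real_eq_iff)
qed

text \<open>Vectors of norm zero are allowed in the system; then \<open>u l\<close> contributes nothing.\<close>

lemma Bessel_residual:
  assumes "finite A" and orth: "\<And>l m. l \<in> A \<Longrightarrow> m \<in> A \<Longrightarrow> l \<noteq> m \<Longrightarrow> iprod n (u l) (u m) = 0"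
    and unit: "\<And>l. l \<in> A \<Longrightarrow> sqn n (u l) = 1 \<or> sqn n (u l) = 0"
  shows "sqn n (\<lambda>i. x i - (\<Sum>l\<in>A. iprod n x (u l) * u l i)) = sqn n x - (\<Sum>l\<in>A. (cmod (iprod n x (u l)))\<^sup>2)"
proof -
  have z: "iprod n x (u l) = 0" if "l \<in> A" "sqn n (u l) = 0" for l
    using that by (simp add: sqn_eq_0_iff iprod_def)
  have "sqn n (\<lambda>i. \<Sum>l\<in>A. iprod n x (u l) * u l i) = (\<Sum>l\<in>A. (cmod (iprod n x (u l)))\<^sup>2)"
  proof (subst sqn_sum_orthogonal)
    show "(\<Sum>l\<in>A. (cmod (iprod n x (u l)))\<^sup>2 * sqn n (u l)) = (\<Sum>l\<in>A. (cmod (iprod n x (u l)))\<^sup>2)"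
    proof (intro sum.cong refl)
      fix l assume "l \<in> A"
      then show "(cmod (iprod n x (u l)))\<^sup>2 * sqn n (u l) = (cmod (iprod n x (u l)))\<^sup>2"
        using unit[of l] z[of l] by auto
    qed
  qed (use assms in auto)
  moreover have "iprod n x (\<lambda>i. \<Sum>l\<in>A. iprod n x (u l) * u l i) = (\<Sum>l\<in>A. iprod n x (u l) * cnj (iprod n x (u l)))"
    by (simp add: iprod_sum_right iprod_scale_right) (simp add: mult.commute)
  ultimately show ?thesis
    by (simp add: sqn_diff complex_norm_square[symmetric] flip: of_real_power)
qed

lemma Bessel_inequality:
  assumes "finite A" and "\<And>l m. l \<in> A \<Longrightarrow> m \<in> A \<Longrightarrow> l \<noteq> m \<Longrightarrow> iprod n (u l) (u m) = 0"
    and "\<And>l. l \<in> A \<Longrightarrow> sqn n (u l) = 1 \<or> sqn n (u l) = 0"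
  shows "(\<Sum>l\<in>A. (cmod (iprod n x (u l)))\<^sup>2) \<le> sqn n x"
  using Bessel_residual[OF assms, where x = x] sqn_nonneg[of n "\<lambda>i. x i - (\<Sum>l\<in>A. iprod n x (u l) * u l i)"] by simp

section \<open>Hermitian forms and their eigenvectors\<close>

definition hermitian :: "nat \<Rightarrow> (nat \<Rightarrow> nat \<Rightarrow> complex) \<Rightarrow> bool" where
  "hermitian n h \<longleftrightarrow> (\<forall>i<n. \<forall>j<n. h j i = cnj (h i j))"

definition qform :: "nat \<Rightarrow> (nat \<Rightarrow> nat \<Rightarrow> complex) \<Rightarrow> (nat \<Rightarrow> complex) \<Rightarrow> real" where
  "qform n h v = Re (\<Sum>i<n. \<Sum>j<n. cnj (v i) * h i j * v j)"

definition apply_mat :: "nat \<Rightarrow> (nat \<Rightarrow> nat \<Rightarrow> complex) \<Rightarrow> (nat \<Rightarrow> complex) \<Rightarrow> nat \<Rightarrow> complex" where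
  "apply_mat n h v = (\<lambda>i. \<Sum>j<n. h i j * v j)"

lemma qform_iprod: "qform n h v = Re (iprod n (apply_mat n h v) v)"
  unfolding qform_def iprod_def apply_mat_def
  by (intro arg_cong[where f=Re] sum.cong refl) (simp add: sum_distrib_left mult.commute mult.left_commute)

lemma apply_mat_add: "apply_mat n h (\<lambda>i. u i + v i) = (\<lambda>i. apply_mat n h u i + apply_mat n h v i)"
  by (simp add: apply_mat_def algebra_simps sum.distrib)

lemma apply_mat_scale: "apply_mat n h (\<lambda>i. c * u i) = (\<lambda>i. c * apply_mat n h u i)"
  by (simp add: apply_mat_def algebra_simps sum_distrib_left)

lemma hermitian_iprod:
  assumes "hermitian n h"
  shows "iprod n (apply_mat n h u) v = iprod n u (apply_mat n h v)"
proof -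
  have "iprod n (apply_mat n h u) v = (\<Sum>i<n. \<Sum>j<n. h i j * u j * cnj (v i))"
    by (simp add: iprod_def apply_mat_def sum_distrib_right)
  also have "\<dots> = (\<Sum>j<n. \<Sum>i<n. h i j * u j * cnj (v i))" by (rule sum.swap)
  also have "\<dots> = (\<Sum>j<n. \<Sum>i<n. u j * cnj (h j i * v i))"
  proof (intro sum.cong refl)
    fix i j assume "j \<in> {..<n}" "i \<in> {..<n}"
    then have "h i j = cnj (h j i)" using assms unfolding hermitian_def by blast
    then show "h i j * u j * cnj (v i) = u j * cnj (h j i * v i)" by simp
  qed
  also have "\<dots> = iprod n u (apply_mat n h v)"
    by (simp add: iprod_def apply_mat_def sum_distrib_left)
  finally show ?thesis .
qed

lemma iprod_cong: "(\<And>i. i < n \<Longrightarrow> u i = u' i) \<Longrightarrow> (\<And>i. i < n \<Longrightarrow> v i = v' i) \<Longrightarrow> iprod n u v = iprod n u' v'"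
  by (simp add: iprod_def)

text \<open>Forcing the entries from \<open>n\<close> on to vanish puts the sphere into a product of
  closed discs and points, which is compact by Tychonoff; the other conditions are closed. This
  supplies the maximiser of the Rayleigh quotient.\<close>

lemma compact_support_unit_sphere:
  "compact {v. (\<forall>i\<ge>n. v i = 0) \<and> sqn n v = 1 \<and> (\<forall>l\<in>A. iprod n v (u l) = 0)}"
proof -
  let ?S = "\<lambda>i. if i < n then cball (0::complex) 1 else {0}"
  have "compactin (product_topology (\<lambda>i. euclidean) UNIV) (PiE UNIV ?S)"
    unfolding compactin_PiE by (auto simp: compactin_euclidean_iff)
  then have c: "compact (PiE UNIV ?S)"
    by (simp add: euclidean_product_topology compactin_euclidean_iff)
  have cont: "continuous_on UNIV (\<lambda>v::nat\<Rightarrow>complex. v i)" for i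
    by (rule continuous_on_product_coordinates)
  have "closed {v. sqn n v = 1}" "\<And>l. closed {v. iprod n v (u l) = 0}" "\<And>i. closed {v::nat\<Rightarrow>complex. v i = 0}"
    unfolding sqn_def iprod_def by (intro closed_Collect_eq continuous_intros cont)+
  then have cl: "closed ({v. sqn n v = 1} \<inter> (\<Inter>l\<in>A. {v. iprod n v (u l) = 0}) \<inter> (\<Inter>i\<in>{n..}. {v. v i = 0}))"
    by (intro closed_Int closed_INT ballI) auto
  have eq: "{v. (\<forall>i\<ge>n. v i = 0) \<and> sqn n v = 1 \<and> (\<forall>l\<in>A. iprod n v (u l) = 0)} =
      PiE UNIV ?S \<inter> ({v. sqn n v = 1} \<inter> (\<Inter>l\<in>A. {v. iprod n v (u l) = 0}) \<inter> (\<Inter>i\<in>{n..}. {v. v i = 0}))"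
  proof (intro equalityI subsetI)
    fix v assume "v \<in> {v. (\<forall>i\<ge>n. v i = 0) \<and> sqn n v = 1 \<and> (\<forall>l\<in>A. iprod n v (u l) = 0)}"
    then have v: "\<And>i. i \<ge> n \<Longrightarrow> v i = 0" "sqn n v = 1" "\<And>l. l \<in> A \<Longrightarrow> iprod n v (u l) = 0" by auto
    have "cmod (v i) \<le> 1" if "i < n" for i
    proof -
      have "(cmod (v i))\<^sup>2 \<le> sqn n v" unfolding sqn_def using that by (intro member_le_sum) auto
      then show ?thesis using v(2) by (simp add: abs_square_le_1)
    qed
    then show "v \<in> PiE UNIV ?S \<inter> ({v. sqn n v = 1} \<inter> (\<Inter>l\<in>A. {v. iprod n v (u l) = 0}) \<inter> (\<Inter>i\<in>{n..}. {v. v i = 0}))"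
      using v by (auto simp: PiE_iff not_less)
  qed auto
  show ?thesis unfolding eq by (rule compact_Int_closed[OF c cl])
qed

lemma continuous_on_qform: "continuous_on S (qform n h)"
proof -
  have "continuous_on UNIV (\<lambda>v::nat\<Rightarrow>complex. v i)" for i
    by (rule continuous_on_product_coordinates)
  then have "continuous_on S (\<lambda>v::nat\<Rightarrow>complex. v i)" for i
    by (rule continuous_on_subset) auto
  then show ?thesis unfolding qform_def[abs_def] by (intro continuous_intros)
qed

text \<open>The choice \<open>t = - r / s\<close>, or \<open>t = - r\<close> if
  \<open>s \<le> 0\<close>, makes the right hand side negative unless \<open>r = 0\<close>. It
  stands in for a vanishing derivative at a maximum.\<close>

lemma nonneg_quadratic_linear_part:
  fixes r s :: real
  assumes "\<And>t. 0 \<le> 2 * t * r + t\<^sup>2 * s" shows "r = 0"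
proof (rule ccontr)
  assume r: "r \<noteq> 0"
  show False
  proof (cases "s \<le> 0")
    case True
    have "2 * (-r) * r + (-r)\<^sup>2 * s = - (r\<^sup>2 * (2 - s))" by (simp add: power2_eq_square algebra_simps)
    moreover have "r\<^sup>2 * (2 - s) > 0" using r True by simp
    ultimately show False using assms[of "-r"] by linarith
  next
    case False
    have "2 * (-r/s) * r + (-r/s)\<^sup>2 * s = - (r\<^sup>2 / s)" using False by (simp add: power2_eq_square field_simps)
    moreover have "r\<^sup>2 / s > 0" using r False by simp
    ultimately show False using assms[of "-r/s"] by linarith
  qed
qed

text \<open>A maximiser of the Rayleigh quotient on the orthogonal complement of the eigenvectors found so
  far is a further eigenvector.\<close>

lemma next_eigenvector:
  assumes h: "hermitian n h" and m: "m < n"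
    and on: "\<And>l l'. l < m \<Longrightarrow> l' < m \<Longrightarrow> iprod n (u l) (u l') = (if l = l' then 1 else 0)"
    and ev: "\<And>l i. l < m \<Longrightarrow> i < n \<Longrightarrow> apply_mat n h (u l) i = of_real (d l) * u l i"
  obtains v \<mu> where "sqn n v = 1" "\<And>l. l < m \<Longrightarrow> iprod n v (u l) = 0"
    "\<And>i. i < n \<Longrightarrow> apply_mat n h v i = of_real \<mu> * v i"
proof -
  define S where "S = {v. (\<forall>i\<ge>n. v i = 0) \<and> sqn n v = 1 \<and> (\<forall>l\<in>{..<m}. iprod n v (u l) = 0)}"
  have unit: "sqn n (u l) = 1" if "l < m" for l
    using on[OF that that] iprod_self[of n "u l"] by (metis of_real_eq_1_iff)
  have scl: "sqn n (u l) = 1 \<or> sqn n (u l) = 0" if "l \<in> {..<m}" for l using unit that by auto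
  have orth: "iprod n (u l) (u l') = 0" if "l \<in> {..<m}" "l' \<in> {..<m}" "l \<noteq> l'" for l l' using on that by auto
  \<comment> \<open>On the indices below \<open>n\<close>, every nonzero vector of the orthogonal
    complement is a positive multiple of a point of \<open>S\<close>; its entries from
    \<open>n\<close> on are cut off to land in \<open>S\<close>.\<close>
  have norml: "\<exists>v'\<in>S. \<exists>c::real. c > 0 \<and> (\<forall>i<n. x i = of_real c * v' i) \<and> sqn n x = c\<^sup>2"
    if x: "sqn n x \<noteq> 0" "\<And>l. l < m \<Longrightarrow> iprod n x (u l) = 0" for x
  proof -
    let ?c = "sqrt (sqn n x)"
    have c: "?c > 0" using x(1) sqn_nonneg[of n x] by (simp add: less_le)
    let ?v = "\<lambda>i. if i < n then of_real (1 / ?c) * x i else 0"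
    have "sqn n ?v = sqn n (\<lambda>i. of_real (1 / ?c) * x i)" by (simp add: sqn_def)
    also have "\<dots> = 1"
      unfolding sqn_scale using c x(1) by (simp add: power_divide norm_divide)
    finally have 1: "sqn n ?v = 1" .
    have "iprod n ?v (u l) = iprod n (\<lambda>i. of_real (1 / ?c) * x i) (u l)" for l by (rule iprod_cong) auto
    then have "iprod n ?v (u l) = 0" if "l < m" for l by (simp only: iprod_scale_left x(2)[OF that]) simp
    then have "?v \<in> S" using 1 by (auto simp: S_def)
    moreover have "\<forall>i<n. x i = of_real ?c * ?v i" using c by auto
    ultimately show ?thesis using c by (intro bexI[of _ ?v] exI[of _ ?c]) auto
  qed
  have "\<exists>x. sqn n x \<noteq> 0 \<and> (\<forall>l<m. iprod n x (u l) = 0)"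
  proof -
    let ?e = "\<lambda>i j. if j = i then 1 else 0 :: complex"
    have e: "iprod n (?e i) v = cnj (v i)" if "i < n" for i v
    proof -
      have "iprod n (?e i) v = (\<Sum>j<n. if j = i then cnj (v i) else 0)"
        unfolding iprod_def by (intro sum.cong) auto
      then show ?thesis using that by simp
    qed
    have se: "sqn n (?e i) = 1" if "i < n" for i
    proof -
      have "sqn n (?e i) = (\<Sum>j<n. if j = i then 1 else 0)" unfolding sqn_def by (intro sum.cong) auto
      then show ?thesis using that by simp
    qed
    \<comment> \<open>Counting: summed over all i, the squared lengths of the projections of the
      unit vectors onto the span of the \<open>u l\<close> give m < n. So some unit vector lies
      outside the span, and its Bessel residual is a nonzero vector of the complement.\<close>
    have "\<exists>i<n. (\<Sum>l<m. (cmod (u l i))\<^sup>2) < 1"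
    proof (rule ccontr)
      assume "\<not> ?thesis"
      then have "1 \<le> (\<Sum>l<m. (cmod (u l i))\<^sup>2)" if "i < n" for i using that by (meson not_less)
      then have "(\<Sum>i<n. 1) \<le> (\<Sum>i<n. \<Sum>l<m. (cmod (u l i))\<^sup>2)" by (intro sum_mono) simp
      also have "\<dots> = (\<Sum>l<m. sqn n (u l))" unfolding sqn_def by (rule sum.swap)
      also have "\<dots> = real m" using unit by simp
      finally show False using m by simp
    qed
    then obtain i where i: "i < n" "(\<Sum>l<m. (cmod (u l i))\<^sup>2) < 1" by blast
    let ?x = "\<lambda>j. ?e i j - (\<Sum>l\<in>{..<m}. iprod n (?e i) (u l) * u l j)"
    have "sqn n ?x = 1 - (\<Sum>l<m. (cmod (u l i))\<^sup>2)"
      by (subst Bessel_residual) (use scl orth i in \<open>simp_all add: e se\<close>)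
    moreover have "iprod n ?x (u l) = 0" if "l < m" for l
    proof -
      have "iprod n ?x (u l) = cnj (u l i) - (\<Sum>l'<m. cnj (u l' i) * iprod n (u l') (u l))"
        by (simp add: iprod_diff_left iprod_sum_left iprod_scale_left e i)
      also have "(\<Sum>l'<m. cnj (u l' i) * iprod n (u l') (u l)) = (\<Sum>l'<m. if l' = l then cnj (u l i) else 0)"
        using that by (intro sum.cong) (auto simp: on)
      finally show ?thesis using that by simp
    qed
    ultimately show ?thesis using i by (intro exI[of _ ?x]) auto
  qed
  then obtain x where x: "sqn n x \<noteq> 0" "\<And>l. l < m \<Longrightarrow> iprod n x (u l) = 0" by blast
  then have ne: "S \<noteq> {}" using norml by blast
  have "compact S" unfolding S_def by (rule compact_support_unit_sphere)
  then obtain v where v: "v \<in> S" and vmax: "\<And>w. w \<in> S \<Longrightarrow> qform n h w \<le> qform n h v"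
    using continuous_attains_sup[OF _ ne continuous_on_qform] by blast
  define \<mu> where "\<mu> = qform n h v"
  have sv: "sqn n v = 1" and ov: "\<And>l. l < m \<Longrightarrow> iprod n v (u l) = 0" using v by (auto simp: S_def)
  have le: "qform n h w \<le> \<mu> * sqn n w" if w: "\<And>l. l < m \<Longrightarrow> iprod n w (u l) = 0" for w
  proof (cases "sqn n w = 0")
    case True
    then have "w i = 0" if "i < n" for i using that by (simp add: sqn_eq_0_iff)
    then have "qform n h w = 0" by (simp add: qform_def)
    then show ?thesis using True by simp
  next
    case False
    from norml[OF False w] obtain v' and c :: real where v': "v' \<in> S" "c > 0" "\<And>i. i < n \<Longrightarrow> w i = of_real c * v' i" "sqn n w = c\<^sup>2"
      by blast
    have "qform n h w = qform n h (\<lambda>i. of_real c * v' i)"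
      unfolding qform_def using v'(3) by simp
    also have "\<dots> = c\<^sup>2 * qform n h v'"
      by (simp add: qform_iprod apply_mat_scale iprod_scale_left iprod_scale_right power2_eq_square)
    also have "\<dots> \<le> c\<^sup>2 * \<mu>" using vmax[OF v'(1)] by (simp add: \<mu>_def mult_left_mono)
    finally show ?thesis using v'(4) by (simp add: mult.commute)
  qed
  \<comment> \<open>The aim is \<open>r = 0\<close>. Being orthogonal to the earlier
    \<open>u l\<close>, it is an allowed direction in which to perturb the maximiser
    \<open>v\<close>.\<close>
  define r where "r = (\<lambda>i. of_real \<mu> * v i - apply_mat n h v i)"
  have or: "iprod n r (u l) = 0" if l: "l < m" for l
  proof -
    have "iprod n (apply_mat n h v) (u l) = iprod n v (\<lambda>i. of_real (d l) * u l i)"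
      unfolding hermitian_iprod[OF h] using ev[OF l] by (intro iprod_cong) auto
    then show ?thesis unfolding r_def by (simp add: iprod_diff_left iprod_scale_left iprod_scale_right ov[OF l])
  qed
  \<comment> \<open>Maximality along \<open>v + t r\<close> gives a quadratic inequality in t whose
    linear coefficient is twice \<open>sqn n r\<close>.\<close>
  have "sqn n r = 0"
  proof (rule nonneg_quadratic_linear_part)
    fix t :: real
    let ?w = "\<lambda>i. v i + of_real t * r i"
    have "iprod n ?w (u l) = 0" if "l < m" for l
      using that by (simp add: iprod_add_left iprod_scale_left ov or)
    then have le: "qform n h ?w \<le> \<mu> * sqn n ?w" by (rule le)
    have sw: "sqn n ?w = 1 + 2 * t * Re (iprod n v r) + t\<^sup>2 * sqn n r"
      by (simp add: sqn_add sv sqn_scale iprod_scale_right)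
    have hr: "Re (iprod n (apply_mat n h r) v) = Re (iprod n (apply_mat n h v) r)"
      unfolding hermitian_iprod[OF h, of r] by (metis iprod_cnj complex_cnj(1) complex.sel(1) cnj.simps(1))
    have qw: "qform n h ?w = \<mu> + 2 * t * Re (iprod n (apply_mat n h v) r) + t\<^sup>2 * qform n h r"
      unfolding \<mu>_def qform_iprod
      by (simp add: apply_mat_add apply_mat_scale iprod_add_left iprod_add_right iprod_scale_left
          iprod_scale_right hr algebra_simps power2_eq_square)
    have "Re (iprod n r r) = \<mu> * Re (iprod n v r) - Re (iprod n (apply_mat n h v) r)"
      by (subst r_def) (simp add: iprod_diff_left iprod_scale_left)
    then have rr: "sqn n r = \<mu> * Re (iprod n v r) - Re (iprod n (apply_mat n h v) r)"
      by (simp add: iprod_self)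
    have "\<mu> * (1 + 2 * t * Re (iprod n v r) + t\<^sup>2 * sqn n r) - (\<mu> + 2 * t * Re (iprod n (apply_mat n h v) r) + t\<^sup>2 * qform n h r)
      = 2 * t * sqn n r + t\<^sup>2 * (\<mu> * sqn n r - qform n h r)"
      unfolding rr[symmetric] by (subst (2) rr) (simp add: algebra_simps)
    then show "0 \<le> 2 * t * sqn n r + t\<^sup>2 * (\<mu> * sqn n r - qform n h r)"
      using le unfolding sw qw by simp
  qed
  then have "apply_mat n h v i = of_real \<mu> * v i" if "i < n" for i
    using that by (auto simp: sqn_eq_0_iff r_def)
  then show thesis using that sv ov by blast
qed

definition orthonormal :: "nat \<Rightarrow> (nat \<Rightarrow> nat \<Rightarrow> complex) \<Rightarrow> bool" where
  "orthonormal n u \<longleftrightarrow> (\<forall>l<n. \<forall>m<n. iprod n (u l) (u m) = (if l = m then 1 else 0))"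

theorem hermitian_diagonalization:
  assumes h: "hermitian n h"
  obtains u d where "orthonormal n u"
    "\<And>l i. l < n \<Longrightarrow> i < n \<Longrightarrow> apply_mat n h (u l) i = of_real (d l) * u l i"
proof -
  have "\<exists>u d. (\<forall>l<m. \<forall>l'<m. iprod n (u l) (u l') = (if l = l' then 1 else 0)) \<and>
      (\<forall>l<m. \<forall>i<n. apply_mat n h (u l) i = of_real (d l) * u l i)" if "m \<le> n" for m
    using that
  proof (induction m)
    case 0
    then show ?case by simp
  next
    case (Suc m)
    then obtain u d where ud: "\<And>l l'. l < m \<Longrightarrow> l' < m \<Longrightarrow> iprod n (u l) (u l') = (if l = l' then 1 else 0)"
      "\<And>l i. l < m \<Longrightarrow> i < n \<Longrightarrow> apply_mat n h (u l) i = of_real (d l) * u l i"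
      using Suc.IH[OF Suc_leD[OF Suc.prems]] by blast
    have "m < n" using Suc.prems by simp
    from next_eigenvector[OF h this ud] obtain v \<mu> where v: "sqn n v = 1" "\<And>l. l < m \<Longrightarrow> iprod n v (u l) = 0"
      "\<And>i. i < n \<Longrightarrow> apply_mat n h v i = of_real \<mu> * v i" by blast
    have v': "\<And>l. l < m \<Longrightarrow> iprod n (u l) v = 0" using v(2) by (metis iprod_cnj complex_cnj_zero)
    let ?u = "\<lambda>l. if l < m then u l else v" and ?d = "\<lambda>l. if l < m then d l else \<mu>"
    have "\<forall>l<Suc m. \<forall>l'<Suc m. iprod n (?u l) (?u l') = (if l = l' then 1 else 0)"
    proof (intro allI impI)
      fix l l' assume "l < Suc m" "l' < Suc m"
      then have "l < m \<or> l = m" "l' < m \<or> l' = m" by auto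
      then show "iprod n (?u l) (?u l') = (if l = l' then 1 else 0)"
        using v(1) by (elim disjE) (simp_all add: ud(1) v(2) v' iprod_self)
    qed
    moreover have "\<forall>l<Suc m. \<forall>i<n. apply_mat n h (?u l) i = of_real (?d l) * ?u l i"
    proof (intro allI impI)
      fix l i assume "l < Suc m" "i < n"
      then show "apply_mat n h (?u l) i = of_real (?d l) * ?u l i"
        by (cases "l < m") (simp_all add: ud(2) v(3))
    qed
    ultimately show ?case by (intro exI[of _ ?u] exI[of _ ?d] conjI)
  qed
  from this[of n] obtain u d where "orthonormal n u"
    "\<forall>l<n. \<forall>i<n. apply_mat n h (u l) i = of_real (d l) * u l i"
    unfolding orthonormal_def by auto
  then show thesis using that[of u d] by simp
qed

text \<open>Completeness by counting: the squared residuals of the standard unit vectors after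
  projection onto the \<open>u l\<close> are nonnegative and sum to n - n = 0, so each of them
  vanishes.\<close>

lemma orthonormal_expansion:
  assumes "orthonormal n u" and "i < n"
  shows "x i = (\<Sum>l<n. iprod n x (u l) * u l i)"
    and "sqn n x = (\<Sum>l<n. (cmod (iprod n x (u l)))\<^sup>2)"
proof -
  have unit: "sqn n (u l) = 1" if "l < n" for l
    using assms that iprod_self[of n "u l"] unfolding orthonormal_def by (metis of_real_eq_1_iff)
  have scl: "sqn n (u l) = 1 \<or> sqn n (u l) = 0" if "l \<in> {..<n}" for l using unit that by auto
  have orth: "iprod n (u l) (u l') = 0" if "l \<in> {..<n}" "l' \<in> {..<n}" "l \<noteq> l'" for l l'
    using assms that by (auto simp: orthonormal_def)
  let ?e = "\<lambda>i j. if j = i then 1 else 0 :: complex"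
  have e: "iprod n (?e i) v = cnj (v i)" if "i < n" for i v
  proof -
    have "iprod n (?e i) v = (\<Sum>j<n. if j = i then cnj (v i) else 0)"
      unfolding iprod_def by (intro sum.cong) auto
    then show ?thesis using that by simp
  qed
  have se: "sqn n (?e i) = 1" if "i < n" for i
  proof -
    have "sqn n (?e i) = (\<Sum>j<n. if j = i then 1 else 0)" unfolding sqn_def by (intro sum.cong) auto
    then show ?thesis using that by simp
  qed
  have res: "sqn n (\<lambda>j. ?e i j - (\<Sum>l\<in>{..<n}. iprod n (?e i) (u l) * u l j)) = 1 - (\<Sum>l<n. (cmod (u l i))\<^sup>2)"
    if "i < n" for i
    by (subst Bessel_residual) (use scl orth that in \<open>simp_all add: e se\<close>)
  have le: "(\<Sum>l<n. (cmod (u l i))\<^sup>2) \<le> 1" if "i < n" for i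
  proof -
    have "0 \<le> 1 - (\<Sum>l<n. (cmod (u l i))\<^sup>2)" unfolding res[OF that, symmetric] by simp
    then show ?thesis by simp
  qed
  have "(\<Sum>i<n. 1 - (\<Sum>l<n. (cmod (u l i))\<^sup>2)) = real n - (\<Sum>l<n. sqn n (u l))"
  proof -
    have "(\<Sum>i<n. \<Sum>l<n. (cmod (u l i))\<^sup>2) = (\<Sum>l<n. sqn n (u l))" unfolding sqn_def by (rule sum.swap)
    then show ?thesis by (simp add: sum_subtractf)
  qed
  also have "\<dots> = 0" using unit by simp
  finally have "\<forall>i\<in>{..<n}. 1 - (\<Sum>l<n. (cmod (u l i))\<^sup>2) = 0"
    by (subst (asm) sum_nonneg_eq_0_iff) (use le in auto)
  then have z: "?e i j = (\<Sum>l<n. cnj (u l i) * u l j)" if "i < n" "j < n" for i j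
    using res[OF that(1)] that by (simp add: sqn_eq_0_iff e)
  have exp: "x i = (\<Sum>l<n. iprod n x (u l) * u l i)" if "i < n" for i
  proof -
    have "(\<Sum>j<n. x j * ?e j i) = (\<Sum>j<n. if j = i then x j else 0)" by (intro sum.cong) auto
    then have "x i = (\<Sum>j<n. x j * ?e j i)" using that by simp
    also have "\<dots> = (\<Sum>j<n. \<Sum>l<n. x j * cnj (u l j) * u l i)"
      by (intro sum.cong refl) (simp add: z that sum_distrib_left mult.assoc)
    also have "\<dots> = (\<Sum>l<n. \<Sum>j<n. x j * cnj (u l j) * u l i)" by (rule sum.swap)
    finally show ?thesis by (simp add: iprod_def sum_distrib_right)
  qed
  then show "x i = (\<Sum>l<n. iprod n x (u l) * u l i)" using assms by blast
  have "sqn n x = sqn n (\<lambda>i. \<Sum>l\<in>{..<n}. iprod n x (u l) * u l i)"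
    unfolding sqn_def using exp by simp
  also have "\<dots> = (\<Sum>l<n. (cmod (iprod n x (u l)))\<^sup>2)"
    by (subst sqn_sum_orthogonal) (use orth unit in auto)
  finally show "sqn n x = (\<Sum>l<n. (cmod (iprod n x (u l)))\<^sup>2)" .
qed

section \<open>Contractive systems of vectors and the singular value decomposition\<close>

text \<open>\<open>p l j\<close> is the \<open>j\<close>-th coordinate of the \<open>l\<close>-th vector; the condition says that the adjoint of
  the matrix with these columns, hence the matrix itself, is a contraction.\<close>

definition bessel :: "nat \<Rightarrow> (nat \<Rightarrow> nat \<Rightarrow> complex) \<Rightarrow> bool" where
  "bessel n p \<longleftrightarrow> (\<forall>x. (\<Sum>l<n. (cmod (\<Sum>j<n. x j * p l j))\<^sup>2) \<le> sqn n x)"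

lemma bessel_cnj:
  assumes "bessel n p" shows "bessel n (\<lambda>l j. cnj (p l j))"
  unfolding bessel_def
proof
  fix x
  have "(\<Sum>l<n. (cmod (\<Sum>j<n. x j * cnj (p l j)))\<^sup>2) = (\<Sum>l<n. (cmod (\<Sum>j<n. cnj (x j) * p l j))\<^sup>2)"
    by (intro sum.cong refl arg_cong[where f="\<lambda>t. t\<^sup>2"], subst complex_mod_cnj[symmetric]) simp
  also have "\<dots> \<le> sqn n x" using assms[unfolded bessel_def, rule_format, of "\<lambda>j. cnj (x j)"] by simp
  finally show "(\<Sum>l<n. (cmod (\<Sum>j<n. x j * cnj (p l j)))\<^sup>2) \<le> sqn n x" .
qed

text \<open>Testing the contraction with the conjugate of \<open>p m\<close> gives
  \<open>(sqn n (p m))\<^sup>2 \<le> sqn n (p m)\<close>.\<close>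

lemma bessel_unit:
  assumes "bessel n p" "m < n" shows "sqn n (p m) \<le> 1"
proof -
  have "(sqn n (p m))\<^sup>2 = (cmod (\<Sum>j<n. cnj (p m j) * p m j))\<^sup>2"
    by (metis (no_types, lifting) iprod_def iprod_self mult.commute norm_of_real power2_abs sum.cong)
  also have "\<dots> \<le> (\<Sum>l<n. (cmod (\<Sum>j<n. cnj (p m j) * p l j))\<^sup>2)"
    using assms(2) by (intro member_le_sum) auto
  also have "\<dots> \<le> sqn n (p m)"
    using assms(1)[unfolded bessel_def, rule_format, of "\<lambda>j. cnj (p m j)"] by simp
  finally have "sqn n (p m) * sqn n (p m) \<le> sqn n (p m) * 1" by (simp add: power2_eq_square)
  then show ?thesis by (metis mult_le_cancel_left_pos sqn_nonneg less_le zero_le_one)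
qed

definition hsn :: "nat \<Rightarrow> (nat \<Rightarrow> nat \<Rightarrow> complex) \<Rightarrow> real" where
  "hsn n X = (\<Sum>i<n. \<Sum>j<n. (cmod (X i j))\<^sup>2)"

text \<open>If the \<open>u l\<close> are orthonormal eigenvectors of the adjoint of
  \<open>X\<close> times \<open>X\<close>, their images \<open>y l\<close> under \<open>X\<close>
  are pairwise orthogonal. The lengths of these images are the singular values, and normalising them
  gives \<open>p\<close>.\<close>

theorem singular_value_decomposition:
  obtains \<sigma> p v where "\<And>l. \<sigma> l \<ge> 0" "bessel n p" "bessel n v"
    "\<And>i j. i < n \<Longrightarrow> j < n \<Longrightarrow> X i j = (\<Sum>l<n. of_real (\<sigma> l) * p l i * cnj (v l j))"
    "(\<Sum>l<n. (\<sigma> l)\<^sup>2) = hsn n X"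
proof -
  define h where "h = (\<lambda>i j. \<Sum>k<n. cnj (X k i) * X k j)"
  have "hermitian n h" by (auto simp: hermitian_def h_def mult.commute)
  then obtain u d where u: "orthonormal n u"
    and ev: "\<And>l i. l < n \<Longrightarrow> i < n \<Longrightarrow> apply_mat n h (u l) i = of_real (d l) * u l i"
    using hermitian_diagonalization by blast
  define y where "y = (\<lambda>l. apply_mat n X (u l))"
  have yh: "iprod n (apply_mat n X x) (apply_mat n X w) = iprod n (apply_mat n h x) w" for x w
  proof -
    have "iprod n (apply_mat n X x) (apply_mat n X w) = (\<Sum>k<n. \<Sum>i<n. \<Sum>j<n. X k j * x j * cnj (X k i) * cnj (w i))"
      unfolding iprod_def apply_mat_def by (simp add: sum_distrib_left sum_distrib_right mult.assoc)
    also have "\<dots> = (\<Sum>i<n. \<Sum>j<n. \<Sum>k<n. X k j * x j * cnj (X k i) * cnj (w i))"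
      by (subst sum.swap) (intro sum.cong refl sum.swap)
    also have "\<dots> = iprod n (apply_mat n h x) w"
      unfolding iprod_def apply_mat_def h_def
      by (simp add: sum_distrib_left sum_distrib_right mult_ac)
    finally show ?thesis .
  qed
  have orth: "iprod n (y l) (y m) = 0" if "l < n" "m < n" "l \<noteq> m" for l m
  proof -
    have "iprod n (y l) (y m) = iprod n (\<lambda>i. of_real (d l) * u l i) (u m)"
      unfolding y_def yh using ev that by (intro iprod_cong) auto
    then show ?thesis using u that by (simp add: iprod_scale_left orthonormal_def)
  qed
  define \<sigma> where "\<sigma> = (\<lambda>l. sqrt (sqn n (y l)))"
  \<comment> \<open>If \<open>\<sigma> l = 0\<close>, then \<open>1 / \<sigma> l = 0\<close> and
    \<open>p l\<close> is the zero vector. This is why the system is only claimed to be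
    \<open>bessel\<close>, not orthonormal.\<close>
  define p where "p = (\<lambda>l i. of_real (1 / \<sigma> l) * y l i)"
  have yp: "y l i = of_real (\<sigma> l) * p l i" if "i < n" for l i
    using that by (cases "\<sigma> l = 0") (auto simp: p_def \<sigma>_def sqn_eq_0_iff)
  have "(\<Sum>l\<in>{..<n}. (cmod (iprod n x (p l)))\<^sup>2) \<le> sqn n x" for x
  proof (rule Bessel_inequality)
    show "iprod n (p l) (p m) = 0" if "l \<in> {..<n}" "m \<in> {..<n}" "l \<noteq> m" for l m
      using orth[of l m] that unfolding p_def iprod_scale_left iprod_scale_right by simp
    show "sqn n (p l) = 1 \<or> sqn n (p l) = 0" for l
      unfolding p_def sqn_scale by (auto simp: \<sigma>_def norm_divide power_divide)
  qed auto
  then have p: "bessel n p"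
    using bessel_cnj[of n "\<lambda>l j. cnj (p l j)"] by (simp add: bessel_def iprod_def)
  have "(\<Sum>l\<in>{..<n}. (cmod (iprod n x (u l)))\<^sup>2) \<le> sqn n x" for x
    by (cases n) (use orthonormal_expansion(2)[OF u, of 0] in auto)
  then have v: "bessel n u"
    using bessel_cnj[of n "\<lambda>l j. cnj (u l j)"] by (simp add: bessel_def iprod_def)
  have "X i j = (\<Sum>l<n. y l i * cnj (u l j))" if "i < n" "j < n" for i j
  proof -
    have "cnj (X i j) = (\<Sum>l<n. iprod n (\<lambda>j. cnj (X i j)) (u l) * u l j)"
      by (rule orthonormal_expansion(1)[OF u that(2), of "\<lambda>j. cnj (X i j)"])
    then have "X i j = cnj (\<Sum>l<n. iprod n (\<lambda>j. cnj (X i j)) (u l) * u l j)" by (metis complex_cnj_cnj)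
    then show ?thesis by (simp add: y_def apply_mat_def iprod_def)
  qed
  then have X: "X i j = (\<Sum>l<n. of_real (\<sigma> l) * p l i * cnj (u l j))" if "i < n" "j < n" for i j
    using that by (simp add: yp)
  have "(\<Sum>l<n. (\<sigma> l)\<^sup>2) = (\<Sum>l<n. sqn n (y l))" by (simp add: \<sigma>_def)
  also have "\<dots> = (\<Sum>l<n. \<Sum>i<n. (cmod (iprod n (\<lambda>j. cnj (X i j)) (u l)))\<^sup>2)"
  proof (unfold sqn_def, intro sum.cong refl)
    fix l i
    have "y l i = cnj (iprod n (\<lambda>j. cnj (X i j)) (u l))" by (simp add: y_def apply_mat_def iprod_def)
    then show "(cmod (y l i))\<^sup>2 = (cmod (iprod n (\<lambda>j. cnj (X i j)) (u l)))\<^sup>2" by simp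
  qed
  also have "\<dots> = (\<Sum>i<n. \<Sum>l<n. (cmod (iprod n (\<lambda>j. cnj (X i j)) (u l)))\<^sup>2)" by (rule sum.swap)
  also have "\<dots> = (\<Sum>i<n. sqn n (\<lambda>j. cnj (X i j)))"
    by (intro sum.cong refl orthonormal_expansion(2)[OF u, symmetric]) simp
  also have "\<dots> = hsn n X" unfolding sqn_cnj by (simp add: hsn_def sqn_def)
  finally show thesis using that[OF _ p v X] by (simp add: \<sigma>_def)
qed

section \<open>Analytic functions on a strip\<close>

definition strip :: "complex set" where "strip = {s. 0 \<le> Re s \<and> Re s \<le> 1}"

definition ostrip :: "complex set" where "ostrip = {s. 0 < Re s \<and> Re s < 1}"

lemma open_ostrip: "open ostrip"
  unfolding ostrip_def Collect_conj_eq
  by (intro open_Int open_Collect_less continuous_intros)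

lemma ostrip_subset_strip: "ostrip \<subseteq> strip"
  by (auto simp: ostrip_def strip_def)

lemma half_in_ostrip: "1/2 \<in> ostrip"
  by (simp add: ostrip_def)

lemma half_in_strip: "1/2 \<in> strip"
  by (simp add: strip_def)

definition strip_fun :: "(complex \<Rightarrow> complex) \<Rightarrow> bool" where
  "strip_fun g \<longleftrightarrow> continuous_on strip g \<and> g holomorphic_on ostrip \<and> (\<exists>B. \<forall>s\<in>strip. cmod (g s) \<le> B)"

lemma strip_fun_const [intro]: "strip_fun (\<lambda>_. c)"
  by (auto simp: strip_fun_def)

lemma strip_fun_add [intro]:
  assumes "strip_fun f" "strip_fun g" shows "strip_fun (\<lambda>s. f s + g s)"
proof -
  from assms obtain A B where "\<forall>s\<in>strip. cmod (f s) \<le> A" "\<forall>s\<in>strip. cmod (g s) \<le> B"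
    unfolding strip_fun_def by blast
  then have "\<forall>s\<in>strip. cmod (f s + g s) \<le> A + B" by (meson add_mono norm_triangle_le)
  then show ?thesis using assms by (auto simp: strip_fun_def intro!: continuous_intros holomorphic_intros)
qed

lemma strip_fun_mult [intro]:
  assumes "strip_fun f" "strip_fun g" shows "strip_fun (\<lambda>s. f s * g s)"
proof -
  from assms obtain A B where AB: "\<And>s. s \<in> strip \<Longrightarrow> cmod (f s) \<le> A" "\<And>s. s \<in> strip \<Longrightarrow> cmod (g s) \<le> B"
    unfolding strip_fun_def by blast
  have "\<forall>s\<in>strip. cmod (f s * g s) \<le> A * B"
  proof
    fix s assume s: "s \<in> strip"
    show "cmod (f s * g s) \<le> A * B" unfolding norm_mult
      using AB[OF s] order_trans[OF norm_ge_zero AB(1)[OF s]] by (intro mult_mono) auto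
  qed
  then show ?thesis using assms by (auto simp: strip_fun_def intro!: continuous_intros holomorphic_intros)
qed

lemma strip_fun_sum [intro]:
  assumes "\<And>i. i \<in> A \<Longrightarrow> strip_fun (f i)" shows "strip_fun (\<lambda>s. \<Sum>i\<in>A. f i s)"
  using assms by (induction A rule: infinite_finite_induct) auto

lemma strip_fun_exp [intro]: "strip_fun (\<lambda>s. exp (s * of_real a))"
proof -
  have "cmod (exp (s * of_real a)) \<le> exp \<bar>a\<bar>" if "s \<in> strip" for s
  proof -
    have "Re s * a \<le> \<bar>Re s * a\<bar>" by simp
    also have "\<dots> \<le> 1 * \<bar>a\<bar>" unfolding abs_mult using that by (intro mult_right_mono) (auto simp: strip_def)
    finally show ?thesis by simp
  qed
  then show ?thesis unfolding strip_fun_def by (intro conjI exI[of _ "exp \<bar>a\<bar>"] ballI)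
      (auto intro!: continuous_intros holomorphic_intros)
qed

text \<open>Two conjugations turn an antilinear occurrence of an analytic function into an analytic
  one. Conjugation of the argument keeps the real part, hence both boundary lines, and fixes the
  point 1/2.\<close>

lemma strip_fun_reflect:
  assumes "strip_fun g" shows "strip_fun (\<lambda>s. cnj (g (cnj s)))"
  unfolding strip_fun_def
proof (intro conjI)
  have im: "cnj ` strip = strip" "cnj ` ostrip = ostrip"
  proof -
    have "x \<in> cnj ` S" if "cnj x \<in> S" for x S by (rule image_eqI[OF _ that]) simp
    then show "cnj ` strip = strip" "cnj ` ostrip = ostrip" by (auto simp: strip_def ostrip_def)
  qed
  show "continuous_on strip (\<lambda>s. cnj (g (cnj s)))"
  proof (intro continuous_on_cnj)
    have "continuous_on strip (g \<circ> cnj)"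
      using assms unfolding strip_fun_def by (intro continuous_on_compose continuous_on_cnj continuous_on_id) (simp add: im)
    then show "continuous_on strip (\<lambda>s. g (cnj s))" by (simp add: o_def)
  qed
  have "(cnj \<circ> g \<circ> cnj) holomorphic_on ostrip"
    using assms by (intro holomorphic_on_compose_cnj_cnj open_ostrip) (simp add: strip_fun_def im)
  then show "(\<lambda>s. cnj (g (cnj s))) holomorphic_on ostrip" by (simp add: o_def)
  obtain B where "\<forall>s\<in>strip. cmod (g s) \<le> B" using assms by (auto simp: strip_fun_def)
  then have "\<forall>s\<in>strip. cmod (cnj (g (cnj s))) \<le> B" by (simp add: strip_def)
  then show "\<exists>B. \<forall>s\<in>strip. cmod (cnj (g (cnj s))) \<le> B" by blast
qed

text \<open>Hadamard's three lines theorem: the factor \<open>exp (\<epsilon> (s\<^sup>2 - 1))\<close> forces decay at both ends of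
  the strip, so that the maximum principle on a long rectangle applies.\<close>

lemma three_lines_pos:
  assumes g: "strip_fun g" and B: "B > 0"
    and bd: "\<And>s. Re s = 0 \<or> Re s = 1 \<Longrightarrow> cmod (g s) \<le> B" and s: "s \<in> strip"
  shows "cmod (g s) \<le> B"
proof -
  obtain M0 where M0: "\<forall>s\<in>strip. cmod (g s) \<le> M0" using g by (auto simp: strip_fun_def)
  define M where "M = max 1 M0"
  have M: "M > 0" "\<And>s. s \<in> strip \<Longrightarrow> cmod (g s) \<le> M" using M0 by (auto simp: M_def max.coboundedI2)
  have ine: "cmod (g s) \<le> B * exp (e * (1 + (Im s)\<^sup>2))" if e: "e > 0" for e
  proof -
    define G where "G = (\<lambda>s. g s * exp (of_real e * (s\<^sup>2 - 1)))"
    have nG: "cmod (G z) = cmod (g z) * exp (e * ((Re z)\<^sup>2 - (Im z)\<^sup>2 - 1))" for z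
      by (simp add: G_def norm_mult power2_eq_square)
    \<comment> \<open>Since \<open>R \<ge> 1\<close>, also \<open>R * R \<ge> M / (e * B)\<close>.
      With \<open>x \<le> exp x\<close> the damping factor then pushes the crude bound
      \<open>M\<close> below \<open>B\<close> on the horizontal edges.\<close>
    define R where "R = \<bar>Im s\<bar> + 1 + \<bar>M / (e * B)\<bar>"
    have R: "R \<ge> 1" "R \<ge> \<bar>Im s\<bar>" "R \<ge> M / (e * B)"
      unfolding R_def using abs_ge_self[of "M / (e * B)"] by linarith+
    have "M / (e * B) \<le> R * R" using R mult_mono[of 1 R "M / (e*B)" R] M e B by simp
    then have "M \<le> B * (e * R\<^sup>2)" using e B by (simp add: field_simps power2_eq_square)
    also have "e * R\<^sup>2 \<le> exp (e * R\<^sup>2)" using exp_ge_add_one_self[of "e * R\<^sup>2"] by linarith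
    then have "B * (e * R\<^sup>2) \<le> B * exp (e * R\<^sup>2)" using B by (intro mult_left_mono) auto
    finally have MR: "M * exp (- e * R\<^sup>2) \<le> B" by (simp add: exp_minus field_simps)
    define S where "S = cbox (Complex 0 (-R)) (Complex 1 R)"
    have S: "z \<in> S \<longleftrightarrow> 0 \<le> Re z \<and> Re z \<le> 1 \<and> -R \<le> Im z \<and> Im z \<le> R" for z
      by (auto simp: S_def in_cbox_complex_iff)
    have iS: "z \<in> interior S \<longleftrightarrow> 0 < Re z \<and> Re z < 1 \<and> -R < Im z \<and> Im z < R" for z
      unfolding S_def interior_cbox by (auto simp: in_box_complex_iff)
    have SS: "S \<subseteq> strip" by (auto simp: S strip_def)
    have "cmod (G s) \<le> B"
    proof (rule maximum_modulus_frontier[of G S B s])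
      show "G holomorphic_on interior S"
        using g unfolding G_def strip_fun_def
        by (intro holomorphic_intros) (auto intro: holomorphic_on_subset simp: iS ostrip_def)
      show "continuous_on (closure S) G"
        using g SS unfolding G_def strip_fun_def
        by (intro continuous_intros) (auto simp: S_def intro: continuous_on_subset)
      show "bounded S" by (simp add: S_def)
      show "s \<in> S" using s R by (auto simp: S strip_def)
      fix z assume "z \<in> frontier S"
      then have z: "z \<in> S" "z \<notin> interior S" by (auto simp: frontier_def S_def)
      have le1: "e * ((Re z)\<^sup>2 - (Im z)\<^sup>2 - 1) \<le> e * (- (Im z)\<^sup>2)"
        using z(1) e by (intro mult_left_mono) (auto simp: S power2_eq_square mult_le_one)
      show "cmod (G z) \<le> B"
      proof (cases "Re z = 0 \<or> Re z = 1")
        case True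
        have "e * (- (Im z)\<^sup>2) \<le> 0" using e by (simp add: mult_le_0_iff)
        then have "exp (e * ((Re z)\<^sup>2 - (Im z)\<^sup>2 - 1)) \<le> 1" using le1 by (simp del: mult_minus_right)
        then show ?thesis unfolding nG using bd[OF True] B mult_mono[of "cmod (g z)" B _ 1] by simp
      next
        case False
        then have "Im z = R \<or> Im z = -R" using z by (auto simp: S iS)
        then have "e * ((Re z)\<^sup>2 - (Im z)\<^sup>2 - 1) \<le> - e * R\<^sup>2" using le1 by auto
        then have "cmod (G z) \<le> M * exp (- e * R\<^sup>2)"
          unfolding nG using M z(1) SS by (intro mult_mono) auto
        then show ?thesis using MR by simp
      qed
    qed
    moreover have "exp (- (e * (1 + (Im s)\<^sup>2))) \<le> exp (e * ((Re s)\<^sup>2 - (Im s)\<^sup>2 - 1))"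
      using e by (simp add: algebra_simps)
    ultimately have "cmod (g s) * exp (- (e * (1 + (Im s)\<^sup>2))) \<le> B"
      unfolding nG by (meson mult_left_mono norm_ge_zero order_trans)
    then show ?thesis unfolding exp_minus by (simp only: divide_inverse[symmetric] pos_divide_le_eq[OF exp_gt_zero])
  qed
  \<comment> \<open>The rectangle has disappeared from the estimate, so \<open>e\<close> may tend to
    0.\<close>
  have "((\<lambda>e. B * exp (e * (1 + (Im s)\<^sup>2))) \<longlongrightarrow> B * exp (0 * (1 + (Im s)\<^sup>2))) (at_right 0)"
    by (intro tendsto_intros)
  then show ?thesis
    using tendsto_lowerbound[of _ B "at_right (0::real)" "cmod (g s)"] ine
    by (simp add: eventually_at_right_less eventually_at_filter)
qed

lemma three_lines:
  assumes g: "strip_fun g" and B: "B \<ge> 0"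
    and bd: "\<And>s. Re s = 0 \<or> Re s = 1 \<Longrightarrow> cmod (g s) \<le> B" and s: "s \<in> strip"
  shows "cmod (g s) \<le> B"
proof (rule field_le_epsilon)
  fix e :: real assume e: "e > 0"
  show "cmod (g s) \<le> B + e"
  proof (rule three_lines_pos[OF g _ _ s])
    fix s :: complex assume "Re s = 0 \<or> Re s = 1"
    from bd[OF this] show "cmod (g s) \<le> B + e" using e by simp
  qed (use B e in auto)
qed

section \<open>Row and column norms, and the three lines estimate at the midpoint\<close>

text \<open>\<open>z k\<close> is the \<open>k\<close>-th coordinate of a matrix over \<open>\<ell>\<^sub>2\<close>. Its column norm is
  \<open>\<parallel>\<Sum>\<^sub>k z\<^sub>k\<^sup>* z\<^sub>k\<parallel>\<^bsup>1/2\<^esup>\<close>; working with all partial sums avoids convergence questions.\<close>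

definition col_bound :: "nat \<Rightarrow> (nat \<Rightarrow> nat \<Rightarrow> nat \<Rightarrow> complex) \<Rightarrow> real \<Rightarrow> bool" where
  "col_bound n z c \<longleftrightarrow> (\<forall>K v. (\<Sum>k<K. sqn n (\<lambda>i. \<Sum>j<n. z k i j * v j)) \<le> c\<^sup>2 * sqn n v)"

text \<open>The row norm is the operator norm of the block row formed by the matrices
  \<open>z k\<close>. Transposition preserves it and produces the block column of the transposed
  matrices.\<close>

definition row_bound :: "nat \<Rightarrow> (nat \<Rightarrow> nat \<Rightarrow> nat \<Rightarrow> complex) \<Rightarrow> real \<Rightarrow> bool" where
  "row_bound n z c \<longleftrightarrow> col_bound n (\<lambda>k i j. z k j i) c"

text \<open>Analyticity and boundedness are asked of each coordinate k separately; only the bounds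
  on the two boundary lines tie the coordinates together.\<close>

definition adm :: "nat \<Rightarrow> (nat \<Rightarrow> nat \<Rightarrow> nat \<Rightarrow> complex \<Rightarrow> complex) \<Rightarrow> real \<Rightarrow> bool" where
  "adm n f c \<longleftrightarrow> c \<ge> 0 \<and> (\<forall>k. \<forall>i<n. \<forall>j<n. strip_fun (f k i j)) \<and>
    (\<forall>s. Re s = 0 \<longrightarrow> row_bound n (\<lambda>k i j. f k i j s) c) \<and>
    (\<forall>s. Re s = 1 \<longrightarrow> col_bound n (\<lambda>k i j. f k i j s) c)"

text \<open>This is the Hilbert-Schmidt inner product of z X z' with Y, where z' is the adjoint of
  z. Summed over the coordinates it tests the completely positive map.\<close>

definition kform :: "nat \<Rightarrow> (nat \<Rightarrow> nat \<Rightarrow> complex) \<Rightarrow> (nat \<Rightarrow> nat \<Rightarrow> complex) \<Rightarrow> (nat \<Rightarrow> nat \<Rightarrow> complex) \<Rightarrow> complex" where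
  "kform n z X Y = (\<Sum>i<n. \<Sum>b<n. \<Sum>j<n. \<Sum>a<n. z i j * cnj (z b a) * X j a * cnj (Y i b))"

lemma sum_swap3: "(\<Sum>a\<in>A. \<Sum>l\<in>L. \<Sum>m\<in>M. g a l m) = (\<Sum>l\<in>L. \<Sum>m\<in>M. \<Sum>a\<in>A. g a l m)"
  by (subst sum.swap) (intro sum.cong refl sum.swap)

lemma sum_mult_mid: "(\<Sum>l\<in>L. \<Sum>m\<in>M. a l m * (\<Sum>i\<in>I. \<Sum>j\<in>J. g l m i j) * (\<Sum>b\<in>I'. \<Sum>c\<in>J'. h l m b c)) =
   (\<Sum>i\<in>I. \<Sum>b\<in>I'. \<Sum>j\<in>J. \<Sum>c\<in>J'. \<Sum>l\<in>L. \<Sum>m\<in>M. a l m * g l m i j * (h l m b c :: complex))"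
proof -
  let ?g = "\<lambda>i b j c l m. a l m * g l m i j * h l m b c"
  have "(\<Sum>i\<in>I. \<Sum>b\<in>I'. \<Sum>j\<in>J. \<Sum>c\<in>J'. \<Sum>l\<in>L. \<Sum>m\<in>M. ?g i b j c l m)
      = (\<Sum>i\<in>I. \<Sum>b\<in>I'. \<Sum>j\<in>J. \<Sum>l\<in>L. \<Sum>m\<in>M. \<Sum>c\<in>J'. ?g i b j c l m)"
    by (intro sum.cong refl sum_swap3)
  also have "\<dots> = (\<Sum>i\<in>I. \<Sum>b\<in>I'. \<Sum>l\<in>L. \<Sum>m\<in>M. \<Sum>j\<in>J. \<Sum>c\<in>J'. ?g i b j c l m)"
    by (intro sum.cong refl sum_swap3)
  also have "\<dots> = (\<Sum>i\<in>I. \<Sum>l\<in>L. \<Sum>m\<in>M. \<Sum>b\<in>I'. \<Sum>j\<in>J. \<Sum>c\<in>J'. ?g i b j c l m)"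
    by (intro sum.cong refl sum_swap3)
  also have "\<dots> = (\<Sum>l\<in>L. \<Sum>m\<in>M. \<Sum>i\<in>I. \<Sum>b\<in>I'. \<Sum>j\<in>J. \<Sum>c\<in>J'. ?g i b j c l m)"
    by (rule sum_swap3)
  also have "\<dots> = (\<Sum>l\<in>L. \<Sum>m\<in>M. \<Sum>i\<in>I. \<Sum>j\<in>J. \<Sum>b\<in>I'. \<Sum>c\<in>J'. ?g i b j c l m)"
    by (intro sum.cong refl sum.swap)
  also have "\<dots> = (\<Sum>l\<in>L. \<Sum>m\<in>M. a l m * (\<Sum>i\<in>I. \<Sum>j\<in>J. g l m i j) * (\<Sum>b\<in>I'. \<Sum>c\<in>J'. h l m b c))"
    by (simp only: sum_distrib_left[symmetric] sum_distrib_right[symmetric])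
  finally show ?thesis by simp
qed

text \<open>The complex power of a singular value. The value 0 at \<open>\<sigma> = 0\<close>, even
  for imaginary \<open>t\<close>, keeps it analytic in \<open>t\<close> and is right at
  \<open>t = 1\<close>.\<close>

definition rpow :: "real \<Rightarrow> complex \<Rightarrow> complex" where
  "rpow \<sigma> t = (if \<sigma> = 0 then 0 else exp (t * of_real (ln \<sigma>)))"

lemma rpow_1: "\<sigma> \<ge> 0 \<Longrightarrow> rpow \<sigma> 1 = of_real \<sigma>"
  by (simp add: rpow_def exp_of_real)

lemma norm_rpow_0: "Re t = 0 \<Longrightarrow> cmod (rpow \<sigma> t) \<le> 1"
  by (simp add: rpow_def)

lemma norm_rpow_2: "\<sigma> \<ge> 0 \<Longrightarrow> Re t = 2 \<Longrightarrow> cmod (rpow \<sigma> t) = \<sigma>\<^sup>2"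
  by (auto simp: rpow_def exp_double)

lemma strip_fun_rpow: "strip_fun (\<lambda>s. rpow \<sigma> (2 * s))" "strip_fun (\<lambda>s. rpow \<sigma> (2 - 2 * s))"
proof -
  show "strip_fun (\<lambda>s. rpow \<sigma> (2 * s))"
    using strip_fun_exp[of "2 * ln \<sigma>"] by (cases "\<sigma> = 0") (auto simp: rpow_def mult_ac)
  have "strip_fun (\<lambda>s. exp (of_real (2 * ln \<sigma>)) * exp (s * of_real (- 2 * ln \<sigma>)))"
    by (intro strip_fun_mult strip_fun_const strip_fun_exp)
  then show "strip_fun (\<lambda>s. rpow \<sigma> (2 - 2 * s))"
    by (cases "\<sigma> = 0") (auto simp: rpow_def exp_add[symmetric] algebra_simps)
qed

text \<open>Pairing with the system \<open>q\<close> does not increase the norm, and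
  \<open>p l\<close> has length at most 1. The column bound thus handles one right vector and all
  left vectors at once; the row bound below does the same for one left vector and all right
  vectors.\<close>

lemma col_bound_bessel:
  assumes z: "col_bound n z c" and p: "bessel n p" "l < n" and q: "bessel n q"
  shows "(\<Sum>k<K. \<Sum>m<n. (cmod (\<Sum>i<n. \<Sum>j<n. cnj (q m i) * z k i j * p l j))\<^sup>2) \<le> c\<^sup>2"
proof -
  have "(\<Sum>m<n. (cmod (\<Sum>i<n. \<Sum>j<n. cnj (q m i) * z k i j * p l j))\<^sup>2) \<le> sqn n (\<lambda>i. \<Sum>j<n. z k i j * p l j)" for k
  proof -
    have "(\<Sum>i<n. \<Sum>j<n. cnj (q m i) * z k i j * p l j) = (\<Sum>i<n. (\<Sum>j<n. z k i j * p l j) * cnj (q m i))" for m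
      by (simp add: sum_distrib_right sum_distrib_left mult_ac)
    then show ?thesis using bessel_cnj[OF q] unfolding bessel_def by simp
  qed
  then have "(\<Sum>k<K. \<Sum>m<n. (cmod (\<Sum>i<n. \<Sum>j<n. cnj (q m i) * z k i j * p l j))\<^sup>2)
      \<le> (\<Sum>k<K. sqn n (\<lambda>i. \<Sum>j<n. z k i j * p l j))" by (intro sum_mono)
  also have "\<dots> \<le> c\<^sup>2 * sqn n (p l)" using z unfolding col_bound_def by blast
  also have "\<dots> \<le> c\<^sup>2 * 1" by (intro mult_left_mono bessel_unit p) auto
  finally show ?thesis by simp
qed

lemma row_bound_bessel:
  assumes z: "row_bound n z c" and p: "bessel n p" and q: "bessel n q" "m < n"
  shows "(\<Sum>k<K. \<Sum>l<n. (cmod (\<Sum>i<n. \<Sum>j<n. cnj (q m i) * z k i j * p l j))\<^sup>2) \<le> c\<^sup>2"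
proof -
  have "(\<Sum>i<n. \<Sum>j<n. cnj (q m i) * z k i j * p l j) = (\<Sum>i<n. \<Sum>j<n. cnj (cnj (p l i)) * z k j i * cnj (q m j))" for k l
    by (subst sum.swap) (simp add: mult_ac)
  then show ?thesis
    using col_bound_bessel[OF z[unfolded row_bound_def] bessel_cnj[OF q(1)] q(2) bessel_cnj[OF p], where K = K] by simp
qed

lemma sum_norm_mult_le:
  fixes A B :: "nat \<Rightarrow> nat \<Rightarrow> complex"
  assumes "(\<Sum>k<K. \<Sum>l<n. (cmod (A k l))\<^sup>2) \<le> c\<^sup>2" "(\<Sum>k<K. \<Sum>l<n. (cmod (B k l))\<^sup>2) \<le> c\<^sup>2" "c \<ge> 0"
  shows "(\<Sum>k<K. \<Sum>l<n. cmod (A k l) * cmod (B k l)) \<le> c\<^sup>2"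
proof -
  have "(\<Sum>k<K. \<Sum>l<n. cmod (A k l) * cmod (B k l))
      = (\<Sum>x\<in>{..<K}\<times>{..<n}. cmod (A (fst x) (snd x)) * cmod (B (fst x) (snd x)))"
    by (simp add: sum.cartesian_product case_prod_beta)
  also have "\<dots> \<le> sqrt (\<Sum>x\<in>{..<K}\<times>{..<n}. (cmod (A (fst x) (snd x)))\<^sup>2) * sqrt (\<Sum>x\<in>{..<K}\<times>{..<n}. (cmod (B (fst x) (snd x)))\<^sup>2)"
    by (rule Cauchy_Schwarz_real)
  also have "\<dots> = sqrt (\<Sum>k<K. \<Sum>l<n. (cmod (A k l))\<^sup>2) * sqrt (\<Sum>k<K. \<Sum>l<n. (cmod (B k l))\<^sup>2)"
    by (simp add: sum.cartesian_product case_prod_beta)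
  also have "\<dots> \<le> c * c"
    using assms by (intro mult_mono real_le_lsqrt) (auto intro!: sum_nonneg)
  finally show ?thesis by (simp add: power2_eq_square)
qed

text \<open>The function \<open>F\<close> carries the powers 2s and 2 - 2s of the singular values of
  \<open>X\<close> and \<open>Y\<close>. On the left line the weights of \<open>X\<close> are at
  most 1 and those of \<open>Y\<close> are \<open>(\<tau> m)\<^sup>2\<close>, which sum to
  \<open>hsn n Y\<close>, while the row bound controls the sum over k and l for each m; on the right
  line the roles are exchanged. At 1/2 both powers are 1 and \<open>F\<close> is the quantity to be
  estimated.\<close>

lemma adm_kform_max:
  assumes f: "adm n f c"
  shows "cmod (\<Sum>k<K. kform n (\<lambda>i j. f k i j (1/2)) X Y) \<le> c\<^sup>2 * max (hsn n X) (hsn n Y)"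
proof -
  obtain \<sigma> p v where X: "\<And>l. \<sigma> l \<ge> 0" "bessel n p" "bessel n v"
    "\<And>i j. i < n \<Longrightarrow> j < n \<Longrightarrow> X i j = (\<Sum>l<n. of_real (\<sigma> l) * p l i * cnj (v l j))"
    "(\<Sum>l<n. (\<sigma> l)\<^sup>2) = hsn n X" using singular_value_decomposition[of n X] by blast
  obtain \<tau> q w where Y: "\<And>l. \<tau> l \<ge> 0" "bessel n q" "bessel n w"
    "\<And>i j. i < n \<Longrightarrow> j < n \<Longrightarrow> Y i j = (\<Sum>l<n. of_real (\<tau> l) * q l i * cnj (w l j))"
    "(\<Sum>l<n. (\<tau> l)\<^sup>2) = hsn n Y" using singular_value_decomposition[of n Y] by blast
  define A where "A = (\<lambda>k m l s. \<Sum>i<n. \<Sum>j<n. cnj (q m i) * f k i j s * p l j)"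
  \<comment> \<open>The inner \<open>cnj s\<close> and the outer conjugation make \<open>B\<close>
    analytic; at the real point 1/2 it is a plain conjugate.\<close>
  define B where "B = (\<lambda>k m l s. cnj (\<Sum>i<n. \<Sum>j<n. cnj (w m i) * f k i j (cnj s) * v l j))"
  define F where "F = (\<lambda>s. \<Sum>k<K. \<Sum>l<n. \<Sum>m<n. (rpow (\<sigma> l) (2 * s) * rpow (\<tau> m) (2 - 2 * s)) * A k m l s * B k m l s)"
  have c: "c \<ge> 0" and sf: "\<And>k i j. i < n \<Longrightarrow> j < n \<Longrightarrow> strip_fun (f k i j)"
    and row: "\<And>s. Re s = 0 \<Longrightarrow> row_bound n (\<lambda>k i j. f k i j s) c"
    and col: "\<And>s. Re s = 1 \<Longrightarrow> col_bound n (\<lambda>k i j. f k i j s) c"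
    using f by (auto simp: adm_def)
  have sA: "strip_fun (A k m l)" for k m l
    unfolding A_def by (intro strip_fun_sum strip_fun_mult strip_fun_const sf) auto
  have "strip_fun (\<lambda>s. \<Sum>i<n. \<Sum>j<n. cnj (w m i) * f k i j s * v l j)" for k m l
    by (intro strip_fun_sum strip_fun_mult strip_fun_const sf) auto
  from strip_fun_reflect[OF this] have sB: "strip_fun (B k m l)" for k m l
    unfolding B_def .
  have sF: "strip_fun F" unfolding F_def by (intro strip_fun_sum strip_fun_mult strip_fun_rpow sA sB)
  have bd: "cmod (F s) \<le> c\<^sup>2 * max (hsn n X) (hsn n Y)" if s: "Re s = 0 \<or> Re s = 1" for s
    using s
  proof
    assume s: "Re s = 0"
    have "cmod (F s) \<le> (\<Sum>k<K. \<Sum>l<n. \<Sum>m<n. (\<tau> m)\<^sup>2 * (cmod (A k m l s) * cmod (B k m l s)))"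
      unfolding F_def
    proof (intro order_trans[OF norm_sum] sum_mono)
      fix k l m
      have "cmod (rpow (\<sigma> l) (2 * s)) * cmod (rpow (\<tau> m) (2 - 2 * s)) \<le> 1 * (\<tau> m)\<^sup>2"
        using s Y(1) by (intro mult_mono norm_rpow_0) (auto simp: norm_rpow_2)
      then show "cmod (rpow (\<sigma> l) (2 * s) * rpow (\<tau> m) (2 - 2 * s) * A k m l s * B k m l s) \<le> (\<tau> m)\<^sup>2 * (cmod (A k m l s) * cmod (B k m l s))"
        by (simp add: norm_mult mult.assoc[symmetric] mult_right_mono)
    qed
    also have "\<dots> = (\<Sum>m<n. (\<tau> m)\<^sup>2 * (\<Sum>k<K. \<Sum>l<n. cmod (A k m l s) * cmod (B k m l s)))"
      unfolding sum_distrib_left by (subst sum_swap3[symmetric], rule refl)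
    also have "\<dots> \<le> (\<Sum>m<n. (\<tau> m)\<^sup>2 * c\<^sup>2)"
    proof (intro sum_mono mult_left_mono sum_norm_mult_le c)
      fix m assume m: "m \<in> {..<n}"
      show "(\<Sum>k<K. \<Sum>l<n. (cmod (A k m l s))\<^sup>2) \<le> c\<^sup>2"
        unfolding A_def using m s by (intro row_bound_bessel row X Y) auto
      show "(\<Sum>k<K. \<Sum>l<n. (cmod (B k m l s))\<^sup>2) \<le> c\<^sup>2"
        unfolding B_def complex_mod_cnj using m s by (intro row_bound_bessel row X Y) auto
    qed auto
    also have "\<dots> = c\<^sup>2 * hsn n Y" by (simp add: Y(5)[symmetric] sum_distrib_left mult.commute)
    also have "\<dots> \<le> c\<^sup>2 * max (hsn n X) (hsn n Y)" by (intro mult_left_mono) auto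
    finally show ?thesis .
  next
    assume s: "Re s = 1"
    have "cmod (F s) \<le> (\<Sum>k<K. \<Sum>l<n. \<Sum>m<n. (\<sigma> l)\<^sup>2 * (cmod (A k m l s) * cmod (B k m l s)))"
      unfolding F_def
    proof (intro order_trans[OF norm_sum] sum_mono)
      fix k l m
      have "cmod (rpow (\<sigma> l) (2 * s)) * cmod (rpow (\<tau> m) (2 - 2 * s)) \<le> (\<sigma> l)\<^sup>2 * 1"
        using s X(1) by (intro mult_mono norm_rpow_0) (auto simp: norm_rpow_2)
      then show "cmod (rpow (\<sigma> l) (2 * s) * rpow (\<tau> m) (2 - 2 * s) * A k m l s * B k m l s) \<le> (\<sigma> l)\<^sup>2 * (cmod (A k m l s) * cmod (B k m l s))"
        by (simp add: norm_mult mult.assoc[symmetric] mult_right_mono)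
    qed
    also have "\<dots> = (\<Sum>l<n. (\<sigma> l)\<^sup>2 * (\<Sum>k<K. \<Sum>m<n. cmod (A k m l s) * cmod (B k m l s)))"
      unfolding sum_distrib_left by (rule sum.swap)
    also have "\<dots> \<le> (\<Sum>l<n. (\<sigma> l)\<^sup>2 * c\<^sup>2)"
    proof (intro sum_mono mult_left_mono sum_norm_mult_le c)
      fix l assume l: "l \<in> {..<n}"
      show "(\<Sum>k<K. \<Sum>m<n. (cmod (A k m l s))\<^sup>2) \<le> c\<^sup>2"
        unfolding A_def using l s by (intro col_bound_bessel col X Y) auto
      show "(\<Sum>k<K. \<Sum>m<n. (cmod (B k m l s))\<^sup>2) \<le> c\<^sup>2"
        unfolding B_def complex_mod_cnj using l s by (intro col_bound_bessel col X Y) auto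
    qed auto
    also have "\<dots> = c\<^sup>2 * hsn n X" by (simp add: X(5)[symmetric] sum_distrib_left mult.commute)
    also have "\<dots> \<le> c\<^sup>2 * max (hsn n X) (hsn n Y)" by (intro mult_left_mono) auto
    finally show ?thesis .
  qed
  have "c\<^sup>2 * max (hsn n X) (hsn n Y) \<ge> 0" by (simp add: hsn_def sum_nonneg max.coboundedI1)
  from three_lines[OF sF this bd half_in_strip] have le: "cmod (F (1/2)) \<le> c\<^sup>2 * max (hsn n X) (hsn n Y)" .
  have "F (1/2) = (\<Sum>k<K. \<Sum>l<n. \<Sum>m<n. (of_real (\<sigma> l) * of_real (\<tau> m)) * A k m l (1/2) * B k m l (1/2))"
    unfolding F_def using X(1) Y(1) by (simp add: rpow_1)
  also have "\<dots> = (\<Sum>k<K. kform n (\<lambda>i j. f k i j (1/2)) X Y)"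
  proof (intro sum.cong refl)
    fix k
    have "(\<Sum>l<n. \<Sum>m<n. (of_real (\<sigma> l) * of_real (\<tau> m)) * A k m l (1/2) * B k m l (1/2))
      = (\<Sum>i<n. \<Sum>b<n. \<Sum>j<n. \<Sum>a<n. \<Sum>l<n. \<Sum>m<n. (of_real (\<sigma> l) * of_real (\<tau> m)) *
          (cnj (q m i) * f k i j (1/2) * p l j) * (w m b * cnj (f k b a (1/2)) * cnj (v l a)))"
      unfolding A_def B_def cnj_sum by (subst sum_mult_mid) simp
    also have "\<dots> = kform n (\<lambda>i j. f k i j (1/2)) X Y"
      unfolding kform_def
    proof (intro sum.cong refl)
      fix i b j a assume "i \<in> {..<n}" "b \<in> {..<n}" "j \<in> {..<n}" "a \<in> {..<n}"
      then have "f k i j (1/2) * cnj (f k b a (1/2)) * X j a * cnj (Y i b) =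
        f k i j (1/2) * cnj (f k b a (1/2)) * ((\<Sum>l<n. of_real (\<sigma> l) * p l j * cnj (v l a)) * (\<Sum>m<n. of_real (\<tau> m) * cnj (q m i) * w m b))"
        by (simp add: X(4) Y(4) mult.assoc)
      also have "\<dots> = (\<Sum>l<n. \<Sum>m<n. (of_real (\<sigma> l) * of_real (\<tau> m)) *
          (cnj (q m i) * f k i j (1/2) * p l j) * (w m b * cnj (f k b a (1/2)) * cnj (v l a)))"
        unfolding sum_product unfolding sum_distrib_left by (intro sum.cong refl) (simp add: mult_ac)
      finally show "(\<Sum>l<n. \<Sum>m<n. (of_real (\<sigma> l) * of_real (\<tau> m)) *
          (cnj (q m i) * f k i j (1/2) * p l j) * (w m b * cnj (f k b a (1/2)) * cnj (v l a)))
        = f k i j (1/2) * cnj (f k b a (1/2)) * X j a * cnj (Y i b)" ..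
    qed
    finally show "(\<Sum>l<n. \<Sum>m<n. (of_real (\<sigma> l) * of_real (\<tau> m)) * A k m l (1/2) * B k m l (1/2))
      = kform n (\<lambda>i j. f k i j (1/2)) X Y" .
  qed
  finally show ?thesis using le by simp
qed

lemma hsn_scale: "hsn n (\<lambda>i j. c * X i j) = (cmod c)\<^sup>2 * hsn n X"
  by (simp add: hsn_def norm_mult power_mult_distrib sum_distrib_left)

lemma hsn_eq_0_iff: "hsn n X = 0 \<longleftrightarrow> (\<forall>i<n. \<forall>j<n. X i j = 0)"
  unfolding hsn_def by (subst sum_nonneg_eq_0_iff) (auto simp: sum_nonneg sum_nonneg_eq_0_iff)

lemma hsn_nonneg [simp]: "hsn n X \<ge> 0"
  by (simp add: hsn_def sum_nonneg)

text \<open>\<open>kform\<close> does not change if \<open>X\<close> is multiplied and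
  \<open>Y\<close> divided by the same t > 0. Taking for \<open>t\<^sup>2\<close> the quotient
  \<open>y / x\<close> of the norms makes both Hilbert-Schmidt norms equal, which turns the maximum
  into the product.\<close>

lemma adm_kform:
  assumes f: "adm n f c"
  shows "cmod (\<Sum>k<K. kform n (\<lambda>i j. f k i j (1/2)) X Y) \<le> c\<^sup>2 * (sqrt (hsn n X) * sqrt (hsn n Y))"
proof (cases "hsn n X = 0 \<or> hsn n Y = 0")
  case True
  then have "kform n z X Y = 0" for z by (auto simp: kform_def hsn_eq_0_iff)
  then show ?thesis using True by auto
next
  case False
  define x where "x = sqrt (hsn n X)"
  define y where "y = sqrt (hsn n Y)"
  define t where "t = sqrt (y / x)"
  have xy: "x > 0" "y > 0" using False by (auto simp: x_def y_def less_le)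
  have t: "t > 0" "t\<^sup>2 = y / x" using xy by (auto simp: t_def)
  have X2: "hsn n X = x\<^sup>2" "hsn n Y = y\<^sup>2" by (auto simp: x_def y_def)
  have hx: "hsn n (\<lambda>i j. of_real t * X i j) = x * y"
    unfolding hsn_scale using t xy by (simp add: X2 power2_eq_square)
  have hy: "hsn n (\<lambda>i j. of_real (1 / t) * Y i j) = x * y"
    unfolding hsn_scale using t xy by (simp add: X2 norm_divide power_divide) (simp add: power2_eq_square field_simps)
  have "kform n z (\<lambda>i j. of_real t * X i j) (\<lambda>i j. of_real (1 / t) * Y i j) = kform n z X Y" for z
    unfolding kform_def using t(1) by (intro sum.cong refl) (simp add: field_simps)
  then show ?thesis
    using adm_kform_max[OF f, where K = K and X = "\<lambda>i j. of_real t * X i j" and Y = "\<lambda>i j. of_real (1 / t) * Y i j"] unfolding hx hy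
    by (simp add: x_def y_def)
qed

section \<open>The completely positive map of a family of matrices\<close>

definition adjoint_family :: "(nat \<Rightarrow> nat \<Rightarrow> nat \<Rightarrow> complex) \<Rightarrow> nat \<Rightarrow> nat \<Rightarrow> nat \<Rightarrow> complex" where
  "adjoint_family z = (\<lambda>k j i. cnj (z k i j))"

lemma adjoint_family_twice [simp]: "adjoint_family (adjoint_family z) = z"
  by (simp add: adjoint_family_def)

text \<open>The completely positive map \<open>X \<mapsto> \<Sum>\<^sub>k z\<^sub>k X z\<^sub>k\<^sup>*\<close>, whose matrix is \<open>\<Sum>\<^sub>k z\<^sub>k \<otimes> cnj z\<^sub>k\<close>.\<close>

definition cpmap :: "nat \<Rightarrow> (nat \<Rightarrow> nat \<Rightarrow> nat \<Rightarrow> complex) \<Rightarrow> (nat \<Rightarrow> nat \<Rightarrow> complex) \<Rightarrow> nat \<Rightarrow> nat \<Rightarrow> complex" where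
  "cpmap n z X = (\<lambda>i b. \<Sum>j<n. \<Sum>a<n. (\<Sum>k. z k i j * cnj (z k b a)) * X j a)"

definition sq_summable :: "nat \<Rightarrow> (nat \<Rightarrow> nat \<Rightarrow> nat \<Rightarrow> complex) \<Rightarrow> bool" where
  "sq_summable n z \<longleftrightarrow> (\<forall>i<n. \<forall>j<n. summable (\<lambda>k. (cmod (z k i j))\<^sup>2))"

lemma sq_summable_adjoint: "sq_summable n z \<Longrightarrow> sq_summable n (adjoint_family z)"
  by (simp add: sq_summable_def adjoint_family_def)

lemma summable_mult_cnj:
  assumes "summable (\<lambda>k. (cmod (x k))\<^sup>2)" "summable (\<lambda>k. (cmod (y k))\<^sup>2)"
  shows "summable (\<lambda>k. x k * cnj (y k))"
proof (rule summable_norm_cancel, rule summable_comparison_test)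
  show "summable (\<lambda>k. (cmod (x k))\<^sup>2 + (cmod (y k))\<^sup>2)" using assms by (rule summable_add)
  have "cmod (x k) * cmod (y k) \<le> (cmod (x k))\<^sup>2 + (cmod (y k))\<^sup>2" for k
    using sum_squares_bound[of "cmod (x k)" "cmod (y k)"] mult_nonneg_nonneg[of "cmod (x k)" "cmod (y k)"]
    unfolding mult.assoc by (smt (verit) norm_ge_zero)
  then show "\<exists>N. \<forall>k\<ge>N. norm (cmod (x k * cnj (y k))) \<le> (cmod (x k))\<^sup>2 + (cmod (y k))\<^sup>2"
    by (simp add: norm_mult)
qed

lemma cpmap_add: "cpmap n z (\<lambda>i j. X i j + Y i j) = (\<lambda>i j. cpmap n z X i j + cpmap n z Y i j)"
  by (simp add: cpmap_def algebra_simps sum.distrib)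

lemma cpmap_scale: "cpmap n z (\<lambda>i j. c * X i j) = (\<lambda>i j. c * cpmap n z X i j)"
  by (simp add: cpmap_def sum_distrib_left mult_ac)

lemma cpmap_sum: "cpmap n z (\<lambda>i j. \<Sum>m\<in>A. X m i j) = (\<lambda>i j. \<Sum>m\<in>A. cpmap n z (X m) i j)"
proof (induction A rule: infinite_finite_induct)
  case (insert x F)
  then show ?case by (simp add: cpmap_add)
qed (simp_all add: cpmap_def)

lemma qform_add: "qform n (\<lambda>i j. X i j + Y i j) v = qform n X v + qform n Y v"
  by (simp only: qform_def distrib_left distrib_right sum.distrib plus_complex.simps)

lemma qform_scale: "qform n (\<lambda>i j. of_real c * X i j) v = c * qform n X v"
proof -
  have "(\<Sum>i<n. \<Sum>j<n. cnj (v i) * (of_real c * X i j) * v j) = of_real c * (\<Sum>i<n. \<Sum>j<n. cnj (v i) * X i j * v j)"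
    unfolding sum_distrib_left by (intro sum.cong refl) (simp add: mult_ac)
  then show ?thesis unfolding qform_def by simp
qed

lemma qform_sum: "qform n (\<lambda>i j. \<Sum>m\<in>A. X m i j) v = (\<Sum>m\<in>A. qform n (X m) v)"
proof (induction A rule: infinite_finite_induct)
  case (insert x F)
  then show ?case by (simp add: qform_add)
qed (simp_all add: qform_def)

lemma qform_le_hsn: "qform n X v \<le> sqrt (hsn n X) * sqn n v"
proof -
  have "sqn n (apply_mat n X v) \<le> hsn n X * sqn n v"
  proof -
    have "sqn n (apply_mat n X v) \<le> (\<Sum>i<n. sqn n (X i) * sqn n v)"
      unfolding apply_mat_def by (subst sqn_def) (intro sum_mono Cauchy_Schwarz_square)
    then show ?thesis by (simp add: hsn_def sqn_def sum_distrib_right)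
  qed
  then have "sqn n (apply_mat n X v) * sqn n v \<le> (hsn n X * sqn n v) * sqn n v" by (intro mult_right_mono) auto
  also have "\<dots> = (sqrt (hsn n X) * sqn n v)\<^sup>2" by (simp add: power_mult_distrib power2_eq_square)
  finally have "sqn n (apply_mat n X v) * sqn n v \<le> (sqrt (hsn n X) * sqn n v)\<^sup>2" .
  moreover have le: "qform n X v \<le> cmod (iprod n (apply_mat n X v) v)"
    unfolding qform_iprod by (rule complex_Re_le_cmod)
  moreover have "(cmod (iprod n (apply_mat n X v) v))\<^sup>2 \<le> sqn n (apply_mat n X v) * sqn n v"
    unfolding iprod_def using Cauchy_Schwarz_square[where n = n and u = "apply_mat n X v" and v = "\<lambda>i. cnj (v i)"] by simp
  ultimately have "(cmod (iprod n (apply_mat n X v) v))\<^sup>2 \<le> (sqrt (hsn n X) * sqn n v)\<^sup>2"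
    by linarith
  then have "cmod (iprod n (apply_mat n X v) v) \<le> sqrt (hsn n X) * sqn n v"
    by (rule power2_le_imp_le) simp
  with le show ?thesis by linarith
qed

definition psd :: "nat \<Rightarrow> (nat \<Rightarrow> nat \<Rightarrow> complex) \<Rightarrow> bool" where
  "psd n X \<longleftrightarrow> hermitian n X \<and> (\<forall>v. qform n X v \<ge> 0)"

text \<open>The form of z X z' at v is the form of X at z' v, where z' is the adjoint of
  \<open>z k\<close>. Hence the map preserves positivity, and for positive X every partial sum over
  k stays below the whole.\<close>

lemma cpmap_qform_sums:
  assumes z: "sq_summable n z"
  shows "(\<lambda>k. qform n X (\<lambda>j. \<Sum>i<n. cnj (z k i j) * v i)) sums qform n (cpmap n z X) v"
proof -
  have "(\<lambda>k. Re (\<Sum>i<n. \<Sum>b<n. cnj (v i) * (\<Sum>j<n. \<Sum>a<n. (z k i j * cnj (z k b a)) * X j a) * v b))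
      sums qform n (cpmap n z X) v"
    unfolding qform_def cpmap_def
    by (intro sums_Re sums_sum sums_mult sums_mult2 summable_sums summable_mult_cnj)
      (use z in \<open>auto simp: sq_summable_def\<close>)
  moreover have "(\<Sum>i<n. \<Sum>b<n. cnj (v i) * (\<Sum>j<n. \<Sum>a<n. (z k i j * cnj (z k b a)) * X j a) * v b)
     = (\<Sum>j<n. \<Sum>a<n. cnj (\<Sum>i<n. cnj (z k i j) * v i) * X j a * (\<Sum>b<n. cnj (z k b a) * v b))" for k
  proof -
    have "(\<Sum>j<n. \<Sum>a<n. cnj (\<Sum>i<n. cnj (z k i j) * v i) * X j a * (\<Sum>b<n. cnj (z k b a) * v b))
      = (\<Sum>j<n. \<Sum>a<n. X j a * (\<Sum>i<n. z k i j * cnj (v i)) * (\<Sum>b<n. cnj (z k b a) * v b))"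
      by (simp add: mult.commute mult.left_commute)
    also have "\<dots> = (\<Sum>j<n. \<Sum>a<n. \<Sum>i<n. \<Sum>b<n. X j a * (z k i j * cnj (v i)) * (cnj (z k b a) * v b))"
      by (simp only: sum_distrib_left sum_distrib_right)  (intro sum.cong refl sum.swap)
    also have "\<dots> = (\<Sum>j<n. \<Sum>i<n. \<Sum>b<n. \<Sum>a<n. X j a * (z k i j * cnj (v i)) * (cnj (z k b a) * v b))"
      by (intro sum.cong refl sum_swap3)
    also have "\<dots> = (\<Sum>i<n. \<Sum>b<n. \<Sum>j<n. \<Sum>a<n. X j a * (z k i j * cnj (v i)) * (cnj (z k b a) * v b))"
      by (rule sum_swap3)
    also have "\<dots> = (\<Sum>i<n. \<Sum>b<n. cnj (v i) * (\<Sum>j<n. \<Sum>a<n. (z k i j * cnj (z k b a)) * X j a) * v b)"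
      unfolding sum_distrib_left unfolding sum_distrib_right by (intro sum.cong refl) (simp add: mult_ac)
    finally show ?thesis ..
  qed
  ultimately show ?thesis unfolding qform_def by simp
qed

lemma cpmap_psd:
  assumes z: "sq_summable n z" and X: "psd n X"
  shows "psd n (cpmap n z X)"
proof -
  have "cpmap n z X b i = cnj (cpmap n z X i b)" if "i < n" "b < n" for i b
  proof -
    have "cnj (cpmap n z X i b) = (\<Sum>j<n. \<Sum>a<n. cnj (\<Sum>k. z k i j * cnj (z k b a)) * cnj (X j a))"
      by (simp add: cpmap_def)
    also have "\<dots> = (\<Sum>j<n. \<Sum>a<n. (\<Sum>k. z k b a * cnj (z k i j)) * X a j)"
    proof (intro sum.cong refl)
      fix j a assume ja: "j \<in> {..<n}" "a \<in> {..<n}"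
      have "(\<lambda>k. z k i j * cnj (z k b a)) sums (\<Sum>k. z k i j * cnj (z k b a))"
        using z that ja by (intro summable_sums summable_mult_cnj) (auto simp: sq_summable_def)
      then have "(\<lambda>k. cnj (z k i j * cnj (z k b a))) sums cnj (\<Sum>k. z k i j * cnj (z k b a))"
        by (simp only: sums_cnj)
      then have "cnj (\<Sum>k. z k i j * cnj (z k b a)) = (\<Sum>k. z k b a * cnj (z k i j))"
        by (simp add: sums_iff mult.commute)
      moreover have "cnj (X j a) = X a j" using X ja unfolding psd_def hermitian_def
        by (metis lessThan_iff)
      ultimately show "cnj (\<Sum>k. z k i j * cnj (z k b a)) * cnj (X j a) = (\<Sum>k. z k b a * cnj (z k i j)) * X a j"
        by simp
    qed
    also have "\<dots> = cpmap n z X b i" unfolding cpmap_def by (rule sum.swap)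
    finally show ?thesis ..
  qed
  moreover have "qform n (cpmap n z X) v \<ge> 0" for v
  proof -
    note s = cpmap_qform_sums[OF z, of X v]
    show ?thesis unfolding sums_unique[OF s] using X by (intro suminf_nonneg sums_summable[OF s]) (simp add: psd_def)
  qed
  ultimately show ?thesis unfolding psd_def hermitian_def by blast
qed

lemma cpmap_qform_partial:
  assumes z: "sq_summable n z" and X: "psd n X"
  shows "(\<Sum>k<K. qform n X (\<lambda>j. \<Sum>i<n. cnj (z k i j) * v i)) \<le> qform n (cpmap n z X) v"
proof -
  note s = cpmap_qform_sums[OF z, of X v]
  show ?thesis unfolding sums_unique[OF s] using X by (intro sum_le_suminf sums_summable[OF s]) (auto simp: psd_def)
qed

definition hsprod :: "nat \<Rightarrow> (nat \<Rightarrow> nat \<Rightarrow> complex) \<Rightarrow> (nat \<Rightarrow> nat \<Rightarrow> complex) \<Rightarrow> complex" where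
  "hsprod n X Y = (\<Sum>i<n. \<Sum>j<n. X i j * cnj (Y i j))"

lemma hsprod_self: "hsprod n X X = of_real (hsn n X)"
  by (simp add: hsprod_def hsn_def complex_norm_square del: of_real_power)

lemma hsprod_le: "cmod (hsprod n X Y) \<le> sqrt (hsn n X) * sqrt (hsn n Y)"
proof -
  have "cmod (\<Sum>x\<in>{..<n}\<times>{..<n}. X (fst x) (snd x) * cnj (Y (fst x) (snd x)))
    \<le> sqrt (\<Sum>x\<in>{..<n}\<times>{..<n}. (cmod (X (fst x) (snd x)))\<^sup>2) * sqrt (\<Sum>x\<in>{..<n}\<times>{..<n}. (cmod (cnj (Y (fst x) (snd x))))\<^sup>2)"
    by (rule Cauchy_Schwarz_complex)
  then show ?thesis by (simp add: hsprod_def hsn_def sum.cartesian_product case_prod_beta)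
qed

lemma cpmap_adjoint:
  assumes z: "sq_summable n z"
  shows "hsprod n (cpmap n z X) Y = hsprod n X (cpmap n (adjoint_family z) Y)"
proof -
  have "hsprod n (cpmap n z X) Y = (\<Sum>i<n. \<Sum>b<n. \<Sum>j<n. \<Sum>a<n. (\<Sum>k. z k i j * cnj (z k b a)) * X j a * cnj (Y i b))"
    by (simp add: hsprod_def cpmap_def sum_distrib_right)
  also have "\<dots> = (\<Sum>i<n. \<Sum>j<n. \<Sum>a<n. \<Sum>b<n. (\<Sum>k. z k i j * cnj (z k b a)) * X j a * cnj (Y i b))"
    by (intro sum.cong refl sum_swap3)
  also have "\<dots> = (\<Sum>j<n. \<Sum>a<n. \<Sum>i<n. \<Sum>b<n. (\<Sum>k. z k i j * cnj (z k b a)) * X j a * cnj (Y i b))"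
    by (rule sum_swap3)
  also have "\<dots> = (\<Sum>j<n. \<Sum>a<n. \<Sum>i<n. \<Sum>b<n. X j a * cnj ((\<Sum>k. adjoint_family z k j i * cnj (adjoint_family z k a b)) * Y i b))"
  proof (intro sum.cong refl)
    fix i b j a assume *: "i \<in> {..<n}" "b \<in> {..<n}" "j \<in> {..<n}" "a \<in> {..<n}"
    have "(\<lambda>k. z k i j * cnj (z k b a)) sums (\<Sum>k. z k i j * cnj (z k b a))"
      using z * by (intro summable_sums summable_mult_cnj) (auto simp: sq_summable_def)
    then have "(\<lambda>k. cnj (z k i j * cnj (z k b a))) sums cnj (\<Sum>k. z k i j * cnj (z k b a))"
      by (simp only: sums_cnj)
    then have "(\<Sum>k. adjoint_family z k j i * cnj (adjoint_family z k a b)) = cnj (\<Sum>k. z k i j * cnj (z k b a))"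
      by (simp add: sums_iff adjoint_family_def)
    then show "(\<Sum>k. z k i j * cnj (z k b a)) * X j a * cnj (Y i b) =
        X j a * cnj ((\<Sum>k. adjoint_family z k j i * cnj (adjoint_family z k a b)) * Y i b)"
      by (simp add: mult_ac)
  qed
  also have "\<dots> = hsprod n X (cpmap n (adjoint_family z) Y)"
    by (simp add: hsprod_def cpmap_def sum_distrib_left)
  finally show ?thesis .
qed

lemma cpmap_adjoint_bound:
  assumes z: "sq_summable n z" and \<kappa>: "\<kappa> \<ge> 0"
    and le: "\<And>X. sqrt (hsn n (cpmap n z X)) \<le> \<kappa> * sqrt (hsn n X)"
  shows "sqrt (hsn n (cpmap n (adjoint_family z) Y)) \<le> \<kappa> * sqrt (hsn n Y)"
proof -
  define W where "W = cpmap n (adjoint_family z) Y"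
  have "hsn n W = cmod (hsprod n W W)" by (simp add: hsprod_self)
  also have "hsprod n W W = hsprod n Y (cpmap n z W)"
    using cpmap_adjoint[OF sq_summable_adjoint[OF z], of Y W] by (simp add: W_def)
  also have "cmod \<dots> \<le> sqrt (hsn n Y) * sqrt (hsn n (cpmap n z W))" by (rule hsprod_le)
  also have "\<dots> \<le> sqrt (hsn n Y) * (\<kappa> * sqrt (hsn n W))" by (intro mult_left_mono le) simp
  finally have "sqrt (hsn n W) * sqrt (hsn n W) \<le> (\<kappa> * sqrt (hsn n Y)) * sqrt (hsn n W)" by (simp add: mult_ac)
  then have "sqrt (hsn n W) \<le> \<kappa> * sqrt (hsn n Y)"
  proof (cases "hsn n W = 0")
    case False
    then have "sqrt (hsn n W) > 0" using hsn_nonneg[of n W] by (simp add: less_le)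
    then show ?thesis using \<open>_ \<le> (\<kappa> * sqrt (hsn n Y)) * sqrt (hsn n W)\<close> by (rule mult_right_le_imp_le[rotated])
  qed (use \<kappa> in simp)
  then show ?thesis by (simp add: W_def)
qed

definition idm :: "nat \<Rightarrow> nat \<Rightarrow> complex" where "idm i j = (if i = j then 1 else 0)"

lemma qform_idm: "qform n idm v = sqn n v"
proof -
  have "(\<Sum>i<n. \<Sum>j<n. cnj (v i) * idm i j * v j) = (\<Sum>i<n. \<Sum>j<n. if j = i then v i * cnj (v i) else 0)"
    by (intro sum.cong refl) (auto simp: idm_def)
  also have "\<dots> = of_real (sqn n v)" by (simp add: of_real_sqn)
  finally show ?thesis by (simp add: qform_def)
qed

lemma psd_idm: "psd n idm"
  by (auto simp: psd_def qform_idm hermitian_def idm_def)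

lemma hermitian_add: "hermitian n X \<Longrightarrow> hermitian n Y \<Longrightarrow> hermitian n (\<lambda>i j. X i j + Y i j)"
  unfolding hermitian_def by (metis complex_cnj_add)

lemma hermitian_scale: "hermitian n X \<Longrightarrow> hermitian n (\<lambda>i j. of_real c * X i j)"
  unfolding hermitian_def by (metis complex_cnj_mult complex_cnj_complex_of_real)

lemma psd_add: "psd n X \<Longrightarrow> psd n Y \<Longrightarrow> psd n (\<lambda>i j. X i j + Y i j)"
  by (simp add: psd_def hermitian_add qform_add)

lemma psd_scale: "psd n X \<Longrightarrow> c \<ge> 0 \<Longrightarrow> psd n (\<lambda>i j. of_real c * X i j)"
  by (simp add: psd_def hermitian_scale qform_scale)

lemma psd_sum: "(\<And>m. m \<in> A \<Longrightarrow> psd n (X m)) \<Longrightarrow> psd n (\<lambda>i j. \<Sum>m\<in>A. X m i j)"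
proof (induction A rule: infinite_finite_induct)
  case (insert x F)
  then show ?case by (simp add: psd_add)
qed (simp_all add: psd_def hermitian_def qform_def)

text \<open>A strictly contractive completely positive map \<open>\<Phi>/c\<^sup>2\<close> has positive definite \<open>a\<close>, \<open>b\<close> with
  \<open>\<Phi> a \<le> c\<^sup>2 b\<close> and \<open>\<Phi>\<^sup>* b \<le> c\<^sup>2 a\<close>: take for \<open>a\<close> a long partial sum of the Neumann series of
  \<open>(1 - \<Phi>\<^sup>*\<Phi>/c\<^sup>4)\<^sup>-\<^sup>1 1\<close>.\<close>

lemma subinvariant_pair:
  assumes z: "sq_summable n z" and \<kappa>: "\<kappa> \<ge> 0" "\<kappa> < c\<^sup>2" and c: "c > 0"
    and le: "\<And>X. sqrt (hsn n (cpmap n z X)) \<le> \<kappa> * sqrt (hsn n X)"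
  obtains a b \<delta> where "hermitian n a" "hermitian n b" "\<delta> > 0"
    "\<And>v. qform n a v \<ge> \<delta> * sqn n v" "\<And>v. qform n b v \<ge> \<delta> * sqn n v"
    "\<And>K v. (\<Sum>k<K. qform n a (\<lambda>j. \<Sum>i<n. cnj (z k i j) * v i)) \<le> c\<^sup>2 * qform n b v"
    "\<And>K v. (\<Sum>k<K. qform n b (\<lambda>i. \<Sum>j<n. z k i j * v j)) \<le> c\<^sup>2 * qform n a v"
proof -
  let ?z' = "adjoint_family z"
  note z' = sq_summable_adjoint[OF z]
  note le' = cpmap_adjoint_bound[OF z \<kappa>(1) le]
  define \<theta> where "\<theta> = (\<kappa> / c\<^sup>2)\<^sup>2"
  have \<theta>: "0 \<le> \<theta>" "\<theta> < 1"
    using \<kappa> c by (simp_all add: \<theta>_def abs_square_less_1)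
  \<comment> \<open>The map followed by its adjoint, scaled so that it shrinks the Hilbert-Schmidt
    norm by the factor \<open>\<theta> < 1\<close>.\<close>
  define Psi where "Psi = (\<lambda>X i j. of_real (1 / c^4) * cpmap n ?z' (cpmap n z X) i j)"
  have Psi_le: "sqrt (hsn n (Psi X)) \<le> \<theta> * sqrt (hsn n X)" for X
  proof -
    have "sqrt (hsn n (Psi X)) = 1 / c^4 * sqrt (hsn n (cpmap n ?z' (cpmap n z X)))"
      unfolding Psi_def hsn_scale using c by (simp add: real_sqrt_mult norm_divide norm_power)
    also have "\<dots> \<le> 1 / c^4 * (\<kappa> * (\<kappa> * sqrt (hsn n X)))"
      using order_trans[OF le' mult_left_mono[OF le \<kappa>(1)]] c by (intro mult_left_mono) auto
    also have "\<dots> = \<theta> * sqrt (hsn n X)" by (simp add: \<theta>_def power_divide power2_eq_square power4_eq_xxxx)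
    finally show ?thesis .
  qed
  define A where "A = (\<lambda>m. (Psi ^^ m) idm)"
  have A_Suc: "A (Suc m) = Psi (A m)" for m by (simp add: A_def)
  have A_le: "sqrt (hsn n (A m)) \<le> \<theta> ^ m * sqrt (hsn n idm)" for m
  proof (induction m)
    case (Suc m)
    then have "\<theta> * sqrt (hsn n (A m)) \<le> \<theta> * (\<theta> ^ m * sqrt (hsn n idm))" using \<theta> by (intro mult_left_mono) auto
    then show ?case using Psi_le[of "A m"] by (simp add: A_Suc mult.assoc)
  qed (simp add: A_def)
  have A_psd: "psd n (A m)" for m
  proof (induction m)
    case 0
    then show ?case by (simp add: A_def psd_idm)
  next
    case (Suc m)
    then show ?case unfolding A_Suc Psi_def by (intro psd_scale cpmap_psd z z') auto
  qed
  have "(\<lambda>m. \<theta> ^ m * sqrt (hsn n idm)) \<longlonglongrightarrow> 0 * sqrt (hsn n idm)"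
    using \<theta> by (intro tendsto_mult LIMSEQ_realpow_zero tendsto_const) auto
  then have "eventually (\<lambda>m. \<theta> ^ m * sqrt (hsn n idm) < 1/2) sequentially"
    by (intro order_tendstoD(2)[of _ 0]) auto
  then obtain N where N: "\<And>m. m \<ge> N \<Longrightarrow> \<theta> ^ m * sqrt (hsn n idm) < 1/2"
    by (auto simp: eventually_sequentially)
  \<comment> \<open>Cutting the series at \<open>M\<close> gives
    \<open>Psi a = a - idm + A M\<close> as forms. The remainder \<open>A M\<close> is at most half
    the identity, so \<open>Psi a\<close> stays below \<open>a\<close> by at least half the
    identity: this is room for a correction.\<close>
  define M where "M = Suc N"
  have AM: "sqrt (hsn n (A M)) \<le> 1/2" using A_le[of M] N[of M] by (simp add: M_def)
  define a where "a = (\<lambda>i j. \<Sum>m<M. A m i j)"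
  have psd_a: "psd n a" unfolding a_def by (intro psd_sum A_psd)
  have Psi_a: "qform n (Psi a) v = qform n a v - sqn n v + qform n (A M) v" for v
  proof -
    have "Psi a = (\<lambda>i j. \<Sum>m<M. A (Suc m) i j)"
      unfolding a_def A_Suc Psi_def cpmap_sum by (simp add: sum_distrib_left)
    then have "qform n (Psi a) v = (\<Sum>m<M. qform n (A (Suc m)) v)" by (simp add: qform_sum)
    also have "\<dots> = (\<Sum>m<M. qform n (A m) v) - qform n (A 0) v + qform n (A M) v"
      using sum.lessThan_Suc_shift[of "\<lambda>m. qform n (A m) v" M] by simp
    also have "A 0 = idm" by (simp add: A_def)
    finally show ?thesis by (simp add: a_def qform_sum qform_idm)
  qed
  define D where "D = sqrt (hsn n (cpmap n ?z' idm)) + 1"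
  \<comment> \<open>Adding \<open>\<epsilon>\<close> times the identity makes \<open>b\<close>
    positive definite. In the second inequality this costs at most
    \<open>\<epsilon> * D = c\<^sup>2 / 2\<close>, exactly the room left by the truncation. The
    summand 1 in \<open>D\<close> keeps it positive.\<close>
  define \<epsilon> where "\<epsilon> = c\<^sup>2 / (2 * D)"
  have D: "D > 0" by (simp add: D_def add_nonneg_pos)
  have \<epsilon>: "\<epsilon> > 0" using c D by (simp add: \<epsilon>_def)
  define b where "b = (\<lambda>i j. of_real (1 / c\<^sup>2) * cpmap n z a i j + of_real \<epsilon> * idm i j)"
  have psd_b: "psd n b" unfolding b_def using \<epsilon> by (intro psd_add psd_scale cpmap_psd z psd_a psd_idm) auto
  have qb: "qform n b v = 1 / c\<^sup>2 * qform n (cpmap n z a) v + \<epsilon> * sqn n v" for v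
    unfolding b_def qform_add qform_scale qform_idm ..
  show thesis
  proof
    show "hermitian n a" "hermitian n b" using psd_a psd_b by (auto simp: psd_def)
    show "min 1 \<epsilon> > 0" using \<epsilon> by simp
    show "qform n a v \<ge> min 1 \<epsilon> * sqn n v" for v
    proof -
      have "qform n a v = (\<Sum>m<N. qform n (A (Suc m)) v) + qform n (A 0) v"
        unfolding a_def qform_sum M_def by (subst sum.lessThan_Suc_shift) simp
      moreover have "(\<Sum>m<N. qform n (A (Suc m)) v) \<ge> 0" using A_psd by (intro sum_nonneg) (auto simp: psd_def)
      moreover have "qform n (A 0) v = sqn n v" by (simp add: A_def qform_idm)
      moreover have "min 1 \<epsilon> * sqn n v \<le> 1 * sqn n v" by (intro mult_right_mono) auto
      ultimately show ?thesis by linarith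
    qed
    show "qform n b v \<ge> min 1 \<epsilon> * sqn n v" for v
    proof -
      have "qform n (cpmap n z a) v \<ge> 0" using cpmap_psd[OF z psd_a] by (simp add: psd_def)
      moreover have "min 1 \<epsilon> * sqn n v \<le> \<epsilon> * sqn n v" by (intro mult_right_mono) auto
      ultimately show ?thesis unfolding qb by (smt (verit) divide_nonneg_nonneg mult_nonneg_nonneg zero_le_power2)
    qed
    show "(\<Sum>k<K. qform n a (\<lambda>j. \<Sum>i<n. cnj (z k i j) * v i)) \<le> c\<^sup>2 * qform n b v" for K v
    proof -
      have "c\<^sup>2 * qform n b v = qform n (cpmap n z a) v + c\<^sup>2 * (\<epsilon> * sqn n v)"
        unfolding qb distrib_left using c by simp
      moreover have "c\<^sup>2 * (\<epsilon> * sqn n v) \<ge> 0" using \<epsilon> by simp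
      ultimately show ?thesis using cpmap_qform_partial[OF z psd_a, of v K] by linarith
    qed
    show "(\<Sum>k<K. qform n b (\<lambda>i. \<Sum>j<n. z k i j * v j)) \<le> c\<^sup>2 * qform n a v" for K v
    proof -
      have "(\<Sum>k<K. qform n b (\<lambda>i. \<Sum>j<n. z k i j * v j)) \<le> qform n (cpmap n ?z' b) v"
        using cpmap_qform_partial[OF z' psd_b, of v K] by (simp add: adjoint_family_def)
      also have "\<dots> = 1 / c\<^sup>2 * qform n (cpmap n ?z' (cpmap n z a)) v + \<epsilon> * qform n (cpmap n ?z' idm) v"
        unfolding b_def cpmap_add cpmap_scale qform_add qform_scale ..
      also have "1 / c\<^sup>2 * qform n (cpmap n ?z' (cpmap n z a)) v = c\<^sup>2 * qform n (Psi a) v"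
        unfolding Psi_def qform_scale using c by (simp add: power2_eq_square power4_eq_xxxx)
      also have "\<dots> = c\<^sup>2 * qform n a v - c\<^sup>2 * sqn n v + c\<^sup>2 * qform n (A M) v"
        unfolding Psi_a by (simp add: algebra_simps)
      also have "c\<^sup>2 * qform n (A M) v \<le> c\<^sup>2 * (1/2 * sqn n v)"
        using order_trans[OF qform_le_hsn mult_right_mono[OF AM sqn_nonneg]] by (intro mult_left_mono) auto
      also have "\<epsilon> * qform n (cpmap n ?z' idm) v \<le> \<epsilon> * (D * sqn n v)"
        using \<epsilon> by (intro mult_left_mono order_trans[OF qform_le_hsn] mult_right_mono) (auto simp: D_def)
      also have "\<dots> = c\<^sup>2 * (1/2 * sqn n v)" using D by (simp add: \<epsilon>_def)
      finally show ?thesis by simp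
    qed
  qed
qed

section \<open>Complex powers of positive definite matrices and the extremal family\<close>

lemma positive_definite_diagonalization:
  assumes a: "hermitian n a" and \<delta>: "\<delta> > 0" "\<And>v. qform n a v \<ge> \<delta> * sqn n v"
  obtains u \<alpha> where "orthonormal n u" "\<And>l. l < n \<Longrightarrow> \<alpha> l > 0"
    "\<And>x. qform n a x = (\<Sum>l<n. \<alpha> l * (cmod (iprod n x (u l)))\<^sup>2)"
proof -
  obtain u \<alpha> where u: "orthonormal n u"
    and ev: "\<And>l i. l < n \<Longrightarrow> i < n \<Longrightarrow> apply_mat n a (u l) i = of_real (\<alpha> l) * u l i"
    using hermitian_diagonalization[OF a] by blast
  have unit: "sqn n (u l) = 1" if "l < n" for l
    using u that iprod_self[of n "u l"] unfolding orthonormal_def by (metis of_real_eq_1_iff)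
  have ip: "iprod n (apply_mat n a x) (u l) = of_real (\<alpha> l) * iprod n x (u l)" if "l < n" for x l
  proof -
    have "iprod n (apply_mat n a x) (u l) = iprod n x (\<lambda>i. of_real (\<alpha> l) * u l i)"
      unfolding hermitian_iprod[OF a] using ev that by (intro iprod_cong) auto
    then show ?thesis by (simp add: iprod_scale_right)
  qed
  have q: "qform n a x = (\<Sum>l<n. \<alpha> l * (cmod (iprod n x (u l)))\<^sup>2)" for x
  proof -
    have "iprod n (apply_mat n a x) x = iprod n (apply_mat n a x) (\<lambda>i. \<Sum>l<n. iprod n x (u l) * u l i)"
      using orthonormal_expansion(1)[OF u] by (intro iprod_cong) auto
    also have "\<dots> = (\<Sum>l<n. of_real (\<alpha> l) * (iprod n x (u l) * cnj (iprod n x (u l))))"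
      unfolding iprod_sum_right iprod_scale_right by (intro sum.cong refl) (simp add: ip)
    also have "\<dots> = of_real (\<Sum>l<n. \<alpha> l * (cmod (iprod n x (u l)))\<^sup>2)"
      by (simp add: complex_norm_square del: of_real_power)
    finally show ?thesis unfolding qform_iprod by simp
  qed
  have "\<alpha> l > 0" if "l < n" for l
  proof -
    have "qform n a (u l) = (\<Sum>m<n. if m = l then \<alpha> l else 0)"
      unfolding q using u that by (intro sum.cong refl) (auto simp: orthonormal_def)
    then have "qform n a (u l) = \<alpha> l" using that by simp
    then show ?thesis using \<delta>(2)[of "u l"] unit[OF that] \<delta>(1) by simp
  qed
  then show thesis using that u q by blast
qed

lemma orthonormal_cnj: "orthonormal n u \<Longrightarrow> orthonormal n (\<lambda>l i. cnj (u l i))"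
proof -
  assume u: "orthonormal n u"
  have "iprod n (\<lambda>i. cnj (u l i)) (\<lambda>i. cnj (u m i)) = cnj (iprod n (u l) (u m))" for l m
    by (simp add: iprod_def)
  then show ?thesis using u unfolding orthonormal_def by simp
qed

text \<open>The matrix with eigenvectors \<open>u\<close> and eigenvalues \<open>e\<close>;
  eigenvalues of the form \<open>exp (t * ln \<alpha>)\<close> make it a complex power of a positive
  definite matrix.\<close>

definition weighted_proj :: "nat \<Rightarrow> (nat \<Rightarrow> nat \<Rightarrow> complex) \<Rightarrow> (nat \<Rightarrow> complex) \<Rightarrow> nat \<Rightarrow> nat \<Rightarrow> complex" where
  "weighted_proj n u e i p = (\<Sum>m<n. e m * u m i * cnj (u m p))"

text \<open>The assumption \<open>le\<close> says, in eigenvector coordinates, that the sum of z' b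
  z over the matrices z of the family is at most \<open>c\<^sup>2\<close> times a, where z' is the
  adjoint of z, b has eigenvalues \<open>(cmod (e m))\<^sup>2\<close> and a has eigenvalues
  \<open>\<alpha> l\<close>. Applied to the image \<open>y\<close> of \<open>x\<close> under the
  matrix with eigenvalues \<open>d\<close>, the weights of a cancel against \<open>d\<close>, and
  the norm of \<open>x\<close> remains.\<close>

lemma weighted_col_bound:
  assumes u: "orthonormal n u" and w: "orthonormal n w"
    and le: "\<And>K v. (\<Sum>k<K. \<Sum>m<n. (cmod (e m))\<^sup>2 * (cmod (iprod n (\<lambda>i. \<Sum>j<n. z k i j * v j) (w m)))\<^sup>2)
      \<le> c\<^sup>2 * (\<Sum>l<n. \<alpha> l * (cmod (iprod n v (u l)))\<^sup>2)"
    and d: "\<And>l. l < n \<Longrightarrow> \<alpha> l * (cmod (d l))\<^sup>2 = 1"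
  shows "col_bound n (\<lambda>k i j. \<Sum>p<n. \<Sum>q<n. weighted_proj n w e i p * weighted_proj n u d q j * z k p q) c"
  unfolding col_bound_def
proof (intro allI)
  fix K x
  define y where "y = (\<lambda>q. \<Sum>l<n. d l * iprod n x (u l) * u l q)"
  have y: "y q = (\<Sum>j<n. weighted_proj n u d q j * x j)" for q
  proof -
    have "(\<Sum>j<n. weighted_proj n u d q j * x j) = (\<Sum>j<n. \<Sum>l<n. d l * u l q * (x j * cnj (u l j)))"
      unfolding weighted_proj_def sum_distrib_right by (intro sum.cong refl) (simp add: mult_ac)
    also have "\<dots> = (\<Sum>l<n. d l * u l q * (\<Sum>j<n. x j * cnj (u l j)))"
      unfolding sum_distrib_left by (rule sum.swap)
    finally show ?thesis by (simp add: y_def iprod_def mult_ac)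
  qed
  have yu: "iprod n y (u l) = d l * iprod n x (u l)" if "l < n" for l
  proof -
    have "iprod n y (u l) = (\<Sum>m<n. if m = l then d l * iprod n x (u l) else 0)"
      unfolding y_def iprod_sum_left iprod_scale_left using u that
      by (intro sum.cong refl) (auto simp: orthonormal_def)
    then show ?thesis using that by simp
  qed
  have f: "(\<Sum>j<n. (\<Sum>p<n. \<Sum>q<n. weighted_proj n w e i p * weighted_proj n u d q j * z k p q) * x j)
      = (\<Sum>m<n. (e m * iprod n (\<lambda>i. \<Sum>j<n. z k i j * y j) (w m)) * w m i)" for k i
  proof -
    have "(\<Sum>j<n. (\<Sum>p<n. \<Sum>q<n. weighted_proj n w e i p * weighted_proj n u d q j * z k p q) * x j)
      = (\<Sum>j<n. \<Sum>p<n. \<Sum>q<n. weighted_proj n w e i p * (z k p q * (weighted_proj n u d q j * x j)))"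
      unfolding sum_distrib_right by (intro sum.cong refl) (simp add: mult_ac)
    also have "\<dots> = (\<Sum>p<n. \<Sum>q<n. \<Sum>j<n. weighted_proj n w e i p * (z k p q * (weighted_proj n u d q j * x j)))"
      by (rule sum_swap3)
    also have "\<dots> = (\<Sum>p<n. weighted_proj n w e i p * (\<Sum>q<n. z k p q * y q))"
      by (simp only: y sum_distrib_left)
    also have "\<dots> = (\<Sum>p<n. \<Sum>m<n. e m * w m i * ((\<Sum>q<n. z k p q * y q) * cnj (w m p)))"
      unfolding weighted_proj_def sum_distrib_right by (intro sum.cong refl) (simp add: mult_ac sum_distrib_left)
    also have "\<dots> = (\<Sum>m<n. e m * w m i * (\<Sum>p<n. (\<Sum>q<n. z k p q * y q) * cnj (w m p)))"
      unfolding sum_distrib_left by (rule sum.swap)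
    finally show ?thesis by (simp add: iprod_def mult_ac)
  qed
  have wu: "sqn n (w l) = 1" if "l < n" for l
    using w that iprod_self[of n "w l"] unfolding orthonormal_def by (metis of_real_eq_1_iff)
  have "(\<Sum>k<K. sqn n (\<lambda>i. \<Sum>j<n. (\<Sum>p<n. \<Sum>q<n. weighted_proj n w e i p * weighted_proj n u d q j * z k p q) * x j))
     = (\<Sum>k<K. \<Sum>m<n. (cmod (e m))\<^sup>2 * (cmod (iprod n (\<lambda>i. \<Sum>j<n. z k i j * y j) (w m)))\<^sup>2)"
    unfolding f using w wu
    by (subst sqn_sum_orthogonal) (auto simp: orthonormal_def norm_mult power_mult_distrib)
  also have "\<dots> \<le> c\<^sup>2 * (\<Sum>l<n. \<alpha> l * (cmod (iprod n y (u l)))\<^sup>2)" by (rule le)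
  also have "(\<Sum>l<n. \<alpha> l * (cmod (iprod n y (u l)))\<^sup>2) = (\<Sum>l<n. (\<alpha> l * (cmod (d l))\<^sup>2) * (cmod (iprod n x (u l)))\<^sup>2)"
    by (simp add: yu norm_mult power_mult_distrib mult_ac)
  also have "\<dots> = (\<Sum>l<n. (cmod (iprod n x (u l)))\<^sup>2)" by (simp add: d)
  also have "\<dots> \<le> sqn n x" by (cases n) (use orthonormal_expansion(2)[OF u, of 0 x] in auto)
  finally show "(\<Sum>k<K. sqn n (\<lambda>i. \<Sum>j<n. (\<Sum>p<n. \<Sum>q<n. weighted_proj n w e i p * weighted_proj n u d q j * z k p q) * x j))
      \<le> c\<^sup>2 * sqn n x" by (simp add: mult_left_mono)
qed

lemma strip_fun_exp_affine: "strip_fun (\<lambda>s. exp ((s - 1/2) * of_real a))" "strip_fun (\<lambda>s. exp ((1/2 - s) * of_real a))"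
proof -
  have "strip_fun (\<lambda>s. exp (- of_real a / 2) * exp (s * of_real a))" by (intro strip_fun_mult strip_fun_const strip_fun_exp)
  then show "strip_fun (\<lambda>s. exp ((s - 1/2) * of_real a))" by (simp add: exp_add[symmetric] algebra_simps)
  have "strip_fun (\<lambda>s. exp (of_real a / 2) * exp (s * of_real (- a)))" by (intro strip_fun_mult strip_fun_const strip_fun_exp)
  then show "strip_fun (\<lambda>s. exp ((1/2 - s) * of_real a))" by (simp add: exp_add[symmetric] algebra_simps)
qed

lemma weighted_proj_1:
  assumes u: "orthonormal n u" and "i < n" "p < n"
  shows "weighted_proj n u (\<lambda>_. 1) i p = (if i = p then 1 else 0)"
proof -
  let ?e = "\<lambda>j. if j = p then 1 else 0 :: complex"
  have "iprod n ?e v = cnj (v p)" for v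
  proof -
    have "iprod n ?e v = (\<Sum>j<n. if j = p then cnj (v p) else 0)" unfolding iprod_def by (intro sum.cong) auto
    then show ?thesis using assms by simp
  qed
  then show ?thesis using orthonormal_expansion(1)[OF u assms(2), of ?e] by (simp add: weighted_proj_def mult_ac)
qed

text \<open>The extremal analytic family is \<open>b\<^bsup>s-1/2\<^esup> z a\<^bsup>1/2-s\<^esup>\<close>.\<close>

theorem interpolating_family:
  assumes z: "sq_summable n z" and \<kappa>: "\<kappa> \<ge> 0" "\<kappa> < c\<^sup>2" and c: "c > 0"
    and le: "\<And>X. sqrt (hsn n (cpmap n z X)) \<le> \<kappa> * sqrt (hsn n X)"
  obtains H where "\<And>i j p q. strip_fun (H i j p q)"
    "\<And>i j p q. i < n \<Longrightarrow> j < n \<Longrightarrow> p < n \<Longrightarrow> q < n \<Longrightarrow> H i j p q (1/2) = (if i = p \<and> j = q then 1 else 0)"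
    "adm n (\<lambda>k i j s. \<Sum>p<n. \<Sum>q<n. H i j p q s * z k p q) c"
proof -
  obtain a b \<delta> where ab: "hermitian n a" "hermitian n b" "\<delta> > 0"
    "\<And>v. qform n a v \<ge> \<delta> * sqn n v" "\<And>v. qform n b v \<ge> \<delta> * sqn n v"
    and le1: "\<And>K v. (\<Sum>k<K. qform n a (\<lambda>j. \<Sum>i<n. cnj (z k i j) * v i)) \<le> c\<^sup>2 * qform n b v"
    and le2: "\<And>K v. (\<Sum>k<K. qform n b (\<lambda>i. \<Sum>j<n. z k i j * v j)) \<le> c\<^sup>2 * qform n a v"
    using subinvariant_pair[OF assms] by blast
  obtain u \<alpha> where u: "orthonormal n u" and \<alpha>: "\<And>l. l < n \<Longrightarrow> \<alpha> l > 0"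
    and qa: "\<And>x. qform n a x = (\<Sum>l<n. \<alpha> l * (cmod (iprod n x (u l)))\<^sup>2)"
    using positive_definite_diagonalization[OF ab(1,3,4)] by blast
  obtain w \<beta> where w: "orthonormal n w" and \<beta>: "\<And>l. l < n \<Longrightarrow> \<beta> l > 0"
    and qb: "\<And>x. qform n b x = (\<Sum>l<n. \<beta> l * (cmod (iprod n x (w l)))\<^sup>2)"
    using positive_definite_diagonalization[OF ab(2,3,5)] by blast
  define e where "e = (\<lambda>s m. exp ((s - 1/2) * complex_of_real (ln (\<beta> m))))"
  define d where "d = (\<lambda>s l. exp ((1/2 - s) * complex_of_real (ln (\<alpha> l))))"
  \<comment> \<open>An entry of b to the power s - 1/2 times an entry of a to the power 1/2 - s. The
    coordinate k does not occur, so values and derivatives of the family are finite combinations of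
    the entries of \<open>z\<close>.\<close>
  define H where "H = (\<lambda>i j p q s. weighted_proj n w (e s) i p * weighted_proj n u (d s) q j)"
  have sH: "strip_fun (H i j p q)" for i j p q
    unfolding H_def weighted_proj_def e_def d_def
    by (intro strip_fun_mult strip_fun_sum strip_fun_const strip_fun_exp_affine)
  have "e (1/2) = (\<lambda>_. 1)" "d (1/2) = (\<lambda>_. 1)" by (auto simp: e_def d_def)
  then have H_half: "H i j p q (1/2) = (if i = p \<and> j = q then 1 else 0)" if "i < n" "j < n" "p < n" "q < n" for i j p q
    using that by (simp add: H_def weighted_proj_1[OF w] weighted_proj_1[OF u])
  have sq: "(cmod (exp (t * of_real (ln x))))\<^sup>2 = exp (2 * (Re t * ln x))" for t x
    by (simp add: exp_double)
  have pow: "(cmod (exp (t * of_real (ln x))))\<^sup>2 = x" if "x > 0" "Re t = 1/2" for t x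
  proof -
    have *: "2 * (Re t * ln x) = ln x" using that(2) by simp
    show ?thesis unfolding sq * using that(1) by simp
  qed
  have pow': "x * (cmod (exp (t * of_real (ln x))))\<^sup>2 = 1" if "x > 0" "Re t = -1/2" for t x
  proof -
    have *: "2 * (Re t * ln x) = - ln x" using that(2) by simp
    show ?thesis unfolding sq * using that(1) by (simp add: exp_minus)
  qed
  have col: "col_bound n (\<lambda>k i j. \<Sum>p<n. \<Sum>q<n. H i j p q s * z k p q) c" if s: "Re s = 1" for s
    unfolding H_def
  proof (rule weighted_col_bound[OF u w])
    show "\<alpha> l * (cmod (d s l))\<^sup>2 = 1" if "l < n" for l
      unfolding d_def using s by (intro pow' \<alpha>[OF that]) simp
    have ee: "(cmod (e s m))\<^sup>2 = \<beta> m" if "m < n" for m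
      unfolding e_def using s by (intro pow \<beta>[OF that]) simp
    show "(\<Sum>k<K. \<Sum>m<n. (cmod (e s m))\<^sup>2 * (cmod (iprod n (\<lambda>i. \<Sum>j<n. z k i j * v j) (w m)))\<^sup>2)
      \<le> c\<^sup>2 * (\<Sum>l<n. \<alpha> l * (cmod (iprod n v (u l)))\<^sup>2)" for K v
      using le2[of v K] unfolding qa qb by (simp add: ee)
  qed
  have row: "row_bound n (\<lambda>k i j. \<Sum>p<n. \<Sum>q<n. H i j p q s * z k p q) c" if s: "Re s = 0" for s
  proof -
    \<comment> \<open>The row bound is the column bound of the transposed family. Transposing the
      powers of a and b conjugates their eigenvectors, and a and b change places.\<close>
    let ?u = "\<lambda>l i. cnj (u l i)" and ?w = "\<lambda>l i. cnj (w l i)"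
    have "col_bound n (\<lambda>k i j. \<Sum>p<n. \<Sum>q<n. weighted_proj n ?u (d s) i p * weighted_proj n ?w (e s) q j * z k q p) c"
    proof (rule weighted_col_bound[OF orthonormal_cnj[OF w] orthonormal_cnj[OF u]])
      show "\<beta> l * (cmod (e s l))\<^sup>2 = 1" if "l < n" for l
        unfolding e_def using s by (intro pow' \<beta>[OF that]) simp
      have dd: "(cmod (d s m))\<^sup>2 = \<alpha> m" if "m < n" for m
        unfolding d_def using s by (intro pow \<alpha>[OF that]) simp
      have c1: "cmod (iprod n (\<lambda>i. \<Sum>j<n. z k j i * v j) (?u m)) = cmod (iprod n (\<lambda>j. \<Sum>i<n. cnj (z k i j) * cnj (v i)) (u m))" for k v m
        by (subst complex_mod_cnj[symmetric]) (simp add: iprod_def)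
      have c2: "cmod (iprod n v (?w m)) = cmod (iprod n (\<lambda>i. cnj (v i)) (w m))" for v m
        by (subst complex_mod_cnj[symmetric]) (simp add: iprod_def)
      show "(\<Sum>k<K. \<Sum>m<n. (cmod (d s m))\<^sup>2 * (cmod (iprod n (\<lambda>i. \<Sum>j<n. z k j i * v j) (?u m)))\<^sup>2)
        \<le> c\<^sup>2 * (\<Sum>l<n. \<beta> l * (cmod (iprod n v (?w l)))\<^sup>2)" for K v
        using le1[where K = K and v = "\<lambda>i. cnj (v i)"] unfolding qa qb c1 c2 by (simp add: dd)
    qed
    moreover have "(\<Sum>p<n. \<Sum>q<n. weighted_proj n ?u (d s) i p * weighted_proj n ?w (e s) q j * z k q p)
       = (\<Sum>p<n. \<Sum>q<n. H j i p q s * z k p q)" for k i j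
      by (subst sum.swap) (simp add: H_def weighted_proj_def mult_ac)
    ultimately show ?thesis unfolding row_bound_def by simp
  qed
  have "adm n (\<lambda>k i j s. \<Sum>p<n. \<Sum>q<n. H i j p q s * z k p q) c"
    unfolding adm_def using c row col by (auto intro!: strip_fun_sum strip_fun_mult strip_fun_const sH)
  then show thesis using that sH H_half by blast
qed

section \<open>Operations on admissible families\<close>

lemma col_boundD: "col_bound n z c \<Longrightarrow> (\<Sum>k<K. sqn n (\<lambda>i. \<Sum>j<n. z k i j * v j)) \<le> c\<^sup>2 * sqn n v"
  by (simp add: col_bound_def)

lemma col_bound_mono: "col_bound n z c \<Longrightarrow> 0 \<le> c \<Longrightarrow> c \<le> d \<Longrightarrow> col_bound n z d"
  unfolding col_bound_def by (meson mult_right_mono order_trans power_mono sqn_nonneg)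

lemma col_bound_scale:
  assumes "col_bound n z c" shows "col_bound n (\<lambda>k i j. a * z k i j) (cmod a * c)"
  unfolding col_bound_def
proof (intro allI)
  fix K v
  have "(\<Sum>k<K. sqn n (\<lambda>i. \<Sum>j<n. a * z k i j * v j)) = (cmod a)\<^sup>2 * (\<Sum>k<K. sqn n (\<lambda>i. \<Sum>j<n. z k i j * v j))"
    by (simp add: sqn_scale[symmetric] sum_distrib_left mult.assoc)
  also have "\<dots> \<le> (cmod a)\<^sup>2 * (c\<^sup>2 * sqn n v)" by (intro mult_left_mono col_boundD assms) auto
  finally show "(\<Sum>k<K. sqn n (\<lambda>i. \<Sum>j<n. a * z k i j * v j)) \<le> (cmod a * c)\<^sup>2 * sqn n v"
    by (simp add: power_mult_distrib mult.assoc)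
qed

lemma row_bound_scale:
  "row_bound n z c \<Longrightarrow> row_bound n (\<lambda>k i j. a * z k i j) (cmod a * c)"
  unfolding row_bound_def by (rule col_bound_scale)

lemma sqn_family_triangle:
  assumes "(\<Sum>k<K. sqn n (x k)) \<le> c\<^sup>2 * t" "(\<Sum>k<K. sqn n (y k)) \<le> d\<^sup>2 * t" "c \<ge> 0" "d \<ge> 0" "t \<ge> 0"
  shows "(\<Sum>k<K. sqn n (\<lambda>i. x k i + y k i)) \<le> (c + d)\<^sup>2 * t"
proof -
  let ?S = "{..<K} \<times> {..<n}"
  have eq: "(\<Sum>k<K. sqn n (x k)) = (\<Sum>p\<in>?S. (cmod (x (fst p) (snd p)))\<^sup>2)" for x
    by (simp add: sqn_def sum.cartesian_product case_prod_beta)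
  have le: "L2_set (\<lambda>p. cmod (x (fst p) (snd p))) ?S \<le> c * sqrt t" if "(\<Sum>k<K. sqn n (x k)) \<le> c\<^sup>2 * t" "c \<ge> 0" for x c
    unfolding L2_set_def eq[symmetric] using that \<open>t \<ge> 0\<close>
    by (intro real_le_lsqrt) (auto simp: power_mult_distrib sum_nonneg)
  have "L2_set (\<lambda>p. cmod (x (fst p) (snd p) + y (fst p) (snd p))) ?S
     \<le> L2_set (\<lambda>p. cmod (x (fst p) (snd p)) + cmod (y (fst p) (snd p))) ?S"
    by (intro L2_set_mono norm_triangle_ineq) auto
  also have "\<dots> \<le> L2_set (\<lambda>p. cmod (x (fst p) (snd p))) ?S + L2_set (\<lambda>p. cmod (y (fst p) (snd p))) ?S"
    by (rule L2_set_triangle_ineq)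
  also have "\<dots> \<le> (c + d) * sqrt t" using le[OF assms(1,3)] le[OF assms(2,4)] by (simp add: distrib_right)
  finally have "(L2_set (\<lambda>p. cmod (x (fst p) (snd p) + y (fst p) (snd p))) ?S)\<^sup>2 \<le> ((c + d) * sqrt t)\<^sup>2"
    by (intro power_mono) (auto simp: L2_set_nonneg)
  then show ?thesis
    using \<open>t \<ge> 0\<close> by (simp add: L2_set_def sum_nonneg power_mult_distrib eq[of "\<lambda>k i. x k i + y k i"])
qed

lemma col_bound_add:
  assumes "col_bound n z c" "col_bound n w d" "c \<ge> 0" "d \<ge> 0"
  shows "col_bound n (\<lambda>k i j. z k i j + w k i j) (c + d)"
  unfolding col_bound_def distrib_right sum.distrib
  by (intro allI sqn_family_triangle col_boundD assms) simp

lemma row_bound_add: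
  "row_bound n z c \<Longrightarrow> row_bound n w d \<Longrightarrow> c \<ge> 0 \<Longrightarrow> d \<ge> 0 \<Longrightarrow> row_bound n (\<lambda>k i j. z k i j + w k i j) (c + d)"
  unfolding row_bound_def by (rule col_bound_add)

definition opb :: "nat \<Rightarrow> nat \<Rightarrow> (nat \<Rightarrow> nat \<Rightarrow> complex) \<Rightarrow> real \<Rightarrow> bool" where
  "opb n m a C \<longleftrightarrow> C \<ge> 0 \<and> (\<forall>v. sqn n (\<lambda>i. \<Sum>j<m. a i j * v j) \<le> C\<^sup>2 * sqn m v)"

lemma opbD: "opb n m a C \<Longrightarrow> sqn n (\<lambda>i. \<Sum>j<m. a i j * v j) \<le> C\<^sup>2 * sqn m v"
  by (simp add: opb_def)

text \<open>For x, the transpose of \<open>a\<close> applied to \<open>v\<close>, the number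
  \<open>sqn m x\<close> is the bilinear pairing of \<open>v\<close> with \<open>a\<close> applied
  to the conjugate of x. Cauchy-Schwarz bounds its square by
  \<open>sqn n v * (C\<^sup>2 * sqn m x)\<close>, and one factor cancels.\<close>

lemma opb_transpose:
  assumes "opb n m a C" shows "opb m n (\<lambda>j i. a i j) C"
  unfolding opb_def
proof (intro conjI allI)
  show C: "C \<ge> 0" using assms by (simp add: opb_def)
  fix v
  define x where "x = (\<lambda>j. \<Sum>i<n. a i j * v i)"
  have "complex_of_real (sqn m x) = (\<Sum>j<m. \<Sum>i<n. a i j * v i * cnj (x j))"
    unfolding of_real_sqn by (simp add: x_def sum_distrib_right)
  also have "\<dots> = (\<Sum>i<n. v i * (\<Sum>j<m. a i j * cnj (x j)))"
    by (subst sum.swap) (simp add: sum_distrib_left mult_ac)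
  finally have "(sqn m x)\<^sup>2 = (cmod (\<Sum>i<n. v i * (\<Sum>j<m. a i j * cnj (x j))))\<^sup>2"
    by (metis norm_of_real power2_abs)
  also have "\<dots> \<le> sqn n v * sqn n (\<lambda>i. \<Sum>j<m. a i j * cnj (x j))" by (rule Cauchy_Schwarz_square)
  also have "\<dots> \<le> sqn n v * (C\<^sup>2 * sqn m (\<lambda>j. cnj (x j)))"
  proof (intro mult_left_mono)
    show "sqn n (\<lambda>i. \<Sum>j<m. a i j * cnj (x j)) \<le> C\<^sup>2 * sqn m (\<lambda>j. cnj (x j))" by (rule opbD[OF assms])
  qed simp
  finally have "sqn m x * sqn m x \<le> (C\<^sup>2 * sqn n v) * sqn m x" by (simp add: power2_eq_square mult_ac)
  then show "sqn m x \<le> C\<^sup>2 * sqn n v"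
    by (cases "sqn m x = 0") (use mult_right_le_imp_le[of "sqn m x" "sqn m x" "C\<^sup>2 * sqn n v"] sqn_nonneg[of m x] in \<open>auto simp: less_le\<close>)
qed

lemma col_bound_bimult:
  assumes z: "col_bound m z c" and a: "opb n m a A" and b: "opb m n b B"
  shows "col_bound n (\<lambda>k i j. \<Sum>p<m. \<Sum>q<m. a i p * b q j * z k p q) (A * c * B)"
  unfolding col_bound_def
proof (intro allI)
  fix K v
  define y where "y = (\<lambda>q. \<Sum>j<n. b q j * v j)"
  have eq: "(\<Sum>j<n. (\<Sum>p<m. \<Sum>q<m. a i p * b q j * z k p q) * v j) = (\<Sum>p<m. a i p * (\<Sum>q<m. z k p q * y q))" for i k
  proof -
    have "(\<Sum>j<n. (\<Sum>p<m. \<Sum>q<m. a i p * b q j * z k p q) * v j) = (\<Sum>j<n. \<Sum>p<m. \<Sum>q<m. a i p * (z k p q * (b q j * v j)))"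
      unfolding sum_distrib_right by (intro sum.cong refl) (simp add: mult_ac)
    also have "\<dots> = (\<Sum>p<m. \<Sum>q<m. \<Sum>j<n. a i p * (z k p q * (b q j * v j)))" by (rule sum_swap3)
    finally show ?thesis by (simp only: y_def sum_distrib_left)
  qed
  have "(\<Sum>k<K. sqn n (\<lambda>i. \<Sum>p<m. a i p * (\<Sum>q<m. z k p q * y q))) \<le> (\<Sum>k<K. A\<^sup>2 * sqn m (\<lambda>p. \<Sum>q<m. z k p q * y q))"
    using a by (intro sum_mono) (simp add: opb_def)
  also have "\<dots> = A\<^sup>2 * (\<Sum>k<K. sqn m (\<lambda>p. \<Sum>q<m. z k p q * y q))" by (simp add: sum_distrib_left)
  also have "\<dots> \<le> A\<^sup>2 * (c\<^sup>2 * sqn m y)" by (intro mult_left_mono col_boundD z) auto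
  also have "\<dots> \<le> A\<^sup>2 * (c\<^sup>2 * (B\<^sup>2 * sqn n v))"
    using b unfolding y_def by (intro mult_left_mono) (auto simp: opb_def)
  finally show "(\<Sum>k<K. sqn n (\<lambda>i. \<Sum>j<n. (\<Sum>p<m. \<Sum>q<m. a i p * b q j * z k p q) * v j)) \<le> (A * c * B)\<^sup>2 * sqn n v"
    unfolding eq by (simp add: power_mult_distrib mult_ac)
qed

lemma row_bound_bimult:
  assumes z: "row_bound m z c" and a: "opb n m a A" and b: "opb m n b B"
  shows "row_bound n (\<lambda>k i j. \<Sum>p<m. \<Sum>q<m. a i p * b q j * z k p q) (A * c * B)"
proof -
  have "col_bound n (\<lambda>k i j. \<Sum>p<m. \<Sum>q<m. b p i * a j q * z k q p) (B * c * A)"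
    by (rule col_bound_bimult[OF z[unfolded row_bound_def] opb_transpose[OF b] opb_transpose[OF a]])
  moreover have "(\<Sum>p<m. \<Sum>q<m. b p i * a j q * z k q p) = (\<Sum>p<m. \<Sum>q<m. a j p * b q i * z k p q)" for k i j
    by (rule trans[OF sum.swap]) (simp add: mult_ac)
  moreover have "B * c * A = A * c * B" by simp
  ultimately show ?thesis unfolding row_bound_def by (simp only:)
qed

lemma sum_lessThan_add: "(\<Sum>i<m + n. f i) = (\<Sum>i<m. f i) + (\<Sum>i<n. f (m + i :: nat))"
  for f :: "nat \<Rightarrow> 'a::comm_monoid_add"
  by (induction n) (simp_all add: add.assoc)

definition block :: "nat \<Rightarrow> (nat \<Rightarrow> nat \<Rightarrow> 'a::zero) \<Rightarrow> (nat \<Rightarrow> nat \<Rightarrow> 'a) \<Rightarrow> nat \<Rightarrow> nat \<Rightarrow> 'a" where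
  "block m x y i j = (if i < m \<and> j < m then x i j else if i \<ge> m \<and> j \<ge> m then y (i - m) (j - m) else 0)"

lemma col_bound_block:
  assumes z: "col_bound m z c" and w: "col_bound n w c"
  shows "col_bound (m + n) (\<lambda>k. block m (z k) (w k)) c"
  unfolding col_bound_def
proof (intro allI)
  fix K v
  have "sqn (m + n) (\<lambda>i. \<Sum>j<m + n. block m (z k) (w k) i j * v j)
     = sqn m (\<lambda>i. \<Sum>j<m. z k i j * v j) + sqn n (\<lambda>i. \<Sum>j<n. w k i j * v (m + j))" for k
    unfolding sqn_def sum_lessThan_add by (simp add: block_def)
  then have "(\<Sum>k<K. sqn (m + n) (\<lambda>i. \<Sum>j<m + n. block m (z k) (w k) i j * v j))
     = (\<Sum>k<K. sqn m (\<lambda>i. \<Sum>j<m. z k i j * v j)) + (\<Sum>k<K. sqn n (\<lambda>i. \<Sum>j<n. w k i j * v (m + j)))"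
    by (simp add: sum.distrib)
  also have "\<dots> \<le> c\<^sup>2 * sqn m v + c\<^sup>2 * sqn n (\<lambda>j. v (m + j))" by (intro add_mono col_boundD z w)
  also have "\<dots> = c\<^sup>2 * sqn (m + n) v" by (simp add: sqn_def sum_lessThan_add distrib_left)
  finally show "(\<Sum>k<K. sqn (m + n) (\<lambda>i. \<Sum>j<m + n. block m (z k) (w k) i j * v j)) \<le> c\<^sup>2 * sqn (m + n) v" .
qed

lemma block_transpose: "block m x y j i = block m (\<lambda>i j. x j i) (\<lambda>i j. y j i) i j"
  by (auto simp: block_def)

lemma row_bound_block:
  "row_bound m z c \<Longrightarrow> row_bound n w c \<Longrightarrow> row_bound (m + n) (\<lambda>k. block m (z k) (w k)) c"
proof -
  assume "row_bound m z c" "row_bound n w c"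
  then have "col_bound (m + n) (\<lambda>k. block m (\<lambda>i j. z k j i) (\<lambda>i j. w k j i)) c"
    unfolding row_bound_def by (rule col_bound_block)
  moreover have "(\<lambda>k i j. block m (z k) (w k) j i) = (\<lambda>k. block m (\<lambda>i j. z k j i) (\<lambda>i j. w k j i))"
    by (intro ext block_transpose)
  ultimately show ?thesis unfolding row_bound_def by simp
qed

lemma sq_summable_col_bound:
  assumes "\<And>i j. i < n \<Longrightarrow> j < n \<Longrightarrow> summable (\<lambda>k. (cmod (z k i j))\<^sup>2)"
  shows "col_bound n z (sqrt (\<Sum>i<n. \<Sum>j<n. \<Sum>k. (cmod (z k i j))\<^sup>2))"
  unfolding col_bound_def
proof (intro allI)
  fix K v
  have "(\<Sum>k<K. sqn n (\<lambda>i. \<Sum>j<n. z k i j * v j)) \<le> (\<Sum>k<K. \<Sum>i<n. sqn n (z k i) * sqn n v)"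
    by (subst sqn_def) (intro sum_mono Cauchy_Schwarz_square)
  also have "\<dots> = (\<Sum>i<n. \<Sum>j<n. \<Sum>k<K. (cmod (z k i j))\<^sup>2) * sqn n v"
  proof -
    have "(\<Sum>k<K. \<Sum>i<n. sqn n (z k i)) = (\<Sum>i<n. \<Sum>j<n. \<Sum>k<K. (cmod (z k i j))\<^sup>2)"
      unfolding sqn_def by (rule sum_swap3)
    then show ?thesis by (simp add: sum_distrib_right[symmetric])
  qed
  also have "\<dots> \<le> (\<Sum>i<n. \<Sum>j<n. \<Sum>k. (cmod (z k i j))\<^sup>2) * sqn n v"
    using assms by (intro mult_right_mono sum_mono sum_le_suminf) auto
  also have "(\<Sum>i<n. \<Sum>j<n. \<Sum>k. (cmod (z k i j))\<^sup>2) = (sqrt (\<Sum>i<n. \<Sum>j<n. \<Sum>k. (cmod (z k i j))\<^sup>2))\<^sup>2"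
    using assms by (intro real_sqrt_pow2[symmetric] sum_nonneg suminf_nonneg) auto
  finally show "(\<Sum>k<K. sqn n (\<lambda>i. \<Sum>j<n. z k i j * v j)) \<le> (sqrt (\<Sum>i<n. \<Sum>j<n. \<Sum>k. (cmod (z k i j))\<^sup>2))\<^sup>2 * sqn n v" .
qed

lemma sq_summable_row_bound:
  assumes "\<And>i j. i < n \<Longrightarrow> j < n \<Longrightarrow> summable (\<lambda>k. (cmod (z k i j))\<^sup>2)"
  shows "row_bound n z (sqrt (\<Sum>i<n. \<Sum>j<n. \<Sum>k. (cmod (z k i j))\<^sup>2))"
proof -
  have "row_bound n z (sqrt (\<Sum>i<n. \<Sum>j<n. \<Sum>k. (cmod (z k j i))\<^sup>2))"
    unfolding row_bound_def by (rule sq_summable_col_bound) (rule assms)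
  moreover have "(\<Sum>i<n. \<Sum>j<n. \<Sum>k. (cmod (z k j i))\<^sup>2) = (\<Sum>i<n. \<Sum>j<n. \<Sum>k. (cmod (z k i j))\<^sup>2)"
    by (rule sum.swap)
  ultimately show ?thesis by simp
qed

lemma adm_mono: "adm n f c \<Longrightarrow> c \<le> d \<Longrightarrow> adm n f d"
  unfolding adm_def row_bound_def by (auto intro: col_bound_mono)

lemma adm_const:
  assumes "\<And>i j. i < n \<Longrightarrow> j < n \<Longrightarrow> summable (\<lambda>k. (cmod (z k i j))\<^sup>2)"
  shows "adm n (\<lambda>k i j s. z k i j) (sqrt (\<Sum>i<n. \<Sum>j<n. \<Sum>k. (cmod (z k i j))\<^sup>2))"
  unfolding adm_def using assms
  by (auto intro!: sq_summable_col_bound sq_summable_row_bound sum_nonneg suminf_nonneg)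

lemma adm_add:
  assumes "adm n f c" "adm n g d" shows "adm n (\<lambda>k i j s. f k i j s + g k i j s) (c + d)"
  using assms unfolding adm_def by (auto intro!: col_bound_add row_bound_add)

lemma adm_bimult:
  assumes f: "adm m f c" and a: "opb n m a A" and b: "opb m n b B"
  shows "adm n (\<lambda>k i j s. \<Sum>p<m. \<Sum>q<m. a i p * b q j * f k p q s) (A * c * B)"
  using assms unfolding adm_def
  by (auto intro!: strip_fun_sum strip_fun_mult col_bound_bimult row_bound_bimult simp: opb_def)

lemma adm_block:
  assumes "adm m f c" "adm n g c"
  shows "adm (m + n) (\<lambda>k i j s. block m (\<lambda>i j. f k i j s) (\<lambda>i j. g k i j s) i j) c"
proof -
  have "strip_fun (\<lambda>s. block m (\<lambda>i j. f k i j s) (\<lambda>i j. g k i j s) i j)" if "i < m + n" "j < m + n" for k i j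
    using assms that unfolding adm_def block_def by (cases "i < m"; cases "j < m") auto
  then show ?thesis using assms unfolding adm_def
    by (auto intro!: col_bound_block row_bound_block)
qed

section \<open>Multiplication and division by the conformal map\<close>

text \<open>The conformal map of the strip onto the unit disc that vanishes at the midpoint: the
  exponential maps the strip to the right half plane.\<close>

definition hpm :: "complex \<Rightarrow> complex" where "hpm s = exp (\<i> * of_real pi * (s - 1/2))"

definition disc_map :: "complex \<Rightarrow> complex" where "disc_map s = (hpm s - 1) / (hpm s + 1)"

text \<open>The derivative of \<open>disc_map\<close> at 1/2: there \<open>hpm\<close> has value 1
  and derivative \<open>\<i> * pi\<close>, and (h - 1) / (h + 1) has derivative 1/2 at h =
  1.\<close>

definition dm_deriv :: complex where "dm_deriv = \<i> * of_real pi / 2"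

lemma dm_deriv_nonzero [simp]: "dm_deriv \<noteq> 0"
  by (simp add: dm_deriv_def)

lemma Re_hpm: "Re (hpm s) = exp (- pi * Im s) * cos (pi * Re s - pi / 2)"
  by (simp add: hpm_def Re_exp algebra_simps)

lemma Re_hpm_nonneg: "s \<in> strip \<Longrightarrow> Re (hpm s) \<ge> 0"
  unfolding Re_hpm strip_def
  by (intro mult_nonneg_nonneg cos_ge_zero) (auto intro: mult_left_le simp: mult_left_le)

lemma Re_hpm_boundary: "Re s = 0 \<or> Re s = 1 \<Longrightarrow> Re (hpm s) = 0"
  unfolding Re_hpm by auto

lemma hpm_plus_1: "s \<in> strip \<Longrightarrow> hpm s + 1 \<noteq> 0"
  using Re_hpm_nonneg[of s] by (metis add_0 add.commute add_eq_0_iff complex.sel(1) minus_complex.sel(1) one_complex.sel(1) uminus_complex.sel(1) neg_0_le_iff_le not_one_le_zero)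

lemma cmod_Cayley: "(cmod (h + 1))\<^sup>2 - (cmod (h - 1))\<^sup>2 = 4 * Re h"
  unfolding cmod_power2 by (simp add: power2_eq_square algebra_simps)

lemma norm_disc_map_le: "s \<in> strip \<Longrightarrow> cmod (disc_map s) \<le> 1"
proof -
  assume s: "s \<in> strip"
  have "(cmod (hpm s - 1))\<^sup>2 \<le> (cmod (hpm s + 1))\<^sup>2" using cmod_Cayley[of "hpm s"] Re_hpm_nonneg[OF s] by linarith
  then have "cmod (hpm s - 1) \<le> cmod (hpm s + 1)" by (rule power2_le_imp_le) simp
  then show ?thesis by (simp add: disc_map_def norm_divide divide_le_eq_1)
qed

lemma norm_disc_map_boundary: "Re s = 0 \<or> Re s = 1 \<Longrightarrow> cmod (disc_map s) = 1"
proof -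
  assume s: "Re s = 0 \<or> Re s = 1"
  then have "s \<in> strip" by (auto simp: strip_def)
  have "(cmod (hpm s - 1))\<^sup>2 = (cmod (hpm s + 1))\<^sup>2" using cmod_Cayley[of "hpm s"] Re_hpm_boundary[OF s] by linarith
  then have "cmod (hpm s - 1) = cmod (hpm s + 1)" by (simp add: power2_eq_iff_nonneg)
  then show ?thesis using hpm_plus_1[OF \<open>s \<in> strip\<close>] by (simp add: disc_map_def norm_divide)
qed

lemma disc_map_half: "disc_map (1/2) = 0"
  by (simp add: disc_map_def hpm_def)

lemma disc_map_deriv: "(disc_map has_field_derivative dm_deriv) (at (1/2))"
proof -
  have "(hpm has_field_derivative \<i> * of_real pi) (at (1/2))"
    unfolding hpm_def by (auto intro!: derivative_eq_intros)
  moreover have "hpm (1/2) = 1" by (simp add: hpm_def)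
  ultimately show ?thesis unfolding disc_map_def[abs_def] dm_deriv_def
    by (auto intro!: derivative_eq_intros)
qed

lemma strip_fun_disc_map: "strip_fun disc_map"
proof -
  have "continuous_on strip hpm" "hpm holomorphic_on ostrip"
    unfolding hpm_def[abs_def] by (auto intro!: continuous_intros holomorphic_intros)
  then show ?thesis
    unfolding strip_fun_def using norm_disc_map_le ostrip_subset_strip hpm_plus_1 unfolding disc_map_def[abs_def]
    by (intro conjI exI[of _ 1] ballI) (auto intro!: continuous_intros holomorphic_intros)
qed

lemma disc_map_eq_0:
  assumes "s \<in> strip" shows "disc_map s = 0 \<longleftrightarrow> s = 1/2"
proof
  assume "disc_map s = 0"
  then have "hpm s = 1" using hpm_plus_1[OF assms] by (simp add: disc_map_def)
  then have "Re (\<i> * of_real pi * (s - 1/2)) = 0 \<and> (\<exists>k::int. Im (\<i> * of_real pi * (s - 1/2)) = of_int (2 * k) * pi)"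
    unfolding hpm_def exp_eq_1 .
  then obtain k :: int where k: "Im s = 0" "pi * (Re s - 1/2) = of_int (2 * k) * pi" by auto
  then have "Re s = 1/2 + 2 * real_of_int k" by simp
  moreover have "0 \<le> Re s" "Re s \<le> 1" using assms by (auto simp: strip_def)
  ultimately have "k = 0" by linarith
  then show "s = 1/2" using \<open>Re s = _\<close> k(1) by (simp add: complex_eq_iff)
qed (simp only: disc_map_half)

text \<open>The modulus t of \<open>hpm s\<close> is \<open>exp (- pi * Im s)\<close>. As exp pi >
  3, it is at least 3 or at most 1/3 here, and then |t - 1| is at least half of t + 1. This keeps
  quotients by \<open>disc_map\<close> bounded far from the midpoint.\<close>

lemma norm_disc_map_ge: 
  assumes "s \<in> strip" "\<bar>Im s\<bar> \<ge> 1" shows "cmod (disc_map s) \<ge> 1/2"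
proof -
  define t where "t = cmod (hpm s)"
  have t: "t = exp (- pi * Im s)" by (simp add: t_def hpm_def)
  have e3: "exp x \<ge> 3" if "x \<ge> pi" for x :: real
    using exp_ge_add_one_self[of x] that pi_gt3 by linarith
  have "t \<ge> 3 \<or> t \<le> 1/3"
  proof (cases "Im s \<ge> 1")
    case True
    then have "exp (pi * Im s) \<ge> 3" by (intro e3) simp
    then show ?thesis unfolding t by (simp add: exp_minus field_simps)
  next
    case False
    then have "pi * (- Im s) \<ge> pi * 1" using assms(2) by (intro mult_left_mono) auto
    then show ?thesis unfolding t using e3[of "- pi * Im s"] by simp
  qed
  then have le: "t + 1 \<le> 2 * \<bar>t - 1\<bar>" by auto
  have "cmod (hpm s + 1) \<le> cmod (hpm s) + cmod 1" by (rule norm_triangle_ineq)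
  also have "\<dots> = t + 1" by (simp add: t_def)
  also note le
  also have "2 * \<bar>t - 1\<bar> = 2 * \<bar>cmod (hpm s) - cmod 1\<bar>" by (simp add: t_def)
  also have "\<dots> \<le> 2 * cmod (hpm s - 1)" by (intro mult_left_mono norm_triangle_ineq3) simp
  finally have "cmod (hpm s + 1) \<le> 2 * cmod (hpm s - 1)" .
  then show ?thesis using hpm_plus_1[OF assms(1)] by (simp add: disc_map_def norm_divide field_simps)
qed

lemma strip_fun_field_derivative:
  assumes "strip_fun f" shows "(f has_field_derivative deriv f (1/2)) (at (1/2))"
  using assms half_in_ostrip open_ostrip unfolding strip_fun_def by (intro holomorphic_derivI[of f ostrip]) auto

text \<open>For f vanishing at 1/2 the value there fills the removable singularity of the
  quotient.\<close>

definition divide_disc_map :: "(complex \<Rightarrow> complex) \<Rightarrow> complex \<Rightarrow> complex" where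
  "divide_disc_map f s = (if s = 1/2 then deriv f (1/2) / dm_deriv else f s / disc_map s)"

text \<open>Inside the strip the function is a quotient of two difference quotients, the lower one
  without zeros, hence holomorphic. Away from 1/2 it is a quotient of functions continuous up to the
  boundary. It is bounded on a compact rectangle by continuity and elsewhere because
  \<open>disc_map\<close> has modulus at least 1/2.\<close>

lemma strip_fun_divide_disc_map:
  assumes f: "strip_fun f" and f0: "f (1/2) = 0"
  shows "strip_fun (divide_disc_map f)"
proof -
  let ?q = "\<lambda>f z. if z = 1/2 then deriv f (1/2) else (f z - f (1/2)) / (z - 1/2)"
  have "?q g holomorphic_on ostrip" if "strip_fun g" for g
    using that unfolding strip_fun_def by (intro pole_lemma_open open_ostrip) auto
  from this[OF f] this[OF strip_fun_disc_map]
  have hol: "?q f holomorphic_on ostrip" "?q disc_map holomorphic_on ostrip" .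
  have dm: "deriv disc_map (1/2) = dm_deriv" by (rule DERIV_imp_deriv[OF disc_map_deriv])
  have "(\<lambda>s. ?q f s / ?q disc_map s) holomorphic_on ostrip"
    using ostrip_subset_strip by (intro holomorphic_on_divide hol) (auto simp: dm disc_map_eq_0 disc_map_half)
  then have h: "divide_disc_map f holomorphic_on ostrip"
    by (rule holomorphic_transform) (auto simp: divide_disc_map_def f0 disc_map_half dm)
  have c2: "continuous_on (strip - {1/2}) (divide_disc_map f)"
  proof -
    have "continuous_on (strip - {1/2}) (\<lambda>s. f s / disc_map s)"
      using f strip_fun_disc_map unfolding strip_fun_def
      by (intro continuous_on_divide) (auto simp: disc_map_eq_0 intro: continuous_on_subset)
    then show ?thesis by (rule continuous_on_eq) (auto simp: divide_disc_map_def)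
  qed
  have "ostrip \<union> (strip - {1/2}) = strip" using ostrip_subset_strip half_in_ostrip by auto
  moreover have "continuous_on (ostrip \<union> (strip - {1/2})) (divide_disc_map f)"
  proof (rule continuous_on_Un_local_open)
    show "openin (top_of_set (ostrip \<union> (strip - {1/2}))) ostrip"
      by (rule open_subset[OF _ open_ostrip]) simp
    show "openin (top_of_set (ostrip \<union> (strip - {1/2}))) (strip - {1/2})"
      using \<open>ostrip \<union> _ = strip\<close> by (simp add: openin_delete)
    show "continuous_on ostrip (divide_disc_map f)" by (rule holomorphic_on_imp_continuous_on[OF h])
  qed (rule c2)
  ultimately have c: "continuous_on strip (divide_disc_map f)" by simp
  obtain B where B: "\<And>s. s \<in> strip \<Longrightarrow> cmod (f s) \<le> B" using f unfolding strip_fun_def by blast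
  let ?C = "cbox (Complex 0 (-1)) (Complex 1 1)"
  have "compact (divide_disc_map f ` ?C)"
    by (intro compact_continuous_image continuous_on_subset[OF c])
       (auto simp: strip_def in_cbox_complex_iff)
  then obtain B' where B': "\<And>s. s \<in> ?C \<Longrightarrow> cmod (divide_disc_map f s) \<le> B'"
    by (meson bounded_iff compact_imp_bounded image_eqI)
  have "cmod (divide_disc_map f s) \<le> max B' (2 * B)" if s: "s \<in> strip" for s
  proof (cases "s \<in> ?C")
    case True
    then show ?thesis using B' by (simp add: max.coboundedI1)
  next
    case False
    then have im: "\<bar>Im s\<bar> \<ge> 1" using s by (auto simp: strip_def in_cbox_complex_iff)
    then have "Im s \<noteq> Im (1/2)" by auto
    then have "s \<noteq> 1/2" by blast
    then have "cmod (divide_disc_map f s) = cmod (f s) / cmod (disc_map s)" by (simp add: divide_disc_map_def norm_divide)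
    also have "\<dots> \<le> B / (1/2)"
      using norm_disc_map_ge[OF s im] B[OF s] order_trans[OF norm_ge_zero B[OF s]] by (intro frac_le) auto
    finally show ?thesis by simp
  qed
  then show ?thesis using c h unfolding strip_fun_def by blast
qed

text \<open>\<open>disc_map\<close> has modulus 1 on both boundary lines, where alone norms are
  measured, so division leaves the constant unchanged. This is why the kernel of evaluation carries
  exactly the norm of \<open>OH\<close>.\<close>

lemma adm_divide_disc_map:
  assumes f: "adm n f c" and f0: "\<And>k i j. i < n \<Longrightarrow> j < n \<Longrightarrow> f k i j (1/2) = 0"
  shows "adm n (\<lambda>k i j. divide_disc_map (f k i j)) c"
proof -
  have eq: "divide_disc_map g s = inverse (disc_map s) * g s" "cmod (inverse (disc_map s)) = 1"
    if "Re s = 0 \<or> Re s = 1" for g s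
  proof -
    have "Re s \<noteq> Re (1/2)" using that by auto
    then have "s \<noteq> 1/2" by blast
    then show "divide_disc_map g s = inverse (disc_map s) * g s" by (simp add: divide_disc_map_def field_simps)
    show "cmod (inverse (disc_map s)) = 1" using norm_disc_map_boundary[OF that] by (simp add: norm_inverse)
  qed
  show ?thesis unfolding adm_def
  proof (intro conjI allI impI)
    show "c \<ge> 0" using f by (simp add: adm_def)
    show "strip_fun (divide_disc_map (f k i j))" if "i < n" "j < n" for k i j
      using f f0 that by (auto simp: adm_def intro!: strip_fun_divide_disc_map)
    fix s :: complex
    show "row_bound n (\<lambda>k i j. divide_disc_map (f k i j) s) c" if "Re s = 0"
      using row_bound_scale[of n "\<lambda>k i j. f k i j s" c "inverse (disc_map s)"] f that by (simp add: adm_def eq)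
    show "col_bound n (\<lambda>k i j. divide_disc_map (f k i j) s) c" if "Re s = 1"
      using col_bound_scale[of n "\<lambda>k i j. f k i j s" c "inverse (disc_map s)"] f that by (simp add: adm_def eq)
  qed
qed

lemma adm_mult_disc_map:
  assumes f: "adm n f c"
  shows "adm n (\<lambda>k i j s. disc_map s * f k i j s) c"
  unfolding adm_def
proof (intro conjI allI impI)
  show "c \<ge> 0" using f by (simp add: adm_def)
  show "strip_fun (\<lambda>s. disc_map s * f k i j s)" if "i < n" "j < n" for k i j
    using f that by (auto simp: adm_def intro!: strip_fun_mult strip_fun_disc_map)
  fix s :: complex
  show "row_bound n (\<lambda>k i j. disc_map s * f k i j s) c" if "Re s = 0"
    using row_bound_scale[of n "\<lambda>k i j. f k i j s" c "disc_map s"] f that by (simp add: adm_def norm_disc_map_boundary)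
  show "col_bound n (\<lambda>k i j. disc_map s * f k i j s) c" if "Re s = 1"
    using col_bound_scale[of n "\<lambda>k i j. f k i j s" c "disc_map s"] f that by (simp add: adm_def norm_disc_map_boundary)
qed

section \<open>The norm of OH by interpolation\<close>

lemma l2_vec_norm_vec: "l2_vec_norm (Matrix.vec m v) = sqrt (sqn m v)"
  by (simp add: l2_vec_norm_def sqn_def)

lemma l2_vec_norm_mult_vec:
  "l2_vec_norm (A *\<^sub>v Matrix.vec (dim_col A) v) = sqrt (sqn (dim_row A) (\<lambda>i. \<Sum>j<dim_col A. A $$ (i, j) * v j))"
  by (simp add: l2_vec_norm_def sqn_def scalar_prod_def atLeast0LessThan)

lemma mat_op_norm_eq:
  "mat_op_norm A = Sup {sqrt (sqn (dim_row A) (\<lambda>i. \<Sum>j<dim_col A. A $$ (i, j) * v j)) | v. sqn (dim_col A) v \<le> 1}"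
proof -
  have "{l2_vec_norm (A *\<^sub>v v) | v. v \<in> carrier_vec (dim_col A) \<and> l2_vec_norm v \<le> 1}
      = {sqrt (sqn (dim_row A) (\<lambda>i. \<Sum>j<dim_col A. A $$ (i, j) * v j)) | v. sqn (dim_col A) v \<le> 1}" (is "?L = ?R")
  proof (intro equalityI subsetI)
    fix t assume "t \<in> ?L"
    then obtain v where v: "v \<in> carrier_vec (dim_col A)" "l2_vec_norm v \<le> 1" "t = l2_vec_norm (A *\<^sub>v v)" by blast
    have "v = Matrix.vec (dim_col A) (\<lambda>j. vec_index v j)" using v(1) by auto
    then show "t \<in> ?R" using v(2,3) l2_vec_norm_vec[of "dim_col A" "\<lambda>j. vec_index v j"]
        l2_vec_norm_mult_vec[of A "\<lambda>j. vec_index v j"] by auto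
  next
    fix t assume "t \<in> ?R"
    then obtain v where "sqn (dim_col A) v \<le> 1" "t = sqrt (sqn (dim_row A) (\<lambda>i. \<Sum>j<dim_col A. A $$ (i, j) * v j))" by blast
    then show "t \<in> ?L" using l2_vec_norm_vec[of "dim_col A" v] l2_vec_norm_mult_vec[of A v]
      by (intro CollectI exI[of _ "Matrix.vec (dim_col A) v"]) auto
  qed
  then show ?thesis by (simp add: mat_op_norm_def)
qed

lemma opb_Frobenius: "opb n m a (sqrt (\<Sum>i<n. sqn m (a i)))"
  unfolding opb_def
proof (intro conjI allI)
  show "0 \<le> sqrt (\<Sum>i<n. sqn m (a i))" by (simp add: sum_nonneg)
  fix v
  have "sqn n (\<lambda>i. \<Sum>j<m. a i j * v j) \<le> (\<Sum>i<n. sqn m (a i) * sqn m v)"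
    by (subst sqn_def) (intro sum_mono Cauchy_Schwarz_square)
  then show "sqn n (\<lambda>i. \<Sum>j<m. a i j * v j) \<le> (sqrt (\<Sum>i<n. sqn m (a i)))\<^sup>2 * sqn m v"
    by (simp add: sum_nonneg sum_distrib_right)
qed

lemma mat_op_norm_bdd:
  "bdd_above {sqrt (sqn (dim_row A) (\<lambda>i. \<Sum>j<dim_col A. A $$ (i, j) * v j)) | v. sqn (dim_col A) v \<le> 1}"
proof -
  obtain C where C: "opb (dim_row A) (dim_col A) (\<lambda>i j. A $$ (i, j)) C" using opb_Frobenius by blast
  have "sqrt (sqn (dim_row A) (\<lambda>i. \<Sum>j<dim_col A. A $$ (i, j) * v j)) \<le> C" if "sqn (dim_col A) v \<le> 1" for v
  proof (rule real_le_lsqrt)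
    have "C\<^sup>2 * sqn (dim_col A) v \<le> C\<^sup>2 * 1" using that by (intro mult_left_mono) auto
    then show "sqn (dim_row A) (\<lambda>i. \<Sum>j<dim_col A. A $$ (i, j) * v j) \<le> C\<^sup>2" using opbD[OF C, of v] by simp
  qed (use C in \<open>auto simp: opb_def\<close>)
  then show ?thesis by (intro bdd_aboveI[of _ C]) auto
qed

lemma mat_op_norm_le:
  assumes C: "opb (dim_row A) (dim_col A) (\<lambda>i j. A $$ (i, j)) C"
  shows "mat_op_norm A \<le> C"
  unfolding mat_op_norm_eq
proof (rule cSup_least)
  have "sqn (dim_col A) (\<lambda>_. 0) \<le> 1" by (simp add: sqn_def)
  then show "{sqrt (sqn (dim_row A) (\<lambda>i. \<Sum>j<dim_col A. A $$ (i, j) * v j)) | v. sqn (dim_col A) v \<le> 1} \<noteq> {}" by blast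
  fix t assume "t \<in> {sqrt (sqn (dim_row A) (\<lambda>i. \<Sum>j<dim_col A. A $$ (i, j) * v j)) | v. sqn (dim_col A) v \<le> 1}"
  then obtain v where v: "sqn (dim_col A) v \<le> 1" "t = sqrt (sqn (dim_row A) (\<lambda>i. \<Sum>j<dim_col A. A $$ (i, j) * v j))" by blast
  have "C\<^sup>2 * sqn (dim_col A) v \<le> C\<^sup>2 * 1" using v by (intro mult_left_mono) auto
  then have "sqn (dim_row A) (\<lambda>i. \<Sum>j<dim_col A. A $$ (i, j) * v j) \<le> C\<^sup>2" using opbD[OF C, of v] by simp
  then show "t \<le> C" using C unfolding v(2) by (intro real_le_lsqrt) (auto simp: opb_def)
qed

lemma mat_op_norm_upper:
  "sqn (dim_col A) v \<le> 1 \<Longrightarrow> sqrt (sqn (dim_row A) (\<lambda>i. \<Sum>j<dim_col A. A $$ (i, j) * v j)) \<le> mat_op_norm A"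
  unfolding mat_op_norm_eq by (intro cSup_upper mat_op_norm_bdd) auto

lemma mat_op_norm_nonneg [simp]: "mat_op_norm A \<ge> 0"
  using mat_op_norm_upper[of A "\<lambda>_. 0"] by (simp add: sqn_def)

lemma opb_mat_op_norm: "opb (dim_row A) (dim_col A) (\<lambda>i j. A $$ (i, j)) (mat_op_norm A)"
  unfolding opb_def
proof (intro conjI allI)
  fix v
  let ?n = "dim_row A" and ?m = "dim_col A"
  show "sqn ?n (\<lambda>i. \<Sum>j<?m. A $$ (i, j) * v j) \<le> (mat_op_norm A)\<^sup>2 * sqn ?m v"
  proof (cases "sqn ?m v = 0")
    case True
    then have "v j = 0" if "j < ?m" for j using that by (simp add: sqn_eq_0_iff)
    then have "(\<lambda>i. \<Sum>j<?m. A $$ (i, j) * v j) = (\<lambda>i. 0)" by simp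
    then show ?thesis by (simp add: sqn_def sum_nonneg)
  next
    case False
    define t where "t = sqrt (sqn ?m v)"
    have t: "t > 0" "t\<^sup>2 = sqn ?m v" using False sqn_nonneg[of ?m v] by (auto simp: t_def less_le)
    let ?w = "\<lambda>j. of_real (1 / t) * v j"
    have "sqn ?m ?w = 1" unfolding sqn_scale using t False by (simp add: norm_divide power_divide)
    then have "sqrt (sqn ?n (\<lambda>i. \<Sum>j<?m. A $$ (i, j) * ?w j)) \<le> mat_op_norm A" by (intro mat_op_norm_upper) simp
    moreover have "(\<lambda>i. \<Sum>j<?m. A $$ (i, j) * ?w j) = (\<lambda>i. of_real (1 / t) * (\<Sum>j<?m. A $$ (i, j) * v j))"
      by (simp add: sum_distrib_left mult_ac)
    ultimately have "sqrt ((cmod (of_real (1 / t)))\<^sup>2 * sqn ?n (\<lambda>i. \<Sum>j<?m. A $$ (i, j) * v j)) \<le> mat_op_norm A"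
      by (simp only: sqn_scale)
    then have "(cmod (of_real (1 / t)))\<^sup>2 * sqn ?n (\<lambda>i. \<Sum>j<?m. A $$ (i, j) * v j) \<le> (mat_op_norm A)\<^sup>2"
      by (rule sqrt_le_D)
    moreover have "sqn ?m v > 0" using False sqn_nonneg[of ?m v] by (simp add: less_le)
    ultimately show ?thesis using t by (simp add: norm_divide power_divide field_simps)
  qed
qed simp

section \<open>The Kronecker sum as an operator on Hilbert-Schmidt matrices\<close>

lemma sum_lessThan_square:
  "(\<Sum>r<n * n. f (r div n) (r mod n)) = (\<Sum>i<n. \<Sum>b<n. f i b)" for f :: "nat \<Rightarrow> nat \<Rightarrow> 'a::comm_monoid_add"
proof -
  have "(\<Sum>r<n * n. f (r div n) (r mod n)) = (\<Sum>i<n. sum (\<lambda>r. f (r div n) (r mod n)) {i * n..<i * n + n})"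
    by (rule sum.nat_group[symmetric])
  also have "\<dots> = (\<Sum>i<n. \<Sum>b<n. f i b)"
  proof (rule sum.cong[OF refl])
    fix i assume "i \<in> {..<n}"
    have "sum (\<lambda>r. f (r div n) (r mod n)) {i * n..<i * n + n} = (\<Sum>b\<in>{0..<n}. f ((b + i * n) div n) ((b + i * n) mod n))"
      using sum.shift_bounds_nat_ivl[of "\<lambda>r. f (r div n) (r mod n)" 0 "i * n" n] by (simp add: add.commute)
    also have "\<dots> = (\<Sum>b<n. f i b)" by (simp add: atLeast0LessThan)
    finally show "sum (\<lambda>r. f (r div n) (r mod n)) {i * n..<i * n + n} = (\<Sum>b<n. f i b)" .
  qed
  finally show ?thesis .
qed

definition OH_mat :: "(nat \<Rightarrow> complex) mat \<Rightarrow> complex mat" where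
  "OH_mat x = Matrix.mat (dim_row x * dim_row x) (dim_col x * dim_col x)
        (\<lambda>rs. \<Sum>k. kronecker_mat (coord_mat x k) (map_mat cnj (coord_mat x k)) $$ rs)"

lemma OH_mnorm_eq: "OH_mnorm x = sqrt (mat_op_norm (OH_mat x))"
  by (simp add: OH_mnorm_def OH_mat_def)

lemma OH_mnorm_nonneg [simp]: "OH_mnorm x \<ge> 0"
  by (simp add: OH_mnorm_eq)

abbreviation coords :: "(nat \<Rightarrow> complex) mat \<Rightarrow> nat \<Rightarrow> nat \<Rightarrow> nat \<Rightarrow> complex" where
  "coords x \<equiv> \<lambda>k i j. (x $$ (i, j)) k"

text \<open>A vector of length \<open>n * n\<close> is read as an n by n matrix through
  \<open>r div n\<close> and \<open>r mod n\<close>, the indexing of the Kronecker product. In this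
  reading Euclidean norms are Hilbert-Schmidt norms, so \<open>mat_op_norm (OH_mat x)\<close>
  becomes the norm of \<open>cpmap\<close>.\<close>

lemma OH_mat_apply:
  assumes x: "x \<in> carrier_mat n n" and r: "r < n * n"
  shows "(\<Sum>s<n * n. OH_mat x $$ (r, s) * X (s div n) (s mod n)) = cpmap n (coords x) X (r div n) (r mod n)"
proof -
  have n: "r div n < n" "r mod n < n" using r by (auto simp: less_mult_imp_div_less intro!: mod_less_divisor) (cases n, auto)
  have e: "OH_mat x $$ (r, s) = (\<Sum>k. coords x k (r div n) (s div n) * cnj (coords x k (r mod n) (s mod n)))" if "s < n * n" for s
  proof -
    have "s div n < n" "s mod n < n" using that by (auto simp: less_mult_imp_div_less intro!: mod_less_divisor) (cases n, auto)
    then show ?thesis using x r that n unfolding OH_mat_def by (simp add: kronecker_mat_def coord_mat_def)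
  qed
  have "(\<Sum>s<n * n. OH_mat x $$ (r, s) * X (s div n) (s mod n))
    = (\<Sum>s<n * n. (\<Sum>k. coords x k (r div n) (s div n) * cnj (coords x k (r mod n) (s mod n))) * X (s div n) (s mod n))"
    by (intro sum.cong refl) (simp add: e)
  also have "\<dots> = cpmap n (coords x) X (r div n) (r mod n)"
    unfolding cpmap_def by (rule sum_lessThan_square)
  finally show ?thesis .
qed

lemma OH_mat_sqn:
  assumes x: "x \<in> carrier_mat n n"
  shows "sqn (n * n) (\<lambda>r. \<Sum>s<n * n. OH_mat x $$ (r, s) * X (s div n) (s mod n)) = hsn n (cpmap n (coords x) X)"
proof -
  have "sqn (n * n) (\<lambda>r. \<Sum>s<n * n. OH_mat x $$ (r, s) * X (s div n) (s mod n))
    = (\<Sum>r<n * n. (cmod (cpmap n (coords x) X (r div n) (r mod n)))\<^sup>2)"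
    unfolding sqn_def by (intro sum.cong refl) (simp add: OH_mat_apply[OF x])
  also have "\<dots> = hsn n (cpmap n (coords x) X)"
    unfolding hsn_def by (rule sum_lessThan_square)
  finally show ?thesis .
qed

lemma sqn_square: "sqn (n * n) (\<lambda>s. X (s div n) (s mod n)) = hsn n X"
  unfolding sqn_def hsn_def by (rule sum_lessThan_square)

lemma OH_mnorm_cpmap:
  assumes x: "x \<in> carrier_mat n n"
  shows "sqrt (hsn n (cpmap n (coords x) X)) \<le> (OH_mnorm x)\<^sup>2 * sqrt (hsn n X)"
proof -
  have "opb (n * n) (n * n) (\<lambda>r s. OH_mat x $$ (r, s)) (mat_op_norm (OH_mat x))"
    using opb_mat_op_norm[of "OH_mat x"] x by (simp add: OH_mat_def)
  from opbD[OF this, of "\<lambda>s. X (s div n) (s mod n)"]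
  have "hsn n (cpmap n (coords x) X) \<le> (mat_op_norm (OH_mat x))\<^sup>2 * hsn n X"
    unfolding OH_mat_sqn[OF x] sqn_square .
  then have "sqrt (hsn n (cpmap n (coords x) X)) \<le> sqrt ((mat_op_norm (OH_mat x))\<^sup>2 * hsn n X)" by simp
  then show ?thesis by (simp add: OH_mnorm_eq real_sqrt_mult)
qed

lemma OH_mnorm_le:
  assumes x: "x \<in> carrier_mat n n" and c: "c \<ge> 0"
    and le: "\<And>X. sqrt (hsn n (cpmap n (coords x) X)) \<le> c\<^sup>2 * sqrt (hsn n X)"
  shows "OH_mnorm x \<le> c"
proof -
  have "opb (n * n) (n * n) (\<lambda>r s. OH_mat x $$ (r, s)) (c\<^sup>2)"
    unfolding opb_def
  proof (intro conjI allI)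
    fix v :: "nat \<Rightarrow> complex"
    let ?X = "\<lambda>i j. v (i * n + j)"
    have v: "v = (\<lambda>s. ?X (s div n) (s mod n))" by simp
    have "(sqrt (hsn n (cpmap n (coords x) ?X)))\<^sup>2 \<le> (c\<^sup>2 * sqrt (hsn n ?X))\<^sup>2" by (intro power_mono le) simp
    then have "hsn n (cpmap n (coords x) ?X) \<le> (c\<^sup>2)\<^sup>2 * hsn n ?X" by (simp add: power_mult_distrib)
    then have "sqn (n * n) (\<lambda>r. \<Sum>s<n * n. OH_mat x $$ (r, s) * ?X (s div n) (s mod n)) \<le> (c\<^sup>2)\<^sup>2 * sqn (n * n) (\<lambda>s. ?X (s div n) (s mod n))"
      unfolding OH_mat_sqn[OF x, of ?X] sqn_square[of n ?X] .
    then show "sqn (n * n) (\<lambda>r. \<Sum>s<n * n. OH_mat x $$ (r, s) * v s) \<le> (c\<^sup>2)\<^sup>2 * sqn (n * n) v"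
      by simp
  qed simp
  then have "mat_op_norm (OH_mat x) \<le> c\<^sup>2" using x by (intro mat_op_norm_le) (simp add: OH_mat_def)
  then show ?thesis unfolding OH_mnorm_eq using c by (simp add: real_le_lsqrt)
qed

lemma kform_sums:
  assumes z: "sq_summable n z"
  shows "(\<lambda>k. kform n (z k) X Y) sums hsprod n (cpmap n z X) Y"
proof -
  have "(\<lambda>k. \<Sum>i<n. \<Sum>b<n. (\<Sum>j<n. \<Sum>a<n. (z k i j * cnj (z k b a)) * X j a) * cnj (Y i b)) sums hsprod n (cpmap n z X) Y"
    unfolding hsprod_def cpmap_def
    by (intro sums_sum sums_mult2 summable_sums summable_mult_cnj)
      (use z in \<open>auto simp: sq_summable_def\<close>)
  then show ?thesis by (simp add: kform_def sum_distrib_right)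
qed

text \<open>The two halves of Pisier's theorem \<open>OH = (R, C)\<^bsub>1/2\<^esub>\<close>.\<close>

theorem OH_mnorm_le_adm:
  assumes x: "x \<in> carrier_mat n n" and s: "sq_summable n (coords x)" and f: "adm n f c"
    and eq: "\<And>k i j. i < n \<Longrightarrow> j < n \<Longrightarrow> f k i j (1/2) = coords x k i j"
  shows "OH_mnorm x \<le> c"
proof (rule OH_mnorm_le[OF x])
  show "c \<ge> 0" using f by (simp add: adm_def)
  fix X
  \<comment> \<open>Testing with \<open>Y\<close>, the image of \<open>X\<close> itself, bounds
    \<open>hsn n Y\<close> by \<open>c\<^sup>2\<close> times the product of the two norms; one
    factor of \<open>Y\<close> cancels.\<close>
  define Y where "Y = cpmap n (coords x) X"
  have "kform n (\<lambda>i j. f k i j (1/2)) X Y = kform n (coords x k) X Y" for k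
    unfolding kform_def using eq by (intro sum.cong refl) simp
  then have "cmod (\<Sum>k<K. kform n (coords x k) X Y) \<le> c\<^sup>2 * (sqrt (hsn n X) * sqrt (hsn n Y))" for K
    using adm_kform[OF f, where X = X and Y = Y and K = K] by simp
  moreover have "(\<lambda>K. cmod (\<Sum>k<K. kform n (coords x k) X Y)) \<longlonglongrightarrow> cmod (hsprod n Y Y)"
    using kform_sums[OF s, of X Y] unfolding sums_def Y_def[symmetric] by (rule tendsto_norm)
  ultimately have "cmod (hsprod n Y Y) \<le> c\<^sup>2 * (sqrt (hsn n X) * sqrt (hsn n Y))"
    by (intro LIMSEQ_le_const2[where X = "\<lambda>K. cmod (\<Sum>k<K. kform n (coords x k) X Y)"]) auto
  then have "sqrt (hsn n Y) * sqrt (hsn n Y) \<le> (c\<^sup>2 * sqrt (hsn n X)) * sqrt (hsn n Y)"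
    by (simp add: hsprod_self mult_ac)
  then show "sqrt (hsn n (cpmap n (coords x) X)) \<le> c\<^sup>2 * sqrt (hsn n X)"
    unfolding Y_def[symmetric]
  proof (cases "hsn n Y = 0")
    case False
    then have "sqrt (hsn n Y) > 0" using hsn_nonneg[of n Y] by (simp add: less_le)
    then show "sqrt (hsn n Y) \<le> c\<^sup>2 * sqrt (hsn n X)"
      using \<open>_ \<le> (c\<^sup>2 * sqrt (hsn n X)) * sqrt (hsn n Y)\<close> by (rule mult_right_le_imp_le[rotated])
  qed simp
qed

text \<open>The strict inequality makes the completely positive map strictly contractive relative to
  \<open>c\<^sup>2\<close>, as the Neumann series demands. The scalar functions \<open>H\<close> are
  exported, not just the family, to give access to its derivative.\<close>

theorem OH_mnorm_adm:
  assumes x: "x \<in> carrier_mat n n" and s: "sq_summable n (coords x)" and c: "OH_mnorm x < c"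
  obtains H where "\<And>i j p q. strip_fun (H i j p q)"
    "\<And>i j p q. i < n \<Longrightarrow> j < n \<Longrightarrow> p < n \<Longrightarrow> q < n \<Longrightarrow> H i j p q (1/2) = (if i = p \<and> j = q then 1 else 0)"
    "adm n (\<lambda>k i j s. \<Sum>p<n. \<Sum>q<n. H i j p q s * coords x k p q) c"
proof (rule interpolating_family[OF s _ _ _ OH_mnorm_cpmap[OF x]])
  show "0 \<le> (OH_mnorm x)\<^sup>2" by simp
  show "(OH_mnorm x)\<^sup>2 < c\<^sup>2" using c by (intro power_strict_mono) auto
  show "c > 0" using c OH_mnorm_nonneg[of x] by linarith
qed (rule that)

section \<open>The derived space\<close>

lemma in_ell2_iff: "x \<in> carrier ell2 \<longleftrightarrow> summable (\<lambda>k. (cmod (x k))\<^sup>2)"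
  by (simp add: ell2_def)

lemma ell2_add:
  assumes "u \<in> carrier ell2" "v \<in> carrier ell2" shows "(\<lambda>k. u k + v k) \<in> carrier ell2"
  unfolding in_ell2_iff
proof (rule summable_comparison_test)
  show "summable (\<lambda>k. 2 * (cmod (u k))\<^sup>2 + 2 * (cmod (v k))\<^sup>2)"
    using assms unfolding in_ell2_iff by (intro summable_add summable_mult)
  have "(cmod (u k + v k))\<^sup>2 \<le> 2 * (cmod (u k))\<^sup>2 + 2 * (cmod (v k))\<^sup>2" for k
  proof -
    have "(cmod (u k + v k))\<^sup>2 \<le> (cmod (u k) + cmod (v k))\<^sup>2" by (intro power_mono norm_triangle_ineq) auto
    also have "\<dots> \<le> 2 * (cmod (u k))\<^sup>2 + 2 * (cmod (v k))\<^sup>2"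
      using sum_squares_bound[of "cmod (u k)" "cmod (v k)"] by (simp add: power2_sum)
    finally show ?thesis .
  qed
  then show "\<exists>N. \<forall>k\<ge>N. norm ((cmod (u k + v k))\<^sup>2) \<le> 2 * (cmod (u k))\<^sup>2 + 2 * (cmod (v k))\<^sup>2" by simp
qed

lemma ell2_scale: "u \<in> carrier ell2 \<Longrightarrow> (\<lambda>k. c * u k) \<in> carrier ell2"
  by (simp add: in_ell2_iff norm_mult power_mult_distrib summable_mult)

lemma ell2_zero: "(\<lambda>_. 0) \<in> carrier ell2"
  by (simp add: in_ell2_iff)

lemma ell2_sum: "(\<And>a. a \<in> A \<Longrightarrow> f a \<in> carrier ell2) \<Longrightarrow> (\<lambda>k. \<Sum>a\<in>A. f a k) \<in> carrier ell2"
  by (induction A rule: infinite_finite_induct) (auto simp: ell2_zero ell2_add)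

lemma ell2_uminus: "u \<in> carrier ell2 \<Longrightarrow> (\<lambda>k. - u k) \<in> carrier ell2"
  using ell2_scale[of u "-1"] by simp

text \<open>The operations are prescribed on the carrier only, since the addition of
  \<open>derived_space\<close> deviates from the pointwise one elsewhere.\<close>

lemma ell2_vectorspace:
  fixes V :: "(complex, nat \<Rightarrow> complex, 'm) module_scheme"
  assumes C: "carrier V = carrier ell2"
    and add: "\<And>u v. u \<in> carrier ell2 \<Longrightarrow> v \<in> carrier ell2 \<Longrightarrow> u \<oplus>\<^bsub>V\<^esub> v = (\<lambda>k. u k + v k)"
    and zero: "\<zero>\<^bsub>V\<^esub> = (\<lambda>_. 0)"
    and smult: "\<And>c u. u \<in> carrier ell2 \<Longrightarrow> c \<odot>\<^bsub>V\<^esub> u = (\<lambda>k. c * u k)"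
  shows "vectorspace (class_ring :: complex ring) V"
proof -
  have "abelian_group V"
  proof (rule abelian_groupI)
    fix x assume "x \<in> carrier V"
    then show "\<exists>y\<in>carrier V. y \<oplus>\<^bsub>V\<^esub> x = \<zero>\<^bsub>V\<^esub>"
      unfolding C zero by (intro bexI[of _ "\<lambda>k. - x k"]) (auto simp: add ell2_uminus)
  qed (auto simp: C add zero ell2_add ell2_zero add.assoc add.commute)
  then have "module (class_ring :: complex ring) V"
  proof (rule moduleI[OF class_cring.is_cring])
  qed (auto simp: C add smult ell2_add ell2_scale algebra_simps)
  then show ?thesis by (simp add: vectorspace_def class_field)
qed

lemma OH_simps [simp]: "carrier OH = carrier ell2" "u \<oplus>\<^bsub>OH\<^esub> v = (\<lambda>k. u k + v k)"
  "\<zero>\<^bsub>OH\<^esub> = (\<lambda>_. 0)" "c \<odot>\<^bsub>OH\<^esub> u = (\<lambda>k. c * u k)" "mnorm OH = OH_mnorm"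
  by (simp_all add: OH_def ell2_def module.defs opspace.defs)

lemma OH_vectorspace: "vectorspace (class_ring :: complex ring) OH"
  by (rule ell2_vectorspace) simp_all

section \<open>Splitting a sequence into its even and odd coordinates\<close>

definition evens :: "(nat \<Rightarrow> complex) \<Rightarrow> nat \<Rightarrow> complex" where "evens x k = x (2 * k)"

definition odds :: "(nat \<Rightarrow> complex) \<Rightarrow> nat \<Rightarrow> complex" where "odds x k = x (2 * k + 1)"

definition interleave :: "(nat \<Rightarrow> complex) \<Rightarrow> (nat \<Rightarrow> complex) \<Rightarrow> nat \<Rightarrow> complex" where
  "interleave y z m = (if even m then y (m div 2) else z ((m - 1) div 2))"

lemma evens_interleave [simp]: "evens (interleave y z) = y"
  by (auto simp: evens_def interleave_def)

lemma odds_interleave [simp]: "odds (interleave y z) = z"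
  by (auto simp: odds_def interleave_def)

lemma interleave_evens_odds [simp]: "interleave (evens x) (odds x) = x"
  by (auto simp: evens_def odds_def interleave_def)

lemma evens_odds_eqI: "evens x = evens y \<Longrightarrow> odds x = odds y \<Longrightarrow> x = y"
  by (metis interleave_evens_odds)

lemma evens_zero [simp]: "evens (\<lambda>_. 0) = (\<lambda>_. 0)" and odds_zero [simp]: "odds (\<lambda>_. 0) = (\<lambda>_. 0)"
  by (auto simp: evens_def odds_def)

lemma evens_in_ell2: "x \<in> carrier ell2 \<Longrightarrow> evens x \<in> carrier ell2"
  unfolding in_ell2_iff evens_def
  using summable_reindex[of "\<lambda>k. (cmod (x k))\<^sup>2" "\<lambda>k. 2 * k"] by (simp add: o_def inj_on_def)

lemma odds_in_ell2: "x \<in> carrier ell2 \<Longrightarrow> odds x \<in> carrier ell2"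
  unfolding in_ell2_iff odds_def
  using summable_reindex[of "\<lambda>k. (cmod (x k))\<^sup>2" "\<lambda>k. 2 * k + 1"] by (simp add: o_def inj_on_def)

lemma interleave_sums:
  assumes "y \<in> carrier ell2" "z \<in> carrier ell2"
  shows "(\<lambda>k. (cmod (interleave y z k))\<^sup>2) sums ((ell2_norm y)\<^sup>2 + (ell2_norm z)\<^sup>2)"
proof -
  have sq: "(ell2_norm u)\<^sup>2 = (\<Sum>k. (cmod (u k))\<^sup>2)" if "u \<in> carrier ell2" for u
    using that unfolding ell2_norm_def in_ell2_iff by (intro real_sqrt_pow2 suminf_nonneg) auto
  have "(\<lambda>k. if even k then (cmod (y (k div 2)))\<^sup>2 else (cmod (z ((k - 1) div 2)))\<^sup>2) sums ((ell2_norm z)\<^sup>2 + (ell2_norm y)\<^sup>2)"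
    unfolding sq[OF assms(1)] sq[OF assms(2)] using assms unfolding in_ell2_iff
    by (intro sums_if summable_sums)
  moreover have "(\<lambda>k. (cmod (interleave y z k))\<^sup>2) = (\<lambda>k. if even k then (cmod (y (k div 2)))\<^sup>2 else (cmod (z ((k - 1) div 2)))\<^sup>2)"
    by (auto simp: interleave_def)
  ultimately show ?thesis by (simp add: add.commute)
qed

lemma interleave_in_ell2: "y \<in> carrier ell2 \<Longrightarrow> z \<in> carrier ell2 \<Longrightarrow> interleave y z \<in> carrier ell2"
  unfolding in_ell2_iff[of "interleave y z"] using interleave_sums by (blast intro: sums_summable)

lemma ell2_norm_nonneg [simp]: "ell2_norm x \<ge> 0" if "x \<in> carrier ell2"
  using that unfolding ell2_norm_def in_ell2_iff by (simp add: suminf_nonneg)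

lemma ell2_norm_interleave:
  assumes "x \<in> carrier ell2"
  shows "(ell2_norm x)\<^sup>2 = (ell2_norm (evens x))\<^sup>2 + (ell2_norm (odds x))\<^sup>2"
proof -
  have "(ell2_norm x)\<^sup>2 = (\<Sum>k. (cmod (x k))\<^sup>2)"
    using assms unfolding ell2_norm_def in_ell2_iff by (intro real_sqrt_pow2 suminf_nonneg) auto
  then show ?thesis
    using interleave_sums[OF evens_in_ell2[OF assms] odds_in_ell2[OF assms]] by (simp add: sums_iff)
qed

text \<open>A sequence in \<open>\<ell>\<^sub>2\<close> encodes a pair of sequences: the odd coordinates hold the value of the analytic
  function at \<open>1/2\<close>, the even ones its derivative, in units of the derivative of the conformal map.\<close>

definition represents :: "nat \<Rightarrow> (nat \<Rightarrow> complex) mat \<Rightarrow> (nat \<Rightarrow> nat \<Rightarrow> nat \<Rightarrow> complex \<Rightarrow> complex) \<Rightarrow> real \<Rightarrow> bool" where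
  "represents n x f c \<longleftrightarrow> adm n f c \<and> (\<forall>k. \<forall>i<n. \<forall>j<n. f k i j (1/2) = odds (x $$ (i, j)) k \<and>
     (f k i j has_field_derivative dm_deriv * evens (x $$ (i, j)) k) (at (1/2)))"

definition derived_mnorm :: "(nat \<Rightarrow> complex) mat \<Rightarrow> real" where
  "derived_mnorm x = Inf {c. \<exists>f. represents (dim_row x) x f c}"

definition trunc :: "(nat \<Rightarrow> complex) \<Rightarrow> nat \<Rightarrow> complex" where
  "trunc x = (if x \<in> carrier ell2 then x else (\<lambda>_. 0))"

text \<open>Truncation only affects arguments outside of the carrier. It makes the distance function
  symmetric on the whole type, as the locale \<open>Metric_space\<close> demands.\<close>

definition derived_space :: "(nat \<Rightarrow> complex) opspace" where
  "derived_space = module.extend (ell2\<lparr>add := \<lambda>u v k. trunc u k + trunc v k\<rparr>) (opspace.fields derived_mnorm)"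

lemma trunc [simp]: "x \<in> carrier ell2 \<Longrightarrow> trunc x = x"
  by (simp add: trunc_def)

lemma trunc_in_ell2 [simp]: "trunc x \<in> carrier ell2"
  by (simp add: trunc_def ell2_zero)

lemma derived_space_simps [simp]: "carrier derived_space = carrier ell2"
  "u \<oplus>\<^bsub>derived_space\<^esub> v = (\<lambda>k. trunc u k + trunc v k)"
  "\<zero>\<^bsub>derived_space\<^esub> = (\<lambda>_. 0)" "c \<odot>\<^bsub>derived_space\<^esub> u = (\<lambda>k. c * u k)" "mnorm derived_space = derived_mnorm"
  by (simp_all add: derived_space_def ell2_def module.defs opspace.defs)

lemma derived_vectorspace: "vectorspace (class_ring :: complex ring) derived_space"
  by (rule ell2_vectorspace) simp_all

lemma derived_finsum:
  assumes "finite A" "\<And>a. a \<in> A \<Longrightarrow> f a \<in> carrier ell2"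
  shows "finsum derived_space f A = (\<lambda>k. \<Sum>a\<in>A. f a k)"
  using assms
proof (induction A rule: finite_induct)
  interpret vectorspace "class_ring :: complex ring" derived_space by (rule derived_vectorspace)
  { case empty
    then show ?case by simp
  next
    case (insert a A)
    then have "finsum derived_space f (insert a A) = f a \<oplus>\<^bsub>derived_space\<^esub> finsum derived_space f A"
      by (intro M.finsum_insert) auto
    then show ?case using insert by (simp add: ell2_sum) }
qed

lemma Mats_iff:
  assumes "carrier X = C"
  shows "x \<in> Mats n X \<longleftrightarrow> x \<in> carrier_mat n n \<and> (\<forall>i<n. \<forall>j<n. x $$ (i, j) \<in> C)"
  using assms unfolding Mats_def by (auto dest!: elements_matD intro: elements_matI)

lemmas Mats_derived = Mats_iff[OF derived_space_simps(1)] and Mats_OH = Mats_iff[OF OH_simps(1)]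

lemma Mats_dim: "x \<in> Mats n X \<Longrightarrow> dim_row x = n"
  by (auto simp: Mats_def)

lemma sq_summable_coords: "x \<in> carrier_mat n n \<Longrightarrow> (\<And>i j. i < n \<Longrightarrow> j < n \<Longrightarrow> x $$ (i, j) \<in> carrier ell2) \<Longrightarrow> sq_summable n (coords x)"
  by (simp add: sq_summable_def in_ell2_iff)

lemma represents_nonneg: "represents n x f c \<Longrightarrow> c \<ge> 0"
  by (simp add: represents_def adm_def)

text \<open>The witness is the constant odd part plus \<open>disc_map\<close> times the even part:
  \<open>disc_map\<close> vanishes at 1/2 with derivative \<open>dm_deriv\<close>. So the infimum in
  \<open>derived_mnorm\<close> is over a nonempty set.\<close>

lemma represents_exists:
  assumes "x \<in> Mats n derived_space"
  shows "\<exists>f c. represents n x f c"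
proof -
  have s: "summable (\<lambda>k. (cmod (odds (x $$ (i, j)) k))\<^sup>2)" "summable (\<lambda>k. (cmod (evens (x $$ (i, j)) k))\<^sup>2)"
    if "i < n" "j < n" for i j
    using assms that odds_in_ell2 evens_in_ell2 unfolding Mats_derived in_ell2_iff[symmetric] by auto
  let ?f = "\<lambda>k i j s. odds (x $$ (i, j)) k + disc_map s * evens (x $$ (i, j)) k"
  have "\<exists>c. adm n ?f c"
    by (rule exI, rule adm_add, rule adm_const, rule s(1), assumption, assumption,
        rule adm_mult_disc_map, rule adm_const, rule s(2))
  then obtain c where "adm n ?f c" ..
  moreover have "(?f k i j has_field_derivative dm_deriv * evens (x $$ (i, j)) k) (at (1/2))" for k i j
    by (auto intro!: derivative_eq_intros disc_map_deriv)
  ultimately have "represents n x ?f c" by (simp add: represents_def disc_map_half)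
  then show ?thesis by blast
qed

lemma derived_mnorm_le: "represents n x f c \<Longrightarrow> x \<in> carrier_mat n n \<Longrightarrow> derived_mnorm x \<le> c"
  unfolding derived_mnorm_def using represents_nonneg
  by (intro cInf_lower bdd_belowI[of _ 0]) auto

lemma derived_mnorm_nonneg: "x \<in> Mats n derived_space \<Longrightarrow> derived_mnorm x \<ge> 0"
  unfolding derived_mnorm_def using represents_exists[of x n] represents_nonneg
  by (intro cInf_greatest) (auto simp: Mats_dim)

lemma derived_mnorm_less:
  assumes x: "x \<in> Mats n derived_space" and c: "derived_mnorm x < c"
  shows "\<exists>f. represents n x f c"
proof -
  have d: "dim_row x = n" using x by (rule Mats_dim)
  have "{c. \<exists>f. represents (dim_row x) x f c} \<noteq> {}" using represents_exists[OF x] d by auto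
  from cInf_lessD[OF this c[unfolded derived_mnorm_def]]
  obtain b f where b: "b < c" "represents n x f b" using d by auto
  then have "represents n x f c" unfolding represents_def by (auto intro: adm_mono[OF _ less_imp_le[OF b(1)]])
  then show ?thesis by (rule exI[of _ f])
qed

lemma derived_mnorm_le_all:
  assumes x: "x \<in> Mats n derived_space" and le: "\<And>f c. represents n x f c \<Longrightarrow> t \<le> c"
  shows "t \<le> derived_mnorm x"
proof (rule field_le_epsilon)
  fix e :: real assume "e > 0"
  then have "derived_mnorm x < derived_mnorm x + e" by simp
  from derived_mnorm_less[OF x this] le show "t \<le> derived_mnorm x + e" by blast
qed

lemma represents_add:
  assumes "represents n x f c" "represents n y g d"
    and "\<And>i j. i < n \<Longrightarrow> j < n \<Longrightarrow> w $$ (i, j) = (\<lambda>k. (x $$ (i, j)) k + (y $$ (i, j)) k)"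
  shows "represents n w (\<lambda>k i j s. f k i j s + g k i j s) (c + d)"
  using assms unfolding represents_def
  by (auto intro!: adm_add derivative_eq_intros simp: odds_def evens_def algebra_simps)

lemma represents_bimult:
  assumes "represents m x f c" and a: "opb n m a A" and b: "opb m n b B"
    and w: "\<And>i j. i < n \<Longrightarrow> j < n \<Longrightarrow> w $$ (i, j) = (\<lambda>k. \<Sum>p<m. \<Sum>q<m. a i p * b q j * (x $$ (p, q)) k)"
  shows "represents n w (\<lambda>k i j s. \<Sum>p<m. \<Sum>q<m. a i p * b q j * f k p q s) (A * c * B)"
  unfolding represents_def
proof (intro conjI allI impI)
  show "adm n (\<lambda>k i j s. \<Sum>p<m. \<Sum>q<m. a i p * b q j * f k p q s) (A * c * B)"
    using assms(1) by (intro adm_bimult a b) (simp add: represents_def)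
  fix k i j assume ij: "i < n" "j < n"
  show "(\<Sum>p<m. \<Sum>q<m. a i p * b q j * f k p q (1/2)) = odds (w $$ (i, j)) k"
    using assms(1) ij by (simp add: w represents_def odds_def)
  have "((\<lambda>s. \<Sum>p<m. \<Sum>q<m. a i p * b q j * f k p q s) has_field_derivative
      (\<Sum>p<m. \<Sum>q<m. a i p * b q j * (dm_deriv * evens (x $$ (p, q)) k))) (at (1/2))"
    using assms(1) by (intro DERIV_sum DERIV_cmult) (simp add: represents_def)
  also have "(\<Sum>p<m. \<Sum>q<m. a i p * b q j * (dm_deriv * evens (x $$ (p, q)) k)) = dm_deriv * evens (w $$ (i, j)) k"
    using ij by (simp add: w evens_def sum_distrib_left mult_ac)
  finally show "((\<lambda>s. \<Sum>p<m. \<Sum>q<m. a i p * b q j * f k p q s) has_field_derivative dm_deriv * evens (w $$ (i, j)) k) (at (1/2))" .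
qed

text \<open>A scalar matrix on either side acts on representing functions pointwise in s and
  commutes with the derivative. Besides the Ruan axiom for products this yields scaling and the
  compression to diagonal blocks.\<close>

lemma derived_mnorm_bimult:
  assumes x: "x \<in> Mats m derived_space" and a: "opb n m a A" and b: "opb m n b B" and w': "w \<in> carrier_mat n n"
    and w: "\<And>i j. i < n \<Longrightarrow> j < n \<Longrightarrow> w $$ (i, j) = (\<lambda>k. \<Sum>p<m. \<Sum>q<m. a i p * b q j * (x $$ (p, q)) k)"
  shows "derived_mnorm w \<le> A * derived_mnorm x * B"
proof -
  have AB: "A \<ge> 0" "B \<ge> 0" using a b by (auto simp: opb_def)
  have "derived_mnorm w \<le> A * (derived_mnorm x + e) * B" if "e > 0" for e
    using derived_mnorm_less[OF x, of "derived_mnorm x + e"] that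
      derived_mnorm_le[OF represents_bimult[OF _ a b w] w'] by auto
  moreover have "((\<lambda>e. A * (derived_mnorm x + e) * B) \<longlongrightarrow> A * (derived_mnorm x + 0) * B) (at_right 0)"
    by (intro tendsto_intros)
  ultimately show ?thesis
    using tendsto_lowerbound[of "\<lambda>e. A * (derived_mnorm x + e) * B" _ "at_right (0::real)" "derived_mnorm w"]
    by (simp add: eventually_at_filter)
qed

text \<open>Evaluation at the midpoint is a complete contraction: this is the three lines half of
  the interpolation theorem.\<close>

lemma OH_mnorm_odds_le:
  assumes x: "x \<in> Mats n derived_space"
  shows "OH_mnorm (map_mat odds x) \<le> derived_mnorm x"
proof (rule derived_mnorm_le_all[OF x])
  fix f c assume f: "represents n x f c"
  show "OH_mnorm (map_mat odds x) \<le> c"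
    using x f by (intro OH_mnorm_le_adm[of _ n f] sq_summable_coords)
      (auto simp: Mats_derived represents_def odds_in_ell2)
qed

text \<open>A nearly optimal function with value \<open>evens x\<close> at 1/2, multiplied by
  \<open>disc_map\<close>, vanishes there and has derivative \<open>dm_deriv\<close> times that
  value. Conversely a function representing \<open>x\<close> vanishes at 1/2, and its quotient by
  \<open>disc_map\<close> takes the value \<open>evens x\<close>. Neither operation changes the
  boundary norms.\<close>

lemma derived_mnorm_evens:
  assumes x: "x \<in> Mats n derived_space" and z: "\<And>i j. i < n \<Longrightarrow> j < n \<Longrightarrow> odds (x $$ (i, j)) = (\<lambda>_. 0)"
  shows "derived_mnorm x = OH_mnorm (map_mat evens x)"
proof (rule antisym)
  have xc: "x \<in> carrier_mat n n" and xe: "\<And>i j. i < n \<Longrightarrow> j < n \<Longrightarrow> x $$ (i, j) \<in> carrier ell2"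
    using x by (auto simp: Mats_derived)
  have ss: "sq_summable n (coords (map_mat evens x))"
    using xc xe by (intro sq_summable_coords) (auto simp: evens_in_ell2)
  show "derived_mnorm x \<le> OH_mnorm (map_mat evens x)"
  proof (rule field_le_epsilon)
    fix e :: real assume "e > 0"
    then have less: "OH_mnorm (map_mat evens x) < OH_mnorm (map_mat evens x) + e" (is "_ < ?c") by simp
    have xc': "map_mat evens x \<in> carrier_mat n n" using xc by simp
    obtain H where H: "\<And>i j p q. strip_fun (H i j p q)"
      "\<And>i j p q. i < n \<Longrightarrow> j < n \<Longrightarrow> p < n \<Longrightarrow> q < n \<Longrightarrow> H i j p q (1/2) = (if i = p \<and> j = q then 1 else 0)"
      and adm: "adm n (\<lambda>k i j s. \<Sum>p<n. \<Sum>q<n. H i j p q s * coords (map_mat evens x) k p q) ?c"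
      using OH_mnorm_adm[OF xc' ss less] by blast
    let ?g = "\<lambda>k i j s. \<Sum>p<n. \<Sum>q<n. H i j p q s * coords (map_mat evens x) k p q"
    have g: "?g k i j (1/2) = evens (x $$ (i, j)) k" if "i < n" "j < n" for k i j
    proof -
      have "?g k i j (1/2) = (\<Sum>p<n. \<Sum>q<n. if q = j then (if p = i then evens (x $$ (i, j)) k else 0) else 0)"
        using that xc by (intro sum.cong refl) (auto simp: H(2))
      then show ?thesis using that by simp
    qed
    have "represents n x (\<lambda>k i j s. disc_map s * ?g k i j s) ?c"
      unfolding represents_def
    proof (intro conjI allI impI adm_mult_disc_map adm)
      fix k i j assume ij: "i < n" "j < n"
      show "disc_map (1/2) * ?g k i j (1/2) = odds (x $$ (i, j)) k" using z ij by (simp add: disc_map_half)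
      have "(?g k i j has_field_derivative deriv (?g k i j) (1/2)) (at (1/2))"
        using adm ij by (intro strip_fun_field_derivative) (simp add: adm_def)
      from DERIV_mult[OF disc_map_deriv this]
      show "((\<lambda>s. disc_map s * ?g k i j s) has_field_derivative dm_deriv * evens (x $$ (i, j)) k) (at (1/2))"
        unfolding g[OF ij] disc_map_half by simp
    qed
    then show "derived_mnorm x \<le> ?c" using xc by (rule derived_mnorm_le)
  qed
  show "OH_mnorm (map_mat evens x) \<le> derived_mnorm x"
  proof (rule derived_mnorm_le_all[OF x])
    fix f c assume f: "represents n x f c"
    have "adm n (\<lambda>k i j. divide_disc_map (f k i j)) c"
      using f z by (intro adm_divide_disc_map) (auto simp: represents_def)
    moreover have "divide_disc_map (f k i j) (1/2) = evens (x $$ (i, j)) k" if "i < n" "j < n" for k i j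
    proof -
      have "deriv (f k i j) (1/2) = dm_deriv * evens (x $$ (i, j)) k"
        using f that by (intro DERIV_imp_deriv) (simp add: represents_def)
      then show ?thesis by (simp add: divide_disc_map_def)
    qed
    ultimately show "OH_mnorm (map_mat evens x) \<le> c"
      using xc ss by (intro OH_mnorm_le_adm[of _ n "\<lambda>k i j. divide_disc_map (f k i j)"]) auto
  qed
qed

text \<open>The odd part is prescribed; the even part is read off from the derivative of the
  extremal function. Together with \<open>OH_mnorm_odds_le\<close> this makes evaluation a complete
  quotient map.\<close>

lemma derived_lift:
  assumes z: "z \<in> Mats n OH" and c: "OH_mnorm z < c"
  obtains x where "x \<in> Mats n derived_space" "\<And>i j. i < n \<Longrightarrow> j < n \<Longrightarrow> odds (x $$ (i, j)) = z $$ (i, j)" "derived_mnorm x \<le> c"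
proof -
  have zc: "z \<in> carrier_mat n n" and ze: "\<And>i j. i < n \<Longrightarrow> j < n \<Longrightarrow> z $$ (i, j) \<in> carrier ell2"
    using z by (auto simp: Mats_OH)
  obtain H where H: "\<And>i j p q. strip_fun (H i j p q)"
    "\<And>i j p q. i < n \<Longrightarrow> j < n \<Longrightarrow> p < n \<Longrightarrow> q < n \<Longrightarrow> H i j p q (1/2) = (if i = p \<and> j = q then 1 else 0)"
    and adm: "adm n (\<lambda>k i j s. \<Sum>p<n. \<Sum>q<n. H i j p q s * coords z k p q) c"
    using OH_mnorm_adm[OF zc sq_summable_coords[OF zc ze] c] by blast
  \<comment> \<open>A finite combination of entries of \<open>z\<close> with coefficients
    independent of k, hence again in \<open>ell2\<close>.\<close>
  define y where "y = (\<lambda>i j k. \<Sum>p<n. \<Sum>q<n. deriv (H i j p q) (1/2) / dm_deriv * (z $$ (p, q)) k)"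
  have y: "y i j \<in> carrier ell2" for i j
    unfolding y_def by (intro ell2_sum ell2_scale ze) auto
  define x where "x = Matrix.mat n n (\<lambda>(i, j). interleave (y i j) (z $$ (i, j)))"
  have x: "x \<in> Mats n derived_space" by (auto simp: x_def Mats_derived intro!: interleave_in_ell2 y ze)
  have "represents n x (\<lambda>k i j s. \<Sum>p<n. \<Sum>q<n. H i j p q s * coords z k p q) c"
    unfolding represents_def
  proof (intro conjI allI impI adm)
    fix k i j assume ij: "i < n" "j < n"
    have "(\<Sum>p<n. \<Sum>q<n. H i j p q (1/2) * coords z k p q) = (\<Sum>p<n. \<Sum>q<n. if q = j then (if p = i then (z $$ (i, j)) k else 0) else 0)"
      using ij by (intro sum.cong refl) (auto simp: H(2))
    then show "(\<Sum>p<n. \<Sum>q<n. H i j p q (1/2) * coords z k p q) = odds (x $$ (i, j)) k" using ij by (simp add: x_def)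
    have "((\<lambda>s. \<Sum>p<n. \<Sum>q<n. H i j p q s * coords z k p q) has_field_derivative
        (\<Sum>p<n. \<Sum>q<n. deriv (H i j p q) (1/2) * coords z k p q)) (at (1/2))"
      by (intro DERIV_sum DERIV_cmult_right strip_fun_field_derivative H(1))
    also have "(\<Sum>p<n. \<Sum>q<n. deriv (H i j p q) (1/2) * coords z k p q) = dm_deriv * evens (x $$ (i, j)) k"
      using ij by (simp add: x_def y_def sum_distrib_left)
    finally show "((\<lambda>s. \<Sum>p<n. \<Sum>q<n. H i j p q s * coords z k p q) has_field_derivative dm_deriv * evens (x $$ (i, j)) k) (at (1/2))" .
  qed
  then have "derived_mnorm x \<le> c" using x by (intro derived_mnorm_le) (auto simp: Mats_derived)
  moreover have "odds (x $$ (i, j)) = z $$ (i, j)" if "i < n" "j < n" for i j using that by (simp add: x_def)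
  ultimately show thesis using that x by blast
qed

lemma OH_mnorm_eq_0D:
  assumes z: "z \<in> Mats n OH" and 0: "OH_mnorm z = 0" and ij: "i < n" "j < n"
  shows "z $$ (i, j) = (\<lambda>_. 0)"
proof -
  have zc: "z \<in> carrier_mat n n" and ze: "z $$ (i, j) \<in> carrier ell2" using z ij by (auto simp: Mats_OH)
  \<comment> \<open>The matrix unit at (j, j): its image under \<open>cpmap\<close> has the squared
    norm of \<open>z $$ (i, j)\<close> at the diagonal position i.\<close>
  let ?X = "\<lambda>p q. if p = j \<and> q = j then 1 else 0 :: complex"
  have "sqrt (hsn n (cpmap n (coords z) ?X)) \<le> 0" using OH_mnorm_cpmap[OF zc, of ?X] 0 by simp
  then have "hsn n (cpmap n (coords z) ?X) = 0" using hsn_nonneg[of n "cpmap n (coords z) ?X"] by simp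
  then have "cpmap n (coords z) ?X i i = 0" using ij by (simp add: hsn_eq_0_iff)
  moreover have "cpmap n (coords z) ?X i i = (\<Sum>p<n. \<Sum>q<n. if q = j then (if p = j then (\<Sum>k. coords z k i j * cnj (coords z k i j)) else 0) else 0)"
    unfolding cpmap_def by (intro sum.cong refl) auto
  ultimately have "(\<Sum>k. coords z k i j * cnj (coords z k i j)) = 0" using ij by simp
  then have "complex_of_real (\<Sum>k. (cmod ((z $$ (i, j)) k))\<^sup>2) = 0"
    using ze by (subst suminf_of_real) (auto simp: in_ell2_iff complex_norm_square simp del: of_real_power)
  then have "(\<Sum>k. (cmod ((z $$ (i, j)) k))\<^sup>2) = 0" by (simp only: of_real_eq_0_iff)
  then show ?thesis using ze unfolding in_ell2_iff by (subst (asm) suminf_eq_zero_iff) auto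
qed

section \<open>Ruan axioms, subspace and quotient\<close>

lemma opb_scalar: "opb n n (\<lambda>i p. if p = i then c else 0) (cmod c)"
  unfolding opb_def
proof (intro conjI allI)
  fix v
  have "sqn n (\<lambda>i. \<Sum>j<n. (if j = i then c else 0) * v j) = sqn n (\<lambda>i. c * v i)"
    unfolding sqn_def by (intro sum.cong refl) (simp add: if_distrib[of "\<lambda>t. t * _"] cong: if_cong)
  then show "sqn n (\<lambda>i. \<Sum>j<n. (if j = i then c else 0) * v j) \<le> (cmod c)\<^sup>2 * sqn n v"
    by (simp add: sqn_scale)
qed simp

lemma opb_embed:
  assumes "r + n \<le> N" shows "opb n N (\<lambda>i p. if p = r + i then 1 else 0) 1"
  unfolding opb_def
proof (intro conjI allI)
  fix v
  have "sqn n (\<lambda>i. \<Sum>p<N. (if p = r + i then 1 else 0) * v p) = sqn n (\<lambda>i. v (r + i))"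
    unfolding sqn_def using assms
    by (intro sum.cong refl) (simp add: if_distrib[of "\<lambda>t. t * _"] cong: if_cong)
  also have "\<dots> \<le> sqn r v + sqn n (\<lambda>i. v (r + i))" by simp
  also have "\<dots> = sqn (r + n) v" by (simp add: sqn_def sum_lessThan_add)
  also have "\<dots> \<le> sqn N v" unfolding sqn_def using assms by (intro sum_mono2) auto
  finally show "sqn n (\<lambda>i. \<Sum>p<N. (if p = r + i then 1 else 0) * v p) \<le> 1\<^sup>2 * sqn N v" by simp
qed simp

lemma sum_delta_delta:
  fixes i j m :: nat
  assumes "i < m" "j < m"
  shows "(\<Sum>p<m. \<Sum>q<m. (if p = i then c else 0) * (if q = j then d else 0) * X p q) = c * d * (X i j :: complex)"
proof -
  have "(\<Sum>p<m. \<Sum>q<m. (if p = i then c else 0) * (if q = j then d else 0) * X p q)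
    = (\<Sum>p<m. \<Sum>q<m. if q = j then (if p = i then c * d * X i j else 0) else 0)"
    by (intro sum.cong refl) auto
  also have "\<dots> = (\<Sum>p<m. if p = i then c * d * X i j else 0)"
    using assms(2) by (subst sum.delta) auto
  also have "\<dots> = c * d * X i j" using assms(1) by (subst sum.delta) auto
  finally show ?thesis .
qed

lemma derived_mnorm_scale_le:
  assumes x: "x \<in> Mats n derived_space"
  shows "derived_mnorm (map_mat (\<lambda>v k. c * v k) x) \<le> cmod c * derived_mnorm x"
proof -
  have "derived_mnorm (map_mat (\<lambda>v k. c * v k) x) \<le> cmod c * derived_mnorm x * cmod 1"
    using x by (intro derived_mnorm_bimult[OF x opb_scalar opb_transpose[OF opb_scalar]])
      (auto simp: Mats_derived sum_delta_delta)
  then show ?thesis by simp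
qed

text \<open>For \<open>c \<noteq> 0\<close> the reverse inequality is the assumed one for the
  inverse scalar.\<close>

lemma scale_mat_invertible:
  assumes le: "\<And>x c. x \<in> Mats n X \<Longrightarrow> nrm (map_mat (\<lambda>v k. c * v k) x) \<le> cmod c * (nrm x :: real)"
    and C: "carrier X = carrier ell2" and x: "x \<in> Mats n X" and nn: "\<And>x. x \<in> Mats n X \<Longrightarrow> nrm x \<ge> 0"
  shows "nrm (map_mat (\<lambda>v k. c * v k) x) = cmod c * nrm x"
proof (rule antisym[OF le[OF x]])
  have cx: "map_mat (\<lambda>v k. c * v k) x \<in> Mats n X" for c
    using x unfolding Mats_iff[OF C] by (auto simp: ell2_scale)
  show "cmod c * nrm x \<le> nrm (map_mat (\<lambda>v k. c * v k) x)"
  proof (cases "c = 0")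
    case False
    have "map_mat (\<lambda>v k. inverse c * v k) (map_mat (\<lambda>v k. c * v k) x) = x"
      using False by (intro eq_matI) auto
    then have "nrm x \<le> cmod (inverse c) * nrm (map_mat (\<lambda>v k. c * v k) x)" using le[OF cx, of "inverse c" c] by simp
    then show ?thesis using False by (simp add: norm_inverse norm_divide field_simps)
  next
    case True
    then show ?thesis using nn[OF cx[of c]] by simp
  qed
qed

theorem derived_operator_space: "operator_space derived_space"
proof (rule operator_space.intro[OF derived_vectorspace], unfold_locales)
  fix n :: nat and x assume x: "x \<in> Mats n derived_space"
  show "0 \<le> mnorm derived_space x" using derived_mnorm_nonneg[OF x] by simp
  show "mnorm derived_space x = 0 \<longleftrightarrow> x = mat_zero derived_space n n"
  proof
    assume 0: "mnorm derived_space x = 0"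
    \<comment> \<open>The norm dominates that of the quotient, so the odd parts vanish; then x lies
      in the kernel, where the norm is the \<open>OH\<close> norm of the even parts.\<close>
    have "OH_mnorm (map_mat odds x) = 0"
      using OH_mnorm_odds_le[OF x] 0[unfolded derived_space_simps] OH_mnorm_nonneg[of "map_mat odds x"] by linarith
    moreover have "map_mat odds x \<in> Mats n OH" "map_mat evens x \<in> Mats n OH"
      using x by (auto simp: Mats_derived Mats_OH odds_in_ell2 evens_in_ell2)
    ultimately have odds: "odds (x $$ (i, j)) = (\<lambda>_. 0)" if "i < n" "j < n" for i j
      using OH_mnorm_eq_0D[of "map_mat odds x" n i j] that x by (auto simp: Mats_derived)
    then have "OH_mnorm (map_mat evens x) = 0" using derived_mnorm_evens[OF x] 0 by simp
    then have "evens (x $$ (i, j)) = (\<lambda>_. 0)" if "i < n" "j < n" for i j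
      using OH_mnorm_eq_0D[of "map_mat evens x" n i j] \<open>map_mat evens x \<in> _\<close> that x by (auto simp: Mats_derived)
    with odds have "x $$ (i, j) = (\<lambda>_. 0)" if "i < n" "j < n" for i j
      using that by - (rule evens_odds_eqI, simp_all)
    then show "x = mat_zero derived_space n n" using x by (intro eq_matI) (auto simp: mat_zero_def Mats_derived)
  next
    assume "x = mat_zero derived_space n n"
    then have "map_mat (\<lambda>v k. 0 * v k) x = x" by (intro eq_matI) (auto simp: mat_zero_def)
    then show "mnorm derived_space x = 0"
      using derived_mnorm_scale_le[OF x, of 0] derived_mnorm_nonneg[OF x] by simp
  qed
  show "mnorm derived_space (map_mat ((\<odot>\<^bsub>derived_space\<^esub>) c) x) = cmod c * mnorm derived_space x" for c
    using scale_mat_invertible[of n derived_space derived_mnorm x c, OF derived_mnorm_scale_le _ x derived_mnorm_nonneg]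
    by (simp add: derived_space_simps(4)[abs_def])
  fix y assume y: "y \<in> Mats n derived_space"
  show "mnorm derived_space (mat_add derived_space x y) \<le> mnorm derived_space x + mnorm derived_space y"
  proof (rule field_le_epsilon)
    fix e :: real assume e: "e > 0"
    obtain f where f: "represents n x f (derived_mnorm x + e / 2)" using derived_mnorm_less[OF x, of "derived_mnorm x + e / 2"] e by auto
    obtain g where g: "represents n y g (derived_mnorm y + e / 2)" using derived_mnorm_less[OF y, of "derived_mnorm y + e / 2"] e by auto
    have "represents n (mat_add derived_space x y) (\<lambda>k i j s. f k i j s + g k i j s) (derived_mnorm x + e / 2 + (derived_mnorm y + e / 2))"
      using x y by (intro represents_add[OF f g]) (auto simp: mat_add_def Mats_derived)
    moreover have "mat_add derived_space x y \<in> carrier_mat n n" using x by (auto simp: mat_add_def Mats_derived)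
    ultimately have "derived_mnorm (mat_add derived_space x y) \<le> derived_mnorm x + e / 2 + (derived_mnorm y + e / 2)"
      by (rule derived_mnorm_le)
    then show "mnorm derived_space (mat_add derived_space x y) \<le> mnorm derived_space x + mnorm derived_space y + e" by simp
  qed
next
  fix m n :: nat and x y assume x: "x \<in> Mats m derived_space" and y: "y \<in> Mats n derived_space"
  let ?w = "mat_dsum derived_space x y"
  have xc: "x \<in> carrier_mat m m" and yc: "y \<in> carrier_mat n n" using x y by (auto simp: Mats_derived)
  have wc: "?w \<in> carrier_mat (m + n) (m + n)"
    using xc yc unfolding mat_dsum_def by (intro four_block_carrier_mat) auto
  have w: "?w $$ (i, j) = (if i < m \<and> j < m then x $$ (i, j) else if i \<ge> m \<and> j \<ge> m then y $$ (i - m, j - m) else (\<lambda>_. 0))"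
    if "i < m + n" "j < m + n" for i j
    using that xc yc by (auto simp: mat_dsum_def mat_zero_def)
  have wM: "?w \<in> Mats (m + n) derived_space"
    using wc x y by (auto simp: Mats_derived w ell2_zero)
  show "mnorm derived_space ?w = max (mnorm derived_space x) (mnorm derived_space y)"
  proof (rule antisym)
    show "mnorm derived_space ?w \<le> max (mnorm derived_space x) (mnorm derived_space y)"
    proof (rule field_le_epsilon)
      fix e :: real assume e: "e > 0"
      let ?c = "max (derived_mnorm x) (derived_mnorm y) + e"
      have "derived_mnorm x < ?c" "derived_mnorm y < ?c" using e by (auto simp: max_def)
      then obtain f g where f: "represents m x f ?c" and g: "represents n y g ?c"
        using derived_mnorm_less[OF x] derived_mnorm_less[OF y] by blast
      have "represents (m + n) ?w (\<lambda>k i j s. block m (\<lambda>i j. f k i j s) (\<lambda>i j. g k i j s) i j) ?c"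
        unfolding represents_def
      proof (intro conjI allI impI)
        show "adm (m + n) (\<lambda>k i j s. block m (\<lambda>i j. f k i j s) (\<lambda>i j. g k i j s) i j) ?c"
          using f g by (intro adm_block) (auto simp: represents_def)
        fix k i j assume ij: "i < m + n" "j < m + n"
        show "block m (\<lambda>i j. f k i j (1/2)) (\<lambda>i j. g k i j (1/2)) i j = odds (?w $$ (i, j)) k"
          using f g ij by (auto simp: w block_def represents_def)
        show "((\<lambda>s. block m (\<lambda>i j. f k i j s) (\<lambda>i j. g k i j s) i j) has_field_derivative dm_deriv * evens (?w $$ (i, j)) k) (at (1/2))"
          using f g ij by (auto simp: w block_def represents_def)
      qed
      then show "mnorm derived_space ?w \<le> max (mnorm derived_space x) (mnorm derived_space y) + e"
        using derived_mnorm_le[OF _ wc] by simp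
    qed
    \<comment> \<open>The diagonal blocks are recovered from the direct sum by compression with
      coordinate embeddings of norm 1, at offset 0 and at offset m.\<close>
    have "derived_mnorm x \<le> 1 * derived_mnorm ?w * 1"
    proof (rule derived_mnorm_bimult[OF wM _ _ xc])
      show "opb m (m + n) (\<lambda>i p. if p = 0 + i then 1 else 0) 1" by (rule opb_embed) simp
      from opb_transpose[OF this] show "opb (m + n) m (\<lambda>q j. if q = 0 + j then 1 else 0) 1" .
      show "x $$ (i, j) = (\<lambda>k. \<Sum>p<m + n. \<Sum>q<m + n. (if p = 0 + i then 1 else 0) * (if q = 0 + j then 1 else 0) * (?w $$ (p, q)) k)"
        if "i < m" "j < m" for i j
        using that by (subst sum_delta_delta) (auto simp: w)
    qed
    moreover have "derived_mnorm y \<le> 1 * derived_mnorm ?w * 1"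
    proof (rule derived_mnorm_bimult[OF wM _ _ yc])
      show "opb n (m + n) (\<lambda>i p. if p = m + i then 1 else 0) 1" by (rule opb_embed) simp
      from opb_transpose[OF this] show "opb (m + n) n (\<lambda>q j. if q = m + j then 1 else 0) 1" .
      show "y $$ (i, j) = (\<lambda>k. \<Sum>p<m + n. \<Sum>q<m + n. (if p = m + i then 1 else 0) * (if q = m + j then 1 else 0) * (?w $$ (p, q)) k)"
        if "i < n" "j < n" for i j
        using that by (subst sum_delta_delta) (auto simp: w)
    qed
    ultimately show "max (mnorm derived_space x) (mnorm derived_space y) \<le> mnorm derived_space ?w" by simp
  qed
next
  fix m n :: nat and \<alpha> \<beta> :: "complex mat" and x
  assume \<alpha>: "\<alpha> \<in> carrier_mat n m" and x: "x \<in> Mats m derived_space" and \<beta>: "\<beta> \<in> carrier_mat m n"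
  have xc: "x \<in> carrier_mat m m" and xe: "\<And>i j. i < m \<Longrightarrow> j < m \<Longrightarrow> x $$ (i, j) \<in> carrier ell2" using x by (auto simp: Mats_derived)
  have "mat_bimult derived_space \<alpha> x \<beta> $$ (i, j) = (\<lambda>k. \<Sum>p<m. \<Sum>q<m. \<alpha> $$ (i, p) * \<beta> $$ (q, j) * (x $$ (p, q)) k)"
    if "i < n" "j < n" for i j
  proof -
    have "mat_bimult derived_space \<alpha> x \<beta> $$ (i, j) = (\<Oplus>\<^bsub>derived_space\<^esub>p\<in>{..<m}. \<Oplus>\<^bsub>derived_space\<^esub>q\<in>{..<m}. (\<alpha> $$ (i, p) * \<beta> $$ (q, j)) \<odot>\<^bsub>derived_space\<^esub> x $$ (p, q))"
      using that \<alpha> \<beta> xc by (simp add: mat_bimult_def)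
    also have "\<dots> = (\<Oplus>\<^bsub>derived_space\<^esub>p\<in>{..<m}. (\<lambda>k. \<Sum>q<m. \<alpha> $$ (i, p) * \<beta> $$ (q, j) * (x $$ (p, q)) k))"
    proof (rule abelian_monoid.finsum_cong'[OF _ refl])
      show "abelian_monoid derived_space"
        using derived_vectorspace by (simp add: vectorspace_def module_def abelian_group_def)
      show "(\<lambda>p k. \<Sum>q<m. \<alpha> $$ (i, p) * \<beta> $$ (q, j) * (x $$ (p, q)) k) \<in> {..<m} \<rightarrow> carrier derived_space"
        using xe by (auto intro!: ell2_sum ell2_scale)
      show "(\<Oplus>\<^bsub>derived_space\<^esub>q\<in>{..<m}. (\<alpha> $$ (i, p) * \<beta> $$ (q, j)) \<odot>\<^bsub>derived_space\<^esub> x $$ (p, q)) = (\<lambda>k. \<Sum>q<m. \<alpha> $$ (i, p) * \<beta> $$ (q, j) * (x $$ (p, q)) k)"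
        if "p \<in> {..<m}" for p
        using that xe by (subst derived_finsum) (auto intro!: ell2_scale)
    qed
    also have "\<dots> = (\<lambda>k. \<Sum>p<m. \<Sum>q<m. \<alpha> $$ (i, p) * \<beta> $$ (q, j) * (x $$ (p, q)) k)"
      using xe by (subst derived_finsum) (auto intro!: ell2_sum ell2_scale)
    finally show ?thesis .
  qed
  moreover have "mat_bimult derived_space \<alpha> x \<beta> \<in> carrier_mat n n" using \<alpha> \<beta> by (simp add: mat_bimult_def)
  moreover have "opb n m (\<lambda>i p. \<alpha> $$ (i, p)) (mat_op_norm \<alpha>)" using opb_mat_op_norm[of \<alpha>] \<alpha> by simp
  moreover have "opb m n (\<lambda>i p. \<beta> $$ (i, p)) (mat_op_norm \<beta>)" using opb_mat_op_norm[of \<beta>] \<beta> by simp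
  ultimately show "mnorm derived_space (mat_bimult derived_space \<alpha> x \<beta>) \<le> mat_op_norm \<alpha> * mnorm derived_space x * mat_op_norm \<beta>"
    using derived_mnorm_bimult[OF x] by simp
qed

section \<open>The subspace: the kernel of evaluation at the midpoint\<close>

definition odd_free :: "(nat \<Rightarrow> complex) set" where
  "odd_free = {x \<in> carrier ell2. odds x = (\<lambda>_. 0)}"

lemma odd_free_subspace: "VectorSpace.subspace (class_ring :: complex ring) odd_free derived_space"
proof (rule VectorSpace.subspace.intro[OF derived_vectorspace], rule submodule.intro)
  show "module (class_ring :: complex ring) derived_space" using derived_vectorspace by (simp add: vectorspace_def)
qed (auto simp: odd_free_def ell2_add ell2_scale ell2_zero odds_def fun_eq_iff)

text \<open>The isometry is the derivative at 1/2 in units of \<open>dm_deriv\<close>, that is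
  \<open>evens\<close>; \<open>derived_mnorm_evens\<close> gives the norms at all levels.\<close>

lemma odd_free_isometric: "completely_isometric (subspace_opspace derived_space odd_free) OH"
  unfolding completely_isometric_def complete_isometry_def
proof (intro exI[of _ evens] conjI allI impI ballI)
  have s: "vectorspace (class_ring :: complex ring) (subspace_opspace derived_space odd_free)"
    unfolding subspace_opspace_def by (rule vectorspace.subspace_is_vs[OF derived_vectorspace odd_free_subspace])
  show "linear_map (class_ring :: complex ring) (subspace_opspace derived_space odd_free) OH evens"
  proof (rule linear_map.intro[OF s OH_vectorspace], rule mod_hom.intro)
    show "module (class_ring :: complex ring) (subspace_opspace derived_space odd_free)" "module (class_ring :: complex ring) OH"
      using s OH_vectorspace by (auto simp: vectorspace_def)
    show "mod_hom_axioms (class_ring :: complex ring) (subspace_opspace derived_space odd_free) OH evens"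
      by (rule mod_hom_axioms.intro)
        (auto simp: module_hom_def subspace_opspace_def odd_free_def evens_in_ell2 evens_def fun_eq_iff)
  qed
  fix n x assume "x \<in> Mats n (subspace_opspace derived_space odd_free)"
  moreover have "carrier (subspace_opspace derived_space odd_free) = odd_free" by (simp add: subspace_opspace_def)
  ultimately have x: "x \<in> carrier_mat n n" "\<And>i j. i < n \<Longrightarrow> j < n \<Longrightarrow> x $$ (i, j) \<in> odd_free"
    using Mats_iff by blast+
  then have "derived_mnorm x = OH_mnorm (map_mat evens x)"
    by (intro derived_mnorm_evens[of _ n]) (auto simp: Mats_derived odd_free_def)
  then show "mnorm OH (map_mat evens x) = mnorm (subspace_opspace derived_space odd_free) x"
    by (simp add: subspace_opspace_def)
next
  show "bij_betw evens (carrier (subspace_opspace derived_space odd_free)) (carrier OH)"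
    unfolding bij_betw_def
  proof (intro conjI)
    show "inj_on evens (carrier (subspace_opspace derived_space odd_free))"
    proof (rule inj_onI)
      fix x y assume "x \<in> carrier (subspace_opspace derived_space odd_free)"
        "y \<in> carrier (subspace_opspace derived_space odd_free)" "evens x = evens y"
      then show "x = y" by - (rule evens_odds_eqI, auto simp: subspace_opspace_def odd_free_def)
    qed
    have "y \<in> evens ` odd_free" if "y \<in> carrier ell2" for y
      using that by (intro image_eqI[of _ _ "interleave y (\<lambda>_. 0)"]) (auto simp: odd_free_def interleave_in_ell2 ell2_zero)
    then show "evens ` carrier (subspace_opspace derived_space odd_free) = carrier OH"
      by (auto simp: subspace_opspace_def odd_free_def evens_in_ell2)
  qed
qed

section \<open>The quotient: cosets labelled by their common odd part\<close>

definition fibre :: "(nat \<Rightarrow> complex) \<Rightarrow> (nat \<Rightarrow> complex) set" where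
  "fibre w = {x \<in> carrier ell2. odds x = w}"

lemma fibre_witness: "w \<in> carrier ell2 \<Longrightarrow> interleave (\<lambda>_. 0) w \<in> fibre w"
  by (simp add: fibre_def interleave_in_ell2 ell2_zero)

lemma odd_free_fibre: "odd_free = fibre (\<lambda>_. 0)"
  by (simp add: odd_free_def fibre_def)

lemma odds_add: "odds (\<lambda>k. u k + v k) = (\<lambda>k. odds u k + odds v k)"
  by (simp add: odds_def fun_eq_iff)

lemma odds_scale: "odds (\<lambda>k. c * u k) = (\<lambda>k. c * odds u k)"
  by (simp add: odds_def fun_eq_iff)

lemma ell2_diff: "u \<in> carrier ell2 \<Longrightarrow> v \<in> carrier ell2 \<Longrightarrow> (\<lambda>k. u k - v k) \<in> carrier ell2"
  using ell2_add[OF _ ell2_uminus, of u v] by simp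

lemma fibre_add:
  assumes "w \<in> carrier ell2" "w' \<in> carrier ell2"
  shows "fibre w <+>\<^bsub>derived_space\<^esub> fibre w' = fibre (\<lambda>k. w k + w' k)"
proof (intro equalityI subsetI)
  fix x assume "x \<in> fibre w <+>\<^bsub>derived_space\<^esub> fibre w'"
  then show "x \<in> fibre (\<lambda>k. w k + w' k)" by (auto simp: set_add_def' fibre_def ell2_add odds_add)
next
  fix x assume x: "x \<in> fibre (\<lambda>k. w k + w' k)"
  let ?h = "interleave (\<lambda>_. 0) w"
  have h: "?h \<in> fibre w" by (rule fibre_witness[OF assms(1)])
  have "(\<lambda>k. x k - ?h k) \<in> fibre w'"
  proof -
    have "(\<lambda>k. x k - ?h k) \<in> carrier ell2" using x h by (simp add: fibre_def ell2_diff)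
    moreover have "odds (\<lambda>k. x k - ?h k) = w'"
      using x by (auto simp: fibre_def odds_def fun_eq_iff interleave_def)
    ultimately show ?thesis by (simp add: fibre_def)
  qed
  moreover have "x = ?h \<oplus>\<^bsub>derived_space\<^esub> (\<lambda>k. x k - ?h k)"
    using x h by (auto simp: fibre_def ell2_diff)
  ultimately show "x \<in> fibre w <+>\<^bsub>derived_space\<^esub> fibre w'" using h unfolding set_add_def' by blast
qed

lemma coset_fibre:
  assumes "a \<in> carrier ell2" shows "odd_free +>\<^bsub>derived_space\<^esub> a = fibre (odds a)"
proof (intro equalityI subsetI)
  fix x assume "x \<in> odd_free +>\<^bsub>derived_space\<^esub> a"
  then show "x \<in> fibre (odds a)" using assms by (auto simp: a_r_coset_def' fibre_def odd_free_def ell2_add odds_add)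
next
  fix x assume x: "x \<in> fibre (odds a)"
  have h: "(\<lambda>k. x k - a k) \<in> odd_free"
    using x assms by (auto simp: fibre_def odd_free_def ell2_diff odds_def fun_eq_iff)
  moreover have "x = (\<lambda>k. x k - a k) \<oplus>\<^bsub>derived_space\<^esub> a"
    using x assms by (auto simp: fibre_def ell2_diff)
  ultimately show "x \<in> odd_free +>\<^bsub>derived_space\<^esub> a" unfolding a_r_coset_def' by blast
qed

abbreviation "quot \<equiv> quotient_opspace derived_space odd_free"

lemma quot_carrier: "carrier quot = fibre ` carrier ell2"
proof -
  have "carrier quot = (\<lambda>a. fibre (odds a)) ` carrier ell2"
    by (auto simp: quotient_opspace_def A_RCOSETS_def' coset_fibre)
  also have "\<dots> = fibre ` carrier ell2"
  proof -
    have "odds ` carrier ell2 = carrier ell2"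
    proof (intro equalityI subsetI)
      fix w assume "w \<in> carrier ell2"
      then show "w \<in> odds ` carrier ell2"
        by (intro image_eqI[of _ _ "interleave (\<lambda>_. 0) w"]) (auto simp: interleave_in_ell2 ell2_zero)
    qed (auto simp: odds_in_ell2)
    then show ?thesis by (metis image_image)
  qed
  finally show ?thesis .
qed

lemma quot_add: "w \<in> carrier ell2 \<Longrightarrow> w' \<in> carrier ell2 \<Longrightarrow> fibre w \<oplus>\<^bsub>quot\<^esub> fibre w' = fibre (\<lambda>k. w k + w' k)"
  by (simp add: quotient_opspace_def fibre_add)

lemma quot_zero: "\<zero>\<^bsub>quot\<^esub> = fibre (\<lambda>_. 0)"
  by (simp add: quotient_opspace_def odd_free_fibre)

lemma quot_smult:
  assumes "w \<in> carrier ell2" shows "c \<odot>\<^bsub>quot\<^esub> fibre w = fibre (\<lambda>k. c * w k)"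
proof -
  have "c \<odot>\<^bsub>quot\<^esub> fibre w = (\<Union>a\<in>fibre w. odd_free +>\<^bsub>derived_space\<^esub> (\<lambda>k. c * a k))"
    by (simp add: quotient_opspace_def)
  also have "\<dots> = (\<Union>a\<in>fibre w. fibre (\<lambda>k. c * w k))"
    by (intro SUP_cong refl) (auto simp: fibre_def coset_fibre ell2_scale odds_scale)
  also have "\<dots> = fibre (\<lambda>k. c * w k)" using fibre_witness[OF assms] by auto
  finally show ?thesis .
qed

lemma quot_vectorspace: "vectorspace (class_ring :: complex ring) quot"
proof -
  have "abelian_group quot"
  proof (rule abelian_groupI)
    fix x assume "x \<in> carrier quot"
    then obtain w where w: "w \<in> carrier ell2" "x = fibre w" by (auto simp: quot_carrier)
    then have "fibre (\<lambda>k. - w k) \<oplus>\<^bsub>quot\<^esub> x = \<zero>\<^bsub>quot\<^esub>" by (simp add: quot_add quot_zero ell2_uminus)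
    then show "\<exists>y\<in>carrier quot. y \<oplus>\<^bsub>quot\<^esub> x = \<zero>\<^bsub>quot\<^esub>" using w by (auto simp: quot_carrier ell2_uminus)
  qed (auto simp: quot_carrier quot_add quot_zero ell2_add ell2_zero ac_simps)
  then have "module (class_ring :: complex ring) quot"
    by (rule moduleI[OF class_cring.is_cring]) 
      (auto simp: quot_carrier quot_add quot_smult ell2_add ell2_scale algebra_simps)
  then show ?thesis by (simp add: vectorspace_def class_field)
qed

text \<open>The choice of a is immaterial, as \<open>odds\<close> is constant on each coset.\<close>

definition fibre_base :: "(nat \<Rightarrow> complex) set \<Rightarrow> nat \<Rightarrow> complex" where
  "fibre_base A = odds (SOME a. a \<in> A)"

lemma fibre_base [simp]: "w \<in> carrier ell2 \<Longrightarrow> fibre_base (fibre w) = w"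
  unfolding fibre_base_def using someI[of "\<lambda>a. a \<in> fibre w", OF fibre_witness[of w]] by (auto simp: fibre_def)

text \<open>The infimum over representatives is bounded below because evaluation is contractive
  (\<open>OH_mnorm_odds_le\<close>) and is approached by the lifts of
  \<open>derived_lift\<close>.\<close>

lemma quot_isometric: "completely_isometric quot OH"
  unfolding completely_isometric_def complete_isometry_def
proof (intro exI[of _ fibre_base] conjI allI impI ballI)
  show "linear_map (class_ring :: complex ring) quot OH fibre_base"
  proof (rule linear_map.intro[OF quot_vectorspace OH_vectorspace], rule mod_hom.intro)
    show "module (class_ring :: complex ring) quot" "module (class_ring :: complex ring) OH"
      using quot_vectorspace OH_vectorspace by (auto simp: vectorspace_def)
    show "mod_hom_axioms (class_ring :: complex ring) quot OH fibre_base"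
      by (rule mod_hom_axioms.intro)
        (auto simp: module_hom_def quot_carrier quot_add quot_smult ell2_add ell2_scale)
  qed
  show "bij_betw fibre_base (carrier quot) (carrier OH)"
    by (rule bij_betw_byWitness[of _ fibre]) (auto simp: quot_carrier)
  fix n A assume A: "A \<in> Mats n quot"
  then have Ac: "A \<in> carrier_mat n n" and Ae: "\<And>i j. i < n \<Longrightarrow> j < n \<Longrightarrow> A $$ (i, j) \<in> fibre ` carrier ell2"
    by (auto simp: Mats_iff[OF quot_carrier])
  define z where "z = map_mat fibre_base A"
  have z: "z \<in> Mats n OH" using Ac Ae by (force simp: Mats_OH z_def)
  have Az: "A $$ (i, j) = fibre (z $$ (i, j))" if ij: "i < n" "j < n" for i j
  proof -
    obtain w where w: "w \<in> carrier ell2" "A $$ (i, j) = fibre w" using Ae[OF ij] by blast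
    have "z $$ (i, j) = fibre_base (A $$ (i, j))" using Ac ij by (auto simp: z_def)
    then show ?thesis using w by simp
  qed
  let ?S = "{derived_mnorm x | x. x \<in> carrier_mat n n \<and> (\<forall>i<n. \<forall>j<n. x $$ (i, j) \<in> A $$ (i, j))}"
  have Q: "mnorm quot A = Inf ?S" using Ac by (simp add: quotient_opspace_def)
  have lower: "OH_mnorm z \<le> t" if "t \<in> ?S" for t
  proof -
    obtain x where x: "t = derived_mnorm x" "x \<in> carrier_mat n n" "\<And>i j. i < n \<Longrightarrow> j < n \<Longrightarrow> x $$ (i, j) \<in> A $$ (i, j)"
      using \<open>t \<in> ?S\<close> by blast
    then have "x \<in> Mats n derived_space" by (auto simp: Mats_derived Az fibre_def)
    moreover have "map_mat odds x = z" using x z by (intro eq_matI) (auto simp: Az fibre_def Mats_OH)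
    ultimately show ?thesis using OH_mnorm_odds_le[of x n] x(1) by simp
  qed
  have upper: "\<exists>t\<in>?S. t \<le> c" if c: "OH_mnorm z < c" for c
  proof -
    obtain x where x: "x \<in> Mats n derived_space" "\<And>i j. i < n \<Longrightarrow> j < n \<Longrightarrow> odds (x $$ (i, j)) = z $$ (i, j)" "derived_mnorm x \<le> c"
      using derived_lift[OF z c] by blast
    then have "derived_mnorm x \<in> ?S" by (auto simp: Mats_derived Az fibre_def)
    then show ?thesis using x(3) by blast
  qed
  have "Inf ?S = OH_mnorm z"
  proof (rule antisym)
    show "Inf ?S \<le> OH_mnorm z"
    proof (rule field_le_epsilon)
      fix e :: real assume "e > 0"
      then obtain t where "t \<in> ?S" and "t \<le> OH_mnorm z + e" using upper[of "OH_mnorm z + e"] by auto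
      have "bdd_below ?S" by (rule bdd_belowI[of _ "OH_mnorm z"]) (rule lower)
      from cInf_lower[OF \<open>t \<in> ?S\<close> this] show "Inf ?S \<le> OH_mnorm z + e" using \<open>t \<le> OH_mnorm z + e\<close> by simp
    qed
    have "?S \<noteq> {}" using upper[of "OH_mnorm z + 1"] by auto
    then show "OH_mnorm z \<le> Inf ?S" using lower by (intro cInf_greatest) auto
  qed
  then show "mnorm OH (map_mat fibre_base A) = mnorm quot A" using Q by (simp add: z_def)
qed

section \<open>Gram matrices and the underlying Banach space\<close>

definition gip :: "(nat \<Rightarrow> complex) \<Rightarrow> (nat \<Rightarrow> complex) \<Rightarrow> complex" where
  "gip x y = (\<Sum>k. x k * cnj (y k))"

lemma gip_sums: "x \<in> carrier ell2 \<Longrightarrow> y \<in> carrier ell2 \<Longrightarrow> (\<lambda>k. x k * cnj (y k)) sums gip x y"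
  unfolding gip_def in_ell2_iff by (intro summable_sums summable_mult_cnj)

lemma ell2_norm_sums: "x \<in> carrier ell2 \<Longrightarrow> (\<lambda>k. (cmod (x k))\<^sup>2) sums (ell2_norm x)\<^sup>2"
proof -
  assume x: "x \<in> carrier ell2"
  then have "(ell2_norm x)\<^sup>2 = (\<Sum>k. (cmod (x k))\<^sup>2)"
    unfolding ell2_norm_def in_ell2_iff by (intro real_sqrt_pow2 suminf_nonneg) auto
  then show ?thesis using x unfolding in_ell2_iff by (simp add: summable_sums)
qed

lemma gip_self: "x \<in> carrier ell2 \<Longrightarrow> gip x x = of_real ((ell2_norm x)\<^sup>2)"
proof -
  assume x: "x \<in> carrier ell2"
  have "(\<lambda>k. complex_of_real ((cmod (x k))\<^sup>2)) sums of_real ((ell2_norm x)\<^sup>2)"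
    using ell2_norm_sums[OF x] by (simp only: sums_of_real_iff)
  then have "(\<lambda>k. x k * cnj (x k)) sums of_real ((ell2_norm x)\<^sup>2)" by (simp only: complex_norm_square)
  then show ?thesis by (simp add: gip_def sums_iff)
qed

lemma ell2_norm_combination:
  assumes b: "\<And>i. i < n \<Longrightarrow> b i \<in> carrier ell2"
  shows "(ell2_norm (\<lambda>k. \<Sum>i<n. c i * b i k))\<^sup>2 = Re (\<Sum>i<n. \<Sum>j<n. c i * cnj (c j) * gip (b i) (b j))"
proof -
  have "(\<lambda>k. Re (\<Sum>i<n. \<Sum>j<n. c i * cnj (c j) * (b i k * cnj (b j k)))) sums Re (\<Sum>i<n. \<Sum>j<n. c i * cnj (c j) * gip (b i) (b j))"
    by (intro sums_Re sums_sum sums_mult gip_sums b) auto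
  moreover have "Re (\<Sum>i<n. \<Sum>j<n. c i * cnj (c j) * (b i k * cnj (b j k))) = (cmod (\<Sum>i<n. c i * b i k))\<^sup>2" for k
  proof -
    have "(\<Sum>i<n. \<Sum>j<n. c i * cnj (c j) * (b i k * cnj (b j k))) = (\<Sum>i<n. c i * b i k) * cnj (\<Sum>j<n. c j * b j k)"
      unfolding cnj_sum sum_product by (intro sum.cong refl) (simp add: mult_ac)
    then show ?thesis unfolding complex_norm_square[symmetric] by simp
  qed
  ultimately have "(\<lambda>k. (cmod (\<Sum>i<n. c i * b i k))\<^sup>2) sums Re (\<Sum>i<n. \<Sum>j<n. c i * cnj (c j) * gip (b i) (b j))" by simp
  moreover have "(\<lambda>k. \<Sum>i<n. c i * b i k) \<in> carrier ell2" by (intro ell2_sum ell2_scale b) auto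
  ultimately show ?thesis using ell2_norm_sums sums_unique2 by blast
qed

text \<open>The Hilbert-Schmidt product of two Gram matrices. Expanded along the coordinates of
  \<open>p\<close> it is a sum of squared norms of combinations of the \<open>b i\<close>, so a norm
  inequality for combinations passes to it term by term.\<close>

definition gram_pair :: "nat \<Rightarrow> (nat \<Rightarrow> nat \<Rightarrow> complex) \<Rightarrow> (nat \<Rightarrow> nat \<Rightarrow> complex) \<Rightarrow> real" where
  "gram_pair n b p = Re (\<Sum>i<n. \<Sum>j<n. cnj (gip (p i) (p j)) * gip (b i) (b j))"

lemma gram_pair_sums:
  assumes b: "\<And>i. i < n \<Longrightarrow> b i \<in> carrier ell2" and p: "\<And>i. i < n \<Longrightarrow> p i \<in> carrier ell2"
  shows "(\<lambda>l. (ell2_norm (\<lambda>k. \<Sum>i<n. cnj (p i l) * b i k))\<^sup>2) sums gram_pair n b p"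
proof -
  have "(\<lambda>l. Re (\<Sum>i<n. \<Sum>j<n. cnj (p i l) * cnj (cnj (p j l)) * gip (b i) (b j))) sums gram_pair n b p"
    unfolding gram_pair_def
  proof (intro sums_Re sums_sum sums_mult2)
    fix i j assume "i \<in> {..<n}" "j \<in> {..<n}"
    then have "(\<lambda>l. p i l * cnj (p j l)) sums gip (p i) (p j)" by (intro gip_sums p) auto
    then have "(\<lambda>l. cnj (p i l * cnj (p j l))) sums cnj (gip (p i) (p j))" by (simp only: sums_cnj)
    then show "(\<lambda>l. cnj (p i l) * cnj (cnj (p j l))) sums cnj (gip (p i) (p j))" by simp
  qed
  then show ?thesis using b by (simp only: ell2_norm_combination)
qed

lemma gram_pair_sym:
  assumes "\<And>i. i < n \<Longrightarrow> b i \<in> carrier ell2" "\<And>i. i < n \<Longrightarrow> p i \<in> carrier ell2"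
  shows "gram_pair n b p = gram_pair n p b"
proof -
  have "gram_pair n b p = Re (cnj (\<Sum>i<n. \<Sum>j<n. cnj (gip (p i) (p j)) * gip (b i) (b j)))" by (simp add: gram_pair_def)
  also have "cnj (\<Sum>i<n. \<Sum>j<n. cnj (gip (p i) (p j)) * gip (b i) (b j)) = (\<Sum>i<n. \<Sum>j<n. cnj (gip (b i) (b j)) * gip (p i) (p j))"
    by (simp add: mult.commute)
  finally show ?thesis by (simp add: gram_pair_def)
qed

abbreviation gram :: "(nat \<Rightarrow> nat \<Rightarrow> complex) \<Rightarrow> nat \<Rightarrow> nat \<Rightarrow> complex" where
  "gram b \<equiv> \<lambda>i j. gip (b i) (b j)"

lemma gram_pair_self: "gram_pair n b b = hsn n (gram b)"
proof -
  have "(\<Sum>i<n. \<Sum>j<n. cnj (gip (b i) (b j)) * gip (b i) (b j)) = of_real (hsn n (gram b))"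
    unfolding hsn_def by (simp add: complex_norm_square mult.commute del: of_real_power)
  then show ?thesis by (simp add: gram_pair_def)
qed

text \<open>The two factors \<open>B\<^sup>2\<close> are gained one after the other, through the mixed pairing of both Gram
  matrices.\<close>

lemma gram_contraction:
  assumes a: "\<And>i. i < n \<Longrightarrow> a i \<in> carrier ell2" and b: "\<And>i. i < n \<Longrightarrow> b i \<in> carrier ell2"
    and le: "\<And>c. ell2_norm (\<lambda>k. \<Sum>i<n. c i * b i k) \<le> B * ell2_norm (\<lambda>k. \<Sum>i<n. c i * a i k)"
  shows "hsn n (gram b) \<le> B^4 * hsn n (gram a)"
proof -
  have nn: "0 \<le> ell2_norm (\<lambda>k. \<Sum>i<n. c i * b i k)" for c by (intro ell2_norm_nonneg ell2_sum ell2_scale b) auto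
  have le2: "(ell2_norm (\<lambda>k. \<Sum>i<n. c i * b i k))\<^sup>2 \<le> B\<^sup>2 * (ell2_norm (\<lambda>k. \<Sum>i<n. c i * a i k))\<^sup>2" for c
    using power_mono[OF le nn, of c 2] by (simp add: power_mult_distrib)
  have step: "gram_pair n b p \<le> B\<^sup>2 * gram_pair n a p" if p: "\<And>i. i < n \<Longrightarrow> p i \<in> carrier ell2" for p
    by (rule sums_le[OF le2 gram_pair_sums[OF b p] sums_mult[OF gram_pair_sums[OF a p]]]) 
  have "gram_pair n b b \<le> B\<^sup>2 * gram_pair n a b" by (rule step[OF b])
  also have "gram_pair n a b = gram_pair n b a" by (rule gram_pair_sym[OF a b])
  also have "B\<^sup>2 * gram_pair n b a \<le> B\<^sup>2 * (B\<^sup>2 * gram_pair n a a)" by (intro mult_left_mono step a) auto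
  finally show ?thesis unfolding gram_pair_self by (simp add: power2_eq_square power4_eq_xxxx mult.assoc)
qed

text \<open>A row over the space, padded with zero rows because matrix norms are defined for square
  matrices.\<close>

definition row_mat :: "nat \<Rightarrow> (nat \<Rightarrow> nat \<Rightarrow> complex) \<Rightarrow> (nat \<Rightarrow> complex) mat" where
  "row_mat n a = Matrix.mat n n (\<lambda>(i, j). if i = 0 then a j else (\<lambda>_. 0))"

lemma row_mat_carrier [simp]: "row_mat n a \<in> carrier_mat n n"
  by (simp add: row_mat_def)

lemma row_mat_index [simp]: "i < n \<Longrightarrow> j < n \<Longrightarrow> row_mat n a $$ (i, j) = (if i = 0 then a j else (\<lambda>_. 0))"
  by (simp add: row_mat_def)

lemma row_mat_Mats:
  assumes "carrier X = carrier ell2" "\<And>j. j < n \<Longrightarrow> a j \<in> carrier ell2" shows "row_mat n a \<in> Mats n X"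
  unfolding Mats_iff[OF assms(1)] using assms(2) by (auto simp: ell2_zero)

lemma sum_corner: "n \<ge> 1 \<Longrightarrow> (\<Sum>i<n. \<Sum>b<n. if i = 0 \<and> b = 0 then t else 0) = (t :: real)" for n :: nat
proof -
  assume n: "n \<ge> 1"
  have "(\<Sum>i<n. \<Sum>b<n. if i = 0 \<and> b = 0 then t else 0) = (\<Sum>i<n. \<Sum>b<n. if b = 0 then (if i = 0 then t else 0) else 0)"
    by (intro sum.cong refl) auto
  then show ?thesis using n by (simp add: sum.delta)
qed

text \<open>For a row the image of \<open>cpmap\<close> has a single nonzero entry, the linear
  functional \<open>?T\<close> with the Gram matrix as coefficients. Its norm on Hilbert-Schmidt
  matrices is that of the Gram matrix, attained at the conjugate Gram matrix.\<close>

lemma OH_mnorm_row_mat: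
  assumes n: "n \<ge> 1" and a: "\<And>j. j < n \<Longrightarrow> a j \<in> carrier ell2"
  shows "(OH_mnorm (row_mat n a))\<^sup>2 = sqrt (hsn n (gram a))"
proof -
  let ?T = "\<lambda>X. \<Sum>j<n. \<Sum>b<n. gip (a j) (a b) * X j b"
  have cp: "cpmap n (coords (row_mat n a)) X i b = (if i = 0 \<and> b = 0 then ?T X else 0)" if "i < n" "b < n" for i b X
    unfolding cpmap_def using that by (auto simp: gip_def)
  have hs: "hsn n (cpmap n (coords (row_mat n a)) X) = (cmod (?T X))\<^sup>2" for X
  proof -
    have "hsn n (cpmap n (coords (row_mat n a)) X) = (\<Sum>i<n. \<Sum>b<n. if i = 0 \<and> b = 0 then (cmod (?T X))\<^sup>2 else 0)"
      unfolding hsn_def by (intro sum.cong refl) (simp add: cp)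
    then show ?thesis by (simp add: sum_corner[OF n])
  qed
  have T_le: "cmod (?T X) \<le> sqrt (hsn n (gram a)) * sqrt (hsn n X)" for X
    using hsprod_le[of n "gram a" "\<lambda>i j. cnj (X i j)"] by (simp add: hsprod_def hsn_def)
  have c: "(sqrt (sqrt (hsn n (gram a))))\<^sup>2 = sqrt (hsn n (gram a))" by simp
  have "OH_mnorm (row_mat n a) \<le> sqrt (sqrt (hsn n (gram a)))"
    by (rule OH_mnorm_le[OF row_mat_carrier]) (simp_all add: hs T_le)
  then have "(OH_mnorm (row_mat n a))\<^sup>2 \<le> sqrt (hsn n (gram a))"
    using power_mono[OF _ OH_mnorm_nonneg, of "row_mat n a" _ 2] c by metis
  moreover have "sqrt (hsn n (gram a)) \<le> (OH_mnorm (row_mat n a))\<^sup>2"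
  proof (cases "hsn n (gram a) = 0")
    case False
    then have pos: "sqrt (hsn n (gram a)) > 0" using hsn_nonneg[of n "gram a"] by (simp add: less_le)
    let ?X = "\<lambda>i j. cnj (gip (a i) (a j))"
    have "?T ?X = of_real (hsn n (gram a))"
      unfolding hsn_def by (simp add: complex_norm_square del: of_real_power)
    then have "sqrt (hsn n (cpmap n (coords (row_mat n a)) ?X)) = hsn n (gram a)" unfolding hs by simp
    moreover have "hsn n ?X = hsn n (gram a)" by (simp add: hsn_def)
    ultimately have "hsn n (gram a) \<le> (OH_mnorm (row_mat n a))\<^sup>2 * sqrt (hsn n (gram a))"
      using OH_mnorm_cpmap[OF row_mat_carrier[of n a], of ?X] by simp
    then have "sqrt (hsn n (gram a)) * sqrt (hsn n (gram a)) \<le> (OH_mnorm (row_mat n a))\<^sup>2 * sqrt (hsn n (gram a))" by simp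
    then show ?thesis by (rule mult_right_le_imp_le[OF _ pos])
  qed simp
  ultimately show ?thesis by (rule antisym)
qed

lemma mat_1_1_row: "Matrix.mat 1 1 (\<lambda>_. v) = row_mat 1 (\<lambda>_. v)"
  by (intro eq_matI) (auto simp: row_mat_def)

lemma OH_mnorm_1: "v \<in> carrier ell2 \<Longrightarrow> OH_mnorm (row_mat 1 (\<lambda>_. v)) = ell2_norm v"
proof -
  assume v: "v \<in> carrier ell2"
  have "hsn 1 (gram (\<lambda>_. v)) = ((ell2_norm v)\<^sup>2)\<^sup>2" using v by (simp add: hsn_def gip_self norm_power)
  moreover have "(OH_mnorm (row_mat 1 (\<lambda>_. v)))\<^sup>2 = sqrt (hsn 1 (gram (\<lambda>_. v)))"
    using v by (intro OH_mnorm_row_mat) auto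
  ultimately have "(OH_mnorm (row_mat 1 (\<lambda>_. v)))\<^sup>2 = (ell2_norm v)\<^sup>2"
    by (simp only: real_sqrt_abs) simp
  then show ?thesis using ell2_norm_nonneg[OF v] by (simp add: power2_eq_iff_nonneg)
qed

lemma map_row_mat: "f (\<lambda>_. 0) = (\<lambda>_. 0) \<Longrightarrow> map_mat f (row_mat n a) = row_mat n (\<lambda>j. f (a j))"
  by (intro eq_matI) (auto simp: row_mat_def)

section \<open>The first matrix level: norm equivalence, metric and closedness\<close>

definition dnorm :: "(nat \<Rightarrow> complex) \<Rightarrow> real" where "dnorm v = derived_mnorm (row_mat 1 (\<lambda>_. v))"

lemma base_norm_derived: "base_norm derived_space v = dnorm v"
  by (simp add: base_norm_def mat_1_1_row dnorm_def del: One_nat_def)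

lemma dnorm_odds: "x \<in> carrier ell2 \<Longrightarrow> ell2_norm (odds x) \<le> dnorm x"
  using OH_mnorm_odds_le[of "row_mat 1 (\<lambda>_. x)" 1]
  by (simp add: row_mat_Mats map_row_mat OH_mnorm_1 odds_in_ell2 dnorm_def del: One_nat_def)

lemma dnorm_evens: "y \<in> carrier ell2 \<Longrightarrow> dnorm (interleave y (\<lambda>_. 0)) = ell2_norm y"
proof -
  assume y: "y \<in> carrier ell2"
  have "dnorm (interleave y (\<lambda>_. 0)) = OH_mnorm (map_mat evens (row_mat 1 (\<lambda>_. interleave y (\<lambda>_. 0))))"
    unfolding dnorm_def using y
    by (intro derived_mnorm_evens[of _ 1] row_mat_Mats) (auto simp: interleave_in_ell2 ell2_zero)
  then show ?thesis using y by (simp add: map_row_mat OH_mnorm_1 del: One_nat_def)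
qed

text \<open>A constant function has derivative 0, and at level one its row and column norms are both
  the norm of \<open>ell2\<close>.\<close>

lemma dnorm_odd_part: "z \<in> carrier ell2 \<Longrightarrow> dnorm (interleave (\<lambda>_. 0) z) \<le> ell2_norm z"
proof -
  assume z: "z \<in> carrier ell2"
  have "adm 1 (\<lambda>k i j s. z k) (sqrt (\<Sum>i<(1::nat). \<Sum>j<(1::nat). \<Sum>k. (cmod (z k))\<^sup>2))"
    using z by (intro adm_const) (simp add: in_ell2_iff)
  then have "represents 1 (row_mat 1 (\<lambda>_. interleave (\<lambda>_. 0) z)) (\<lambda>k i j s. z k) (ell2_norm z)"
    by (simp add: represents_def ell2_norm_def)
  then show ?thesis unfolding dnorm_def by (rule derived_mnorm_le) simp
qed

interpretation derived: operator_space derived_space by (rule derived_operator_space)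

lemma dnorm_nonneg: "x \<in> carrier ell2 \<Longrightarrow> dnorm x \<ge> 0"
  unfolding dnorm_def by (intro derived_mnorm_nonneg[of _ 1] row_mat_Mats) auto

lemma dnorm_add:
  assumes "x \<in> carrier ell2" "y \<in> carrier ell2" shows "dnorm (\<lambda>k. x k + y k) \<le> dnorm x + dnorm y"
proof -
  have "mat_add derived_space (row_mat 1 (\<lambda>_. x)) (row_mat 1 (\<lambda>_. y)) = row_mat 1 (\<lambda>_ k. x k + y k)"
    using assms by (intro eq_matI) (auto simp: mat_add_def row_mat_def)
  then show ?thesis
    using derived.mnorm_triangle[of 1 "row_mat 1 (\<lambda>_. x)" "row_mat 1 (\<lambda>_. y)"] assms
    by (simp add: dnorm_def row_mat_Mats)
qed

lemma dnorm_scale: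
  assumes "x \<in> carrier ell2" shows "dnorm (\<lambda>k. c * x k) = cmod c * dnorm x"
  using derived.mnorm_scale[of 1 "row_mat 1 (\<lambda>_. x)" c] assms
  by (simp add: dnorm_def row_mat_Mats map_row_mat derived_space_simps(4)[abs_def])

lemma dnorm_eq_0: "x \<in> carrier ell2 \<Longrightarrow> dnorm x = 0 \<longleftrightarrow> x = (\<lambda>_. 0)"
proof -
  assume x: "x \<in> carrier ell2"
  have "dnorm x = 0 \<longleftrightarrow> row_mat 1 (\<lambda>_. x) = mat_zero derived_space 1 1"
    using derived.mnorm_eq_0_iff[of 1 "row_mat 1 (\<lambda>_. x)"] x by (simp add: dnorm_def row_mat_Mats)
  also have "\<dots> \<longleftrightarrow> x = (\<lambda>_. 0)"
  proof
    assume "row_mat 1 (\<lambda>_. x) = mat_zero derived_space 1 1"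
    then have "row_mat 1 (\<lambda>_. x) $$ (0, 0) = mat_zero derived_space 1 1 $$ (0, 0)" by simp
    then show "x = (\<lambda>_. 0)" by (simp add: mat_zero_def)
  qed (auto intro!: eq_matI simp: mat_zero_def row_mat_def)
  finally show ?thesis .
qed

text \<open>The even part is x minus the odd part, whose norm is at most
  \<open>ell2_norm (odds x)\<close>, hence at most \<open>dnorm x\<close>. So on the Banach space
  level the projection onto the kernel has norm at most 2.\<close>

lemma dnorm_even_part:
  assumes x: "x \<in> carrier ell2" shows "dnorm (interleave (evens x) (\<lambda>_. 0)) \<le> 2 * dnorm x"
proof -
  let ?o = "interleave (\<lambda>_. 0) (odds x)"
  have o: "?o \<in> carrier ell2" using x by (intro interleave_in_ell2 ell2_zero odds_in_ell2)
  have "interleave (evens x) (\<lambda>_. 0) = (\<lambda>k. x k + (-1) * ?o k)"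
    by (auto simp: interleave_def evens_def odds_def fun_eq_iff)
  then have "dnorm (interleave (evens x) (\<lambda>_. 0)) \<le> dnorm x + dnorm (\<lambda>k. (-1) * ?o k)"
    using dnorm_add[OF x ell2_scale[OF o, of "-1"]] by simp
  also have "dnorm (\<lambda>k. (-1) * ?o k) = dnorm ?o" unfolding dnorm_scale[OF o] by simp
  also have "dnorm ?o \<le> ell2_norm (odds x)" by (intro dnorm_odd_part odds_in_ell2 x)
  also have "\<dots> \<le> dnorm x" by (rule dnorm_odds[OF x])
  finally show ?thesis by simp
qed

text \<open>The isomorphism is the identity on sequences. The constant 3 is 2 for the even part plus
  1 for the odd part; the constant 2 bounds the norms of the two parts separately.\<close>

lemma derived_banach_isomorphic: "banach_isomorphic derived_space (base_norm derived_space) ell2 ell2_norm"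
  unfolding banach_isomorphic_def bounded_linear_map_def
proof (intro exI[of _ "\<lambda>x. x"] conjI)
  have v: "vectorspace (class_ring :: complex ring) ell2" by (rule ell2_vectorspace) (auto simp: ell2_def)
  have E: "u \<oplus>\<^bsub>ell2\<^esub> v = (\<lambda>k. u k + v k)" "c \<odot>\<^bsub>ell2\<^esub> u = (\<lambda>k. c * u k)" for u v c by (auto simp: ell2_def)
  have inv: "inv_into (carrier derived_space) (\<lambda>x. x) x = x" if "x \<in> carrier ell2" for x
    using that inv_into_f_f[of "\<lambda>x. x" "carrier ell2" x] by simp
  show "bij_betw (\<lambda>x. x) (carrier derived_space) (carrier ell2)" by (simp add: bij_betw_def)
  show "linear_map (class_ring :: complex ring) derived_space ell2 (\<lambda>x. x)"
    using v derived_vectorspace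
    by (auto simp: linear_map_def mod_hom_def mod_hom_axioms_def vectorspace_def module_hom_def E)
  show "linear_map (class_ring :: complex ring) ell2 derived_space (inv_into (carrier derived_space) (\<lambda>x. x))"
    using v derived_vectorspace
    by (auto simp: linear_map_def mod_hom_def mod_hom_axioms_def vectorspace_def module_hom_def E inv ell2_add ell2_scale)
  have le1: "ell2_norm x \<le> dnorm x * 3" if x: "x \<in> carrier ell2" for x
  proof -
    have e: "ell2_norm (evens x) \<le> 2 * dnorm x"
      using dnorm_even_part[OF x] dnorm_evens[OF evens_in_ell2[OF x]] by simp
    have "(ell2_norm x)\<^sup>2 \<le> (ell2_norm (evens x) + ell2_norm (odds x))\<^sup>2"
      unfolding ell2_norm_interleave[OF x] power2_sum using x evens_in_ell2 odds_in_ell2 by simp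
    then have "ell2_norm x \<le> ell2_norm (evens x) + ell2_norm (odds x)"
      by (rule power2_le_imp_le) (simp add: x evens_in_ell2 odds_in_ell2)
    then show ?thesis using e dnorm_odds[OF x] by simp
  qed
  then show "\<exists>K. \<forall>v\<in>carrier derived_space. ell2_norm v \<le> base_norm derived_space v * K"
    by (auto simp: base_norm_derived)
  have le2: "dnorm x \<le> ell2_norm x * 2" if x: "x \<in> carrier ell2" for x
  proof -
    have "x = (\<lambda>k. interleave (evens x) (\<lambda>_. 0) k + interleave (\<lambda>_. 0) (odds x) k)"
      by (auto simp: interleave_def evens_def odds_def fun_eq_iff)
    then have "dnorm x \<le> dnorm (interleave (evens x) (\<lambda>_. 0)) + dnorm (interleave (\<lambda>_. 0) (odds x))"
      using dnorm_add[of "interleave (evens x) (\<lambda>_. 0)" "interleave (\<lambda>_. 0) (odds x)"] x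
      by (simp add: interleave_in_ell2 ell2_zero evens_in_ell2 odds_in_ell2)
    also have "\<dots> \<le> ell2_norm (evens x) + ell2_norm (odds x)"
      using dnorm_evens[OF evens_in_ell2[OF x]] dnorm_odd_part[OF odds_in_ell2[OF x]] by simp
    also have "ell2_norm (evens x) \<le> ell2_norm x"
      by (rule power2_le_imp_le) (use x in \<open>simp_all add: ell2_norm_interleave[OF x]\<close>)
    also have "ell2_norm (odds x) \<le> ell2_norm x"
      by (rule power2_le_imp_le) (use x in \<open>simp_all add: ell2_norm_interleave[OF x]\<close>)
    finally show ?thesis by simp
  qed
  then show "\<exists>K. \<forall>v\<in>carrier ell2. base_norm derived_space (inv_into (carrier derived_space) (\<lambda>x. x) v) \<le> ell2_norm v * K"
    by (auto simp: base_norm_derived inv)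
qed

text \<open>Truncation lets any \<open>v\<close>, inside or outside the carrier, act as a member of
  the carrier, so that an inverse exists for it and is unique.\<close>

lemma derived_a_inv: "\<ominus>\<^bsub>derived_space\<^esub> v = (\<lambda>k. - trunc v k)"
  unfolding a_inv_def m_inv_def
proof (rule the_equality)
  show "(\<lambda>k. - trunc v k) \<in> carrier (add_monoid derived_space) \<and>
    v \<otimes>\<^bsub>add_monoid derived_space\<^esub> (\<lambda>k. - trunc v k) = \<one>\<^bsub>add_monoid derived_space\<^esub> \<and>
    (\<lambda>k. - trunc v k) \<otimes>\<^bsub>add_monoid derived_space\<^esub> v = \<one>\<^bsub>add_monoid derived_space\<^esub>"
    by (simp add: ell2_uminus)
next
  fix y assume "y \<in> carrier (add_monoid derived_space) \<and>
    v \<otimes>\<^bsub>add_monoid derived_space\<^esub> y = \<one>\<^bsub>add_monoid derived_space\<^esub> \<and>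
    y \<otimes>\<^bsub>add_monoid derived_space\<^esub> v = \<one>\<^bsub>add_monoid derived_space\<^esub>"
  then show "y = (\<lambda>k. - trunc v k)" by (auto simp: fun_eq_iff eq_neg_iff_add_eq_0)
qed

lemma derived_a_minus: "u \<ominus>\<^bsub>derived_space\<^esub> v = (\<lambda>k. trunc u k - trunc v k)"
  unfolding a_minus_def derived_a_inv by (simp add: ell2_uminus)

lemma derived_Metric_space:
  "Metric_space (carrier derived_space) (\<lambda>u v. base_norm derived_space (u \<ominus>\<^bsub>derived_space\<^esub> v))"
  unfolding base_norm_derived derived_a_minus
proof
  have d: "(\<lambda>k. trunc u k - trunc v k) \<in> carrier ell2" for u v by (intro ell2_diff trunc_in_ell2)
  fix x y z
  show "0 \<le> dnorm (\<lambda>k. trunc x k - trunc y k)" by (rule dnorm_nonneg[OF d])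
  show "dnorm (\<lambda>k. trunc x k - trunc y k) = dnorm (\<lambda>k. trunc y k - trunc x k)"
    using dnorm_scale[OF d, of "-1" y x] by simp
  show "dnorm (\<lambda>k. trunc x k - trunc z k) \<le> dnorm (\<lambda>k. trunc x k - trunc y k) + dnorm (\<lambda>k. trunc y k - trunc z k)"
    using dnorm_add[OF d d, of x y y z] by simp
  show "dnorm (\<lambda>k. trunc x k - trunc y k) = 0 \<longleftrightarrow> x = y"
    if "x \<in> carrier derived_space" "y \<in> carrier derived_space"
    using dnorm_eq_0[OF d, of x y] that by (auto simp: fun_eq_iff)
qed

text \<open>Since \<open>odds\<close> is contractive, the ball around x of radius
  \<open>ell2_norm (odds x)\<close> misses the kernel.\<close>

lemma odd_free_closed: "closed_subspace odd_free derived_space"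
  unfolding closed_subspace_def
proof
  show "VectorSpace.subspace (class_ring :: complex ring) odd_free derived_space" by (rule odd_free_subspace)
  interpret Metric_space "carrier derived_space" "\<lambda>u v. base_norm derived_space (u \<ominus>\<^bsub>derived_space\<^esub> v)"
    by (rule derived_Metric_space)
  show "closedin mtopology odd_free"
    unfolding closedin_metric
  proof (intro conjI allI impI)
    show "odd_free \<subseteq> carrier derived_space" by (auto simp: odd_free_def)
    fix x assume x: "x \<in> carrier derived_space - odd_free"
    then have xc: "x \<in> carrier ell2" and "odds x \<noteq> (\<lambda>_. 0)" by (auto simp: odd_free_def)
    have pos: "ell2_norm (odds x) > 0"
    proof (rule ccontr)
      assume "\<not> ?thesis"
      then have "ell2_norm (odds x) = 0" using ell2_norm_nonneg[OF odds_in_ell2[OF xc]] by linarith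
      then have "(\<Sum>k. (cmod (odds x k))\<^sup>2) = 0" by (simp add: ell2_norm_def)
      then have "odds x = (\<lambda>_. 0)" using odds_in_ell2[OF xc] unfolding in_ell2_iff
        by (subst (asm) suminf_eq_zero_iff) auto
      then show False using \<open>odds x \<noteq> _\<close> by simp
    qed
    have "y \<notin> mball x (ell2_norm (odds x))" if y: "y \<in> odd_free" for y
    proof -
      have yc: "y \<in> carrier ell2" and oy: "odds y = (\<lambda>_. 0)" using y by (auto simp: odd_free_def)
      have "odds (\<lambda>k. x k - y k) = odds x" using oy by (auto simp: odds_def fun_eq_iff)
      then have "ell2_norm (odds x) \<le> dnorm (\<lambda>k. x k - y k)"
        using dnorm_odds[OF ell2_diff[OF xc yc]] by simp
      then show ?thesis using xc yc unfolding in_mball unfolding base_norm_derived derived_a_minus by simp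
    qed
    then show "\<exists>r>0. disjnt odd_free (mball x r)" using pos by (intro exI[of _ "ell2_norm (odds x)"]) (auto simp: disjnt_def)
  qed
qed

section \<open>The derived space is not completely isomorphic to OH\<close>

lemma OH_mnorm_scale_le:
  assumes x: "x \<in> Mats n OH"
  shows "OH_mnorm (map_mat (\<lambda>v k. c * v k) x) \<le> cmod c * OH_mnorm x"
proof (rule OH_mnorm_le[of _ n])
  have xc: "x \<in> carrier_mat n n" and xe: "\<And>i j. i < n \<Longrightarrow> j < n \<Longrightarrow> x $$ (i, j) \<in> carrier ell2" using x by (auto simp: Mats_OH)
  show "map_mat (\<lambda>v k. c * v k) x \<in> carrier_mat n n" using xc by simp
  show "0 \<le> cmod c * OH_mnorm x" by simp
  fix X
  have g: "(\<Sum>k. coords (map_mat (\<lambda>v k. c * v k) x) k i j * cnj (coords (map_mat (\<lambda>v k. c * v k) x) k b a))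
      = of_real ((cmod c)\<^sup>2) * (\<Sum>k. coords x k i j * cnj (coords x k b a))" if "i < n" "j < n" "b < n" "a < n" for i j b a
  proof -
    have "(\<lambda>k. of_real ((cmod c)\<^sup>2) * (coords x k i j * cnj (coords x k b a))) sums (of_real ((cmod c)\<^sup>2) * gip (x $$ (i, j)) (x $$ (b, a)))"
      using that xe by (intro sums_mult gip_sums) auto
    moreover have "of_real ((cmod c)\<^sup>2) * (coords x k i j * cnj (coords x k b a))
        = coords (map_mat (\<lambda>v k. c * v k) x) k i j * cnj (coords (map_mat (\<lambda>v k. c * v k) x) k b a)" for k
      using that xc unfolding complex_norm_square by simp
    ultimately show ?thesis by (simp add: sums_iff gip_def)
  qed
  have "cpmap n (coords (map_mat (\<lambda>v k. c * v k) x)) X i b = of_real ((cmod c)\<^sup>2) * cpmap n (coords x) X i b" if "i < n" "b < n" for i b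
    unfolding cpmap_def sum_distrib_left using that by (intro sum.cong refl) (simp only: g lessThan_iff mult.assoc)
  then have "hsn n (cpmap n (coords (map_mat (\<lambda>v k. c * v k) x)) X) = hsn n (\<lambda>i b. of_real ((cmod c)\<^sup>2) * cpmap n (coords x) X i b)"
    by (simp add: hsn_def)
  then have "sqrt (hsn n (cpmap n (coords (map_mat (\<lambda>v k. c * v k) x)) X)) = (cmod c)\<^sup>2 * sqrt (hsn n (cpmap n (coords x) X))"
    unfolding hsn_scale by (simp only: norm_of_real abs_power2 real_sqrt_mult real_sqrt_abs)
  also have "\<dots> \<le> (cmod c)\<^sup>2 * ((OH_mnorm x)\<^sup>2 * sqrt (hsn n X))" by (intro mult_left_mono OH_mnorm_cpmap xc) simp
  finally show "sqrt (hsn n (cpmap n (coords (map_mat (\<lambda>v k. c * v k) x)) X)) \<le> (cmod c * OH_mnorm x)\<^sup>2 * sqrt (hsn n X)"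
    by (simp add: power_mult_distrib mult_ac)
qed

lemma OH_mnorm_scale:
  "x \<in> Mats n OH \<Longrightarrow> OH_mnorm (map_mat (\<lambda>v k. c * v k) x) = cmod c * OH_mnorm x"
  using scale_mat_invertible[of n OH OH_mnorm x c, OF OH_mnorm_scale_le] by simp

lemma derived_mnorm_scale:
  "x \<in> Mats n derived_space \<Longrightarrow> derived_mnorm (map_mat (\<lambda>v k. c * v k) x) = cmod c * derived_mnorm x"
  using scale_mat_invertible[of n derived_space derived_mnorm x c, OF derived_mnorm_scale_le] derived_mnorm_nonneg by simp

lemma scale_mat_Mats:
  assumes "carrier X = carrier ell2" "x \<in> Mats n X" shows "map_mat (\<lambda>v k. c * v k) x \<in> Mats n X"
  using assms(2) unfolding Mats_iff[OF assms(1)] by (auto simp: ell2_scale)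

lemma module_hom_ell2:
  assumes T: "linear_map (class_ring :: complex ring) X Z T" and C: "carrier X = carrier ell2" "carrier Z = carrier ell2"
    and X: "\<And>u v c. u \<in> carrier ell2 \<Longrightarrow> v \<in> carrier ell2 \<Longrightarrow> u \<oplus>\<^bsub>X\<^esub> v = (\<lambda>k. u k + v k)" "\<And>c u. c \<odot>\<^bsub>X\<^esub> u = (\<lambda>k. c * u k)"
    and Z: "\<And>u v c. u \<in> carrier ell2 \<Longrightarrow> v \<in> carrier ell2 \<Longrightarrow> u \<oplus>\<^bsub>Z\<^esub> v = (\<lambda>k. u k + v k)" "\<And>c u. c \<odot>\<^bsub>Z\<^esub> u = (\<lambda>k. c * u k)"
  shows "u \<in> carrier ell2 \<Longrightarrow> T u \<in> carrier ell2"
    and "u \<in> carrier ell2 \<Longrightarrow> v \<in> carrier ell2 \<Longrightarrow> T (\<lambda>k. u k + v k) = (\<lambda>k. T u k + T v k)"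
    and "u \<in> carrier ell2 \<Longrightarrow> T (\<lambda>k. c * u k) = (\<lambda>k. c * T u k)"
proof -
  have h: "T \<in> module_hom (class_ring :: complex ring) X Z"
    using T by (simp add: linear_map_def mod_hom_def mod_hom_axioms_def)
  show cl: "T u \<in> carrier ell2" if "u \<in> carrier ell2" for u
    using module_hom_closed[OF h] that C by auto
  show "T (\<lambda>k. u k + v k) = (\<lambda>k. T u k + T v k)" if "u \<in> carrier ell2" "v \<in> carrier ell2"
    using module_hom_add[OF h, of u v] that C cl X Z by simp
  show "T (\<lambda>k. c * u k) = (\<lambda>k. c * T u k)" if "u \<in> carrier ell2"
    using module_hom_smult[OF h, of c u] that C X Z by simp
qed

text \<open>A real constant is extracted from the extended supremum over unit balls. Stating the
  conclusion for any M > 0 above the norm makes scaling by 1 / M possible even if the norm is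
  0.\<close>

lemma completely_bounded_ball:
  fixes X Z :: "(nat \<Rightarrow> complex) opspace"
  assumes cb: "completely_bounded X Z T" and C: "carrier X = carrier ell2" "carrier Z = carrier ell2"
    and T: "\<And>u. u \<in> carrier ell2 \<Longrightarrow> T u \<in> carrier ell2" "\<And>c u. u \<in> carrier ell2 \<Longrightarrow> T (\<lambda>k. c * u k) = (\<lambda>k. c * T u k)"
    and sX: "\<And>n x c. x \<in> Mats n X \<Longrightarrow> mnorm X (map_mat (\<lambda>v k. c * v k) x) = cmod c * mnorm X x"
    and sZ: "\<And>n x c. x \<in> Mats n Z \<Longrightarrow> mnorm Z (map_mat (\<lambda>v k. c * v k) x) = cmod c * mnorm Z x"
  obtains K where "K > 0" "\<And>n x M. n \<ge> 1 \<Longrightarrow> x \<in> Mats n X \<Longrightarrow> M > 0 \<Longrightarrow> mnorm X x \<le> M \<Longrightarrow> mnorm Z (map_mat T x) \<le> K * M"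
proof -
  define S where "S = (SUP n\<in>{1..}. amp_norm X Z T n)"
  have S: "S = ennreal (enn2real S)" using cb by (simp add: S_def completely_bounded_def)
  define K where "K = enn2real S + 1"
  have unit: "mnorm Z (map_mat T x) \<le> K" if "n \<ge> 1" "x \<in> Mats n X" "mnorm X x \<le> 1" for n x
  proof -
    have "ennreal (mnorm Z (map_mat T x)) \<le> amp_norm X Z T n"
      unfolding amp_norm_def using that by (intro SUP_upper) auto
    also have "\<dots> \<le> S" unfolding S_def using that by (intro SUP_upper) auto
    finally have "ennreal (mnorm Z (map_mat T x)) \<le> ennreal (enn2real S)" using S by simp
    then have "mnorm Z (map_mat T x) \<le> enn2real S" by (subst (asm) ennreal_le_iff) auto
    then show ?thesis by (simp add: K_def)
  qed
  have "mnorm Z (map_mat T x) \<le> K * M" if n: "n \<ge> 1" and x: "x \<in> Mats n X" and M: "M > 0" "mnorm X x \<le> M" for n x M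
  proof -
    define c where "c = complex_of_real (1 / M)"
    have nc: "cmod c = 1 / M" using M by (simp add: c_def norm_divide)
    have xe: "x \<in> carrier_mat n n" "\<And>i j. i < n \<Longrightarrow> j < n \<Longrightarrow> x $$ (i, j) \<in> carrier ell2"
      using x unfolding Mats_iff[OF C(1)] by auto
    have "map_mat (\<lambda>v k. c * v k) x \<in> Mats n X"
      by (rule scale_mat_Mats[OF C(1) x])
    moreover have "mnorm X (map_mat (\<lambda>v k. c * v k) x) \<le> 1"
      unfolding sX[OF x] nc using M by (simp add: field_simps)
    ultimately have "mnorm Z (map_mat T (map_mat (\<lambda>v k. c * v k) x)) \<le> K" using unit[OF n] by blast
    moreover have "map_mat T (map_mat (\<lambda>v k. c * v k) x) = map_mat (\<lambda>v k. c * v k) (map_mat T x)"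
      using xe by (intro eq_matI) (auto simp: T(2))
    moreover have "map_mat T x \<in> Mats n Z" unfolding Mats_iff[OF C(2)] using xe by (auto intro: T(1))
    ultimately have "1 / M * mnorm Z (map_mat T x) \<le> K" by (simp add: sZ nc)
    then show ?thesis using M by (simp add: field_simps)
  qed
  moreover have "K > 0" by (simp add: K_def add_nonneg_pos)
  ultimately show thesis using that by blast
qed

definition unit_seq :: "nat \<Rightarrow> nat \<Rightarrow> complex" where "unit_seq j k = (if k = j then 1 else 0)"

lemma unit_seq_in_ell2: "unit_seq j \<in> carrier ell2"
proof -
  have "(\<lambda>k. (cmod (unit_seq j k))\<^sup>2) = (\<lambda>k. if k = j then 1 else 0)" by (auto simp: unit_seq_def)
  then show ?thesis by (simp add: in_ell2_iff)
qed

lemma gip_unit_seq: "gip (unit_seq i) (unit_seq j) = (if i = j then 1 else 0)"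
proof -
  have "(\<lambda>k. unit_seq i k * cnj (unit_seq j k)) = (\<lambda>k. if k = i then (if i = j then 1 else 0) else 0)"
    by (auto simp: unit_seq_def)
  then have "(\<lambda>k. unit_seq i k * cnj (unit_seq j k)) sums (if i = j then 1 else 0)"
    using sums_single[of i "\<lambda>k. if i = j then 1 else 0 :: complex"] by simp
  then show ?thesis by (simp add: gip_def sums_iff)
qed

lemma hsn_gram_unit_seq: "hsn n (gram unit_seq) = real n"
proof -
  have "hsn n (gram unit_seq) = (\<Sum>i<n. \<Sum>j<n. if j = i then 1 else 0)"
    unfolding hsn_def gip_unit_seq by (intro sum.cong refl) auto
  then show ?thesis by simp
qed

lemma sum_if_less_le: "(\<And>k. h k \<ge> 0) \<Longrightarrow> (\<Sum>k<K. if k < n then h k else 0) \<le> (\<Sum>k<n. h k :: real)" for n :: nat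
proof -
  assume h: "\<And>k. h k \<ge> 0"
  have "(\<Sum>k<K. if k < n then h k else 0) = (\<Sum>k\<in>{..<K} \<inter> {k. k < n}. h k)" by (simp add: sum.If_cases)
  also have "\<dots> \<le> (\<Sum>k<n. h k)" by (intro sum_mono2) (auto simp: h)
  finally show ?thesis .
qed

lemma sqn_single: "i0 < n \<Longrightarrow> sqn n (\<lambda>i. if i = i0 then t else 0) = (cmod t)\<^sup>2"
proof -
  assume i0: "i0 < n"
  have "sqn n (\<lambda>i. if i = i0 then t else 0) = (\<Sum>i<n. if i = i0 then (cmod t)\<^sup>2 else 0)"
    unfolding sqn_def by (intro sum.cong refl) auto
  then show ?thesis using i0 by simp
qed

text \<open>The analytic family \<open>n\<^bsup>(s-1/2)/2\<^esup> \<Sum>\<^sub>j e\<^sub>1\<^sub>j \<otimes> e\<^sub>j\<close> has row and column norm \<open>n\<^bsup>1/4\<^esup>\<close> on the respective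
  boundary lines, while its derivative at \<open>1/2\<close> is \<open>ln n / 2\<close> times its value.\<close>

definition twist :: "nat \<Rightarrow> complex" where "twist n = of_real (ln n / 2) / dm_deriv"

lemma derived_mnorm_twisted_row:
  assumes n: "n \<ge> 1"
  shows "derived_mnorm (row_mat n (\<lambda>j. interleave (\<lambda>k. twist n * unit_seq j k) (unit_seq j))) \<le> sqrt (sqrt n)"
proof -
  define g where "g = (\<lambda>s. exp ((s - 1/2) * complex_of_real (ln n / 2)))"
  define f where "f = (\<lambda>k (i::nat) (j::nat) s. if i = 0 \<and> j = k then g s else 0)"
  have n0: "0 < n" "real n > 0" using n by auto
  have ng: "(cmod (g s))\<^sup>2 = exp ((Re s - 1/2) * ln n)" for s
    by (simp add: g_def exp_double[symmetric])
  have half: "exp (1/2 * ln (real n)) = sqrt n" using n0 by (simp add: ln_sqrt[symmetric] del: ln_sqrt)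
  \<comment> \<open>Before multiplication by \<open>g\<close> the row of unit vectors has column
    norm 1 and row norm \<open>sqrt n\<close>. The modulus of \<open>g\<close> is the fourth root of
    n on the right line and its inverse on the left, so the exponent \<open>ln n / 2\<close>
    balances the two lines.\<close>
  have g1: "(cmod (g s))\<^sup>2 = sqrt n" if "Re s = 1" for s unfolding ng using that half by simp
  have g0: "(cmod (g s))\<^sup>2 = 1 / sqrt n" if "Re s = 0" for s
    unfolding ng using that half by (simp add: exp_minus field_simps)
  have col: "col_bound n (\<lambda>k i j. f k i j s) (sqrt (sqrt n))" if s: "Re s = 1" for s
    unfolding col_bound_def
  proof (intro allI)
    fix K v
    have "(\<lambda>i. \<Sum>j<n. f k i j s * v j) = (\<lambda>i. if i = 0 then (if k < n then g s * v k else 0) else 0)" for k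
    proof
      fix i
      have "(\<Sum>j<n. f k i j s * v j) = (\<Sum>j<n. if j = k then (if i = 0 then g s * v k else 0) else 0)"
        by (intro sum.cong refl) (auto simp: f_def)
      then show "(\<Sum>j<n. f k i j s * v j) = (if i = 0 then (if k < n then g s * v k else 0) else 0)" by simp
    qed
    then have "(\<Sum>k<K. sqn n (\<lambda>i. \<Sum>j<n. f k i j s * v j)) = (\<Sum>k<K. if k < n then (cmod (g s * v k))\<^sup>2 else 0)"
      using n0 by (simp add: sqn_single if_distrib[of cmod] if_distrib[of "\<lambda>t. t\<^sup>2"] cong: if_cong)
    also have "\<dots> \<le> (\<Sum>k<n. (cmod (g s * v k))\<^sup>2)" by (rule sum_if_less_le) simp
    also have "\<dots> = (sqrt (sqrt n))\<^sup>2 * sqn n v"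
      by (simp add: norm_mult power_mult_distrib g1[OF s] sqn_def sum_distrib_left)
    finally show "(\<Sum>k<K. sqn n (\<lambda>i. \<Sum>j<n. f k i j s * v j)) \<le> (sqrt (sqrt n))\<^sup>2 * sqn n v" .
  qed
  have row: "row_bound n (\<lambda>k i j. f k i j s) (sqrt (sqrt n))" if s: "Re s = 0" for s
    unfolding row_bound_def col_bound_def
  proof (intro allI)
    fix K v
    have "sqn n (\<lambda>i. \<Sum>j<n. f k j i s * v j) = (if k < n then (cmod (g s * v 0))\<^sup>2 else 0)" for k
    proof -
      have "(\<Sum>j<n. f k j i s * v j) = (\<Sum>j<n. if j = 0 then (if i = k then g s * v 0 else 0) else 0)" for i
        by (intro sum.cong refl) (auto simp: f_def)
      then have e: "(\<lambda>i. \<Sum>j<n. f k j i s * v j) = (\<lambda>i. if i = k then g s * v 0 else 0)" using n0 by simp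
      show ?thesis
      proof (cases "k < n")
        case True
        then show ?thesis unfolding e by (simp add: sqn_single)
      next
        case False
        then show ?thesis unfolding e by (simp add: sqn_def)
      qed
    qed
    then have "(\<Sum>k<K. sqn n (\<lambda>i. \<Sum>j<n. f k j i s * v j)) = (\<Sum>k<K. if k < n then (cmod (g s * v 0))\<^sup>2 else 0)" by simp
    also have "\<dots> \<le> (\<Sum>k<n. (cmod (g s * v 0))\<^sup>2)" by (rule sum_if_less_le) simp
    also have "\<dots> = real n / sqrt n * (cmod (v 0))\<^sup>2"
      by (simp add: norm_mult power_mult_distrib g0[OF s])
    also have "\<dots> = (sqrt (sqrt n))\<^sup>2 * (cmod (v 0))\<^sup>2" using n0 by (simp add: real_div_sqrt)
    also have "\<dots> \<le> (sqrt (sqrt n))\<^sup>2 * sqn n v"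
      unfolding sqn_def using n0 by (intro mult_left_mono member_le_sum) auto
    finally show "(\<Sum>k<K. sqn n (\<lambda>i. \<Sum>j<n. f k j i s * v j)) \<le> (sqrt (sqrt n))\<^sup>2 * sqn n v" .
  qed
  have sg: "strip_fun g" unfolding g_def by (rule strip_fun_exp_affine)
  have "strip_fun (f k i j)" for k i j
    unfolding f_def using sg by (cases "i = 0 \<and> j = k") auto
  then have adm: "adm n f (sqrt (sqrt n))" using row col by (simp add: adm_def)
  have dg: "(g has_field_derivative of_real (ln n / 2)) (at (1/2))"
    unfolding g_def by (auto intro!: derivative_eq_intros)
  have gh: "g (1/2) = 1" by (simp add: g_def)
  have "represents n (row_mat n (\<lambda>j. interleave (\<lambda>k. twist n * unit_seq j k) (unit_seq j))) f (sqrt (sqrt n))"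
    unfolding represents_def
  proof (intro conjI allI impI adm)
    fix k i j assume ij: "i < n" "j < n"
    let ?x = "row_mat n (\<lambda>j. interleave (\<lambda>k. twist n * unit_seq j k) (unit_seq j)) $$ (i, j)"
    show "f k i j (1/2) = odds ?x k" using ij by (auto simp: f_def gh unit_seq_def)
    have e: "dm_deriv * evens ?x k = (if i = 0 \<and> j = k then of_real (ln n / 2) else 0)"
      using ij by (auto simp: unit_seq_def twist_def)
    show "(f k i j has_field_derivative dm_deriv * evens ?x k) (at (1/2))"
      unfolding e f_def using dg by (cases "i = 0"; cases "j = k") simp_all
  qed
  then show ?thesis by (rule derived_mnorm_le) simp
qed

text \<open>On a space completely isomorphic to \<open>OH\<close> every bounded operator would act boundedly on rows. The
  projection onto the even coordinates does not.\<close>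

theorem derived_not_isomorphic: "\<not> completely_isomorphic derived_space OH"
proof
  assume "completely_isomorphic derived_space OH"
  then obtain T where bij: "bij_betw T (carrier ell2) (carrier ell2)" and cbT: "completely_bounded derived_space OH T"
    and cbU: "completely_bounded OH derived_space (inv_into (carrier ell2) T)"
    by (auto simp: completely_isomorphic_def complete_isomorphism_def)
  define U where "U = inv_into (carrier ell2) T"
  have cbU: "completely_bounded OH derived_space U" using cbU by (simp add: U_def)
  have UT: "U (T x) = x" if "x \<in> carrier ell2" for x
    using bij that unfolding U_def by (simp add: bij_betw_inv_into_left)
  have lT: "linear_map (class_ring :: complex ring) derived_space OH T" using cbT by (simp add: completely_bounded_def)
  have lU: "linear_map (class_ring :: complex ring) OH derived_space U" using cbU by (simp add: completely_bounded_def)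
  have T: "\<And>u. u \<in> carrier ell2 \<Longrightarrow> T u \<in> carrier ell2"
    "\<And>u v. u \<in> carrier ell2 \<Longrightarrow> v \<in> carrier ell2 \<Longrightarrow> T (\<lambda>k. u k + v k) = (\<lambda>k. T u k + T v k)"
    "\<And>c u. u \<in> carrier ell2 \<Longrightarrow> T (\<lambda>k. c * u k) = (\<lambda>k. c * T u k)"
    by (rule module_hom_ell2[OF lT], simp_all)+
  have U: "\<And>u. u \<in> carrier ell2 \<Longrightarrow> U u \<in> carrier ell2"
    "\<And>u v. u \<in> carrier ell2 \<Longrightarrow> v \<in> carrier ell2 \<Longrightarrow> U (\<lambda>k. u k + v k) = (\<lambda>k. U u k + U v k)"
    "\<And>c u. u \<in> carrier ell2 \<Longrightarrow> U (\<lambda>k. c * u k) = (\<lambda>k. c * U u k)"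
    by (rule module_hom_ell2[OF lU], simp_all)+
  obtain A where A: "A > 0" "\<And>n x M. n \<ge> 1 \<Longrightarrow> x \<in> Mats n derived_space \<Longrightarrow> M > 0 \<Longrightarrow> derived_mnorm x \<le> M \<Longrightarrow> OH_mnorm (map_mat T x) \<le> A * M"
    using completely_bounded_ball[OF cbT _ _ T(1,3)] by (auto simp: derived_mnorm_scale OH_mnorm_scale)
  obtain B where B: "B > 0" "\<And>n x M. n \<ge> 1 \<Longrightarrow> x \<in> Mats n OH \<Longrightarrow> M > 0 \<Longrightarrow> OH_mnorm x \<le> M \<Longrightarrow> derived_mnorm (map_mat U x) \<le> B * M"
    using completely_bounded_ball[OF cbU _ _ U(1,3)] by (auto simp: derived_mnorm_scale OH_mnorm_scale)
  have zero: "T (\<lambda>_. 0) = (\<lambda>_. 0)" "U (\<lambda>_. 0) = (\<lambda>_. 0)"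
    using T(3)[OF ell2_zero, of 0] U(3)[OF ell2_zero, of 0] by simp_all
  define P where "P = (\<lambda>x. interleave (evens x) (\<lambda>_. 0 :: complex))"
  have P: "P x \<in> carrier ell2" if "x \<in> carrier ell2" for x
    unfolding P_def using that by (intro interleave_in_ell2 evens_in_ell2 ell2_zero)
  have P_lin: "P (\<lambda>k. u k + v k) = (\<lambda>k. P u k + P v k)" "P (\<lambda>k. c * u k) = (\<lambda>k. c * P u k)" for u v c
    by (auto simp: P_def interleave_def evens_def fun_eq_iff)
  \<comment> \<open>The projection transported to \<open>OH\<close>. Its bound \<open>D\<close> on
    the first level, made of \<open>A\<close>, \<open>B\<close> and the norm 2 of \<open>P\<close>,
    carries over to rows through Gram matrices.\<close>
  define S where "S = (\<lambda>a. T (P (U a)))"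
  have S: "S a \<in> carrier ell2" if "a \<in> carrier ell2" for a unfolding S_def by (intro T(1) P U(1) that)
  have S_add: "S (\<lambda>k. u k + v k) = (\<lambda>k. S u k + S v k)" if "u \<in> carrier ell2" "v \<in> carrier ell2" for u v
    unfolding S_def using that by (simp add: U P_lin T P)
  have S_scale: "S (\<lambda>k. c * u k) = (\<lambda>k. c * S u k)" if "u \<in> carrier ell2" for u c
    unfolding S_def using that by (simp add: U P_lin T P)
  define D where "D = A * (2 * B)"
  have D: "D > 0" using A B by (simp add: D_def)
  have S_M: "ell2_norm (S a) \<le> D * M" if a: "a \<in> carrier ell2" and M: "M > 0" "ell2_norm a \<le> M" for a M
  proof -
    have "derived_mnorm (map_mat U (row_mat 1 (\<lambda>_. a))) \<le> B * M"
      by (rule B(2)[of 1]) (use a M in \<open>simp_all add: OH_mnorm_1 row_mat_Mats del: One_nat_def\<close>)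
    then have "dnorm (U a) \<le> B * M" by (simp add: map_row_mat zero dnorm_def)
    then have "dnorm (P (U a)) \<le> 2 * B * M" using dnorm_even_part[OF U(1)[OF a]] by (simp add: P_def)
    then have "OH_mnorm (map_mat T (row_mat 1 (\<lambda>_. P (U a)))) \<le> A * (2 * B * M)"
      using a M B(1) by (intro A(2)) (auto simp: dnorm_def intro!: row_mat_Mats P U(1))
    then have "OH_mnorm (row_mat 1 (\<lambda>_. S a)) \<le> A * (2 * B * M)" by (simp add: map_row_mat zero S_def)
    then show ?thesis using S[OF a] by (simp add: OH_mnorm_1 D_def mult.assoc del: One_nat_def)
  qed
  have S_le: "ell2_norm (S a) \<le> D * ell2_norm a" if a: "a \<in> carrier ell2" for a
  proof (rule field_le_epsilon)
    fix e :: real assume e: "e > 0"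
    have "ell2_norm (S a) \<le> D * (ell2_norm a + e / D)"
      using e D ell2_norm_nonneg[OF a] by (intro S_M[OF a]) (auto intro: add_nonneg_pos)
    then show "ell2_norm (S a) \<le> D * ell2_norm a + e" using D by (simp add: distrib_left)
  qed
  have S_comb: "S (\<lambda>k. \<Sum>i<n. c i * a i k) = (\<lambda>k. \<Sum>i<n. c i * S (a i) k)" if "\<And>i. i < n \<Longrightarrow> a i \<in> carrier ell2" for n :: nat and c a
    using that
  proof (induction n)
    case 0
    then show ?case using S_scale[OF ell2_zero, of 0] by simp
  next
    case (Suc n)
    have "(\<lambda>k. \<Sum>i<n. c i * a i k) \<in> carrier ell2" "(\<lambda>k. c n * a n k) \<in> carrier ell2"
      using Suc.prems by (auto intro!: ell2_sum ell2_scale)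
    then show ?case using Suc by (simp add: S_add S_scale)
  qed
  have bound: "ln n \<le> D * A * B * pi" if n: "n \<ge> 2" for n :: nat
  proof -
    \<comment> \<open>The fourth root of n bounds the twisted row in \<open>derived_space\<close>
      and is also the \<open>OH\<close> norm of the row of unit vectors; hence it cancels at the
      end.\<close>
    define q where "q = sqrt (sqrt n)"
    have q: "q > 0" using n by (simp add: q_def)
    have q4: "q^4 = n" by (simp add: q_def power4_eq_xxxx) (metis of_nat_0_le_iff power2_eq_square real_sqrt_pow2 real_sqrt_ge_0_iff mult.assoc)
    define w where "w = (\<lambda>j. interleave (\<lambda>k. twist n * unit_seq j k) (unit_seq j))"
    define u where "u = (\<lambda>j. interleave (unit_seq j) (\<lambda>_. 0))"
    have w: "w j \<in> carrier ell2" and u: "u j \<in> carrier ell2" for j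
      unfolding w_def u_def by (intro interleave_in_ell2 ell2_scale unit_seq_in_ell2 ell2_zero)+
    have tw: "cmod (twist n) = ln n / pi" "twist n \<noteq> 0"
    proof -
      have ln: "ln (real n) > 0" using n by simp
      show "cmod (twist n) = ln n / pi" using ln by (simp add: twist_def dm_deriv_def norm_divide norm_mult)
      then show "twist n \<noteq> 0" using ln by auto
    qed
    have "OH_mnorm (map_mat T (row_mat n w)) \<le> A * q"
    proof (rule A(2)[of n])
      show "derived_mnorm (row_mat n w) \<le> q" using derived_mnorm_twisted_row[of n] n by (simp add: w_def q_def)
      show "row_mat n w \<in> Mats n derived_space" by (rule row_mat_Mats) (simp_all add: w)
    qed (use n q in auto)
    then have "OH_mnorm (row_mat n (\<lambda>j. T (w j))) \<le> A * q" by (simp add: map_row_mat zero)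
    then have "(OH_mnorm (row_mat n (\<lambda>j. T (w j))))\<^sup>2 \<le> (A * q)\<^sup>2" by (intro power_mono) auto
    then have "sqrt (hsn n (gram (\<lambda>j. T (w j)))) \<le> (A * q)\<^sup>2"
      using n T(1)[OF w] by (subst (asm) OH_mnorm_row_mat) auto
    then have hw: "hsn n (gram (\<lambda>j. T (w j))) \<le> (A * q)^4"
      using sqrt_le_D by fastforce
    \<comment> \<open>\<open>P\<close> removes the odd part of \<open>w j\<close> and leaves
      \<open>twist n\<close> times the kernel element \<open>u j\<close>, so a factor of size ln n
      is split off.\<close>
    have Sw: "S (T (w j)) = (\<lambda>k. twist n * T (u j) k)" for j
    proof -
      have "P (w j) = (\<lambda>k. twist n * u j k)" by (auto simp: P_def w_def u_def interleave_def fun_eq_iff)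
      then show ?thesis by (simp add: S_def UT w T(3)[OF u])
    qed
    have "hsn n (gram (\<lambda>j. S (T (w j)))) \<le> D^4 * hsn n (gram (\<lambda>j. T (w j)))"
    proof (rule gram_contraction)
      show "T (w i) \<in> carrier ell2" "S (T (w i)) \<in> carrier ell2" for i by (intro S T(1) w)+
      fix c
      have "(\<lambda>k. \<Sum>i<n. c i * T (w i) k) \<in> carrier ell2" by (intro ell2_sum ell2_scale T(1) w)
      from S_le[OF this] show "ell2_norm (\<lambda>k. \<Sum>i<n. c i * S (T (w i)) k) \<le> D * ell2_norm (\<lambda>k. \<Sum>i<n. c i * T (w i) k)"
        by (simp add: S_comb T(1) w)
    qed
    also have "\<dots> \<le> D^4 * (A * q)^4" by (intro mult_left_mono hw) simp
    finally have hS: "hsn n (gram (\<lambda>j. S (T (w j)))) \<le> ((D * A * q)\<^sup>2)\<^sup>2"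
      by (simp add: power_mult_distrib mult_ac)
    have "(OH_mnorm (row_mat n (\<lambda>j. S (T (w j)))))\<^sup>2 \<le> (D * A * q)\<^sup>2"
      using n S[OF T(1)[OF w]] hS by (subst OH_mnorm_row_mat) (auto intro: real_le_lsqrt)
    then have OS: "OH_mnorm (row_mat n (\<lambda>j. S (T (w j)))) \<le> D * A * q"
      by (rule power2_le_imp_le) (use D A q in auto)
    have "row_mat n (\<lambda>j. S (T (w j))) = map_mat (\<lambda>v k. twist n * v k) (row_mat n (\<lambda>j. T (u j)))"
      by (simp add: map_row_mat Sw)
    then have "cmod (twist n) * OH_mnorm (row_mat n (\<lambda>j. T (u j))) \<le> D * A * q"
      using OS OH_mnorm_scale[OF row_mat_Mats[OF OH_simps(1), of n "\<lambda>j. T (u j)"], of "twist n"] T(1)[OF u] by simp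
    then have Tu: "OH_mnorm (row_mat n (\<lambda>j. T (u j))) \<le> D * A * q / cmod (twist n)"
      using tw(2) by (simp add: pos_le_divide_eq mult.commute)
    have "derived_mnorm (map_mat U (row_mat n (\<lambda>j. T (u j)))) \<le> B * (D * A * q / cmod (twist n))"
    proof (rule B(2)[of n])
      show "row_mat n (\<lambda>j. T (u j)) \<in> Mats n OH" by (rule row_mat_Mats) (simp_all add: T(1) u)
      show "0 < D * A * q / cmod (twist n)" using D A(1) q tw(2) by simp
    qed (use n Tu in auto)
    then have le: "derived_mnorm (row_mat n u) \<le> B * (D * A * q / cmod (twist n))"
      by (simp add: map_row_mat zero UT u)
    \<comment> \<open>The row pulled back by \<open>U\<close> lies in the kernel, where its norm is
      known exactly.\<close>
    have "derived_mnorm (row_mat n u) = OH_mnorm (map_mat evens (row_mat n u))"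
      using u by (intro derived_mnorm_evens[of _ n] row_mat_Mats) (auto simp: u_def)
    also have "\<dots> = OH_mnorm (row_mat n unit_seq)" by (simp add: map_row_mat u_def)
    also have "\<dots> = q"
    proof -
      have "(OH_mnorm (row_mat n unit_seq))\<^sup>2 = q\<^sup>2"
        using n by (subst OH_mnorm_row_mat) (auto simp: unit_seq_in_ell2 hsn_gram_unit_seq q_def)
      then show ?thesis using q by (simp add: power2_eq_iff_nonneg)
    qed
    finally have "q \<le> B * (D * A * q / cmod (twist n))" using le by simp
    then have "q * cmod (twist n) \<le> q * (D * A * B)" using tw(2) by (simp add: field_simps)
    \<comment> \<open>The modulus of \<open>twist n\<close> is \<open>ln n / pi\<close>, whereas the
      right hand side does not depend on n.\<close>
    then have "cmod (twist n) \<le> D * A * B" using q by simp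
    then show ?thesis unfolding tw by (simp add: field_simps)
  qed
  obtain n :: nat where n: "real n > exp (D * A * B * pi)" "n \<ge> 2"
    using reals_Archimedean2[of "max 2 (exp (D * A * B * pi))"] by (metis max_less_iff_conj less_imp_le of_nat_less_iff of_nat_numeral)
  have "ln (real n) > D * A * B * pi" using n(1) by (metis exp_gt_zero ln_exp ln_less_cancel_iff less_trans)
  then show False using bound[OF n(2)] by simp
qed

theorem theorem4p10:
  shows "\<exists>(X :: (nat \<Rightarrow> complex) opspace) Y.
    operator_space X \<and>
    banach_isomorphic X (base_norm X) ell2 ell2_norm \<and>
    \<not> completely_isomorphic X OH \<and>
    closed_subspace Y X \<and>
    completely_isometric (subspace_opspace X Y) OH \<and>
    completely_isometric (quotient_opspace X Y) OH"
  using derived_operator_space derived_banach_isomorphic derived_not_isomorphic odd_free_closed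
    odd_free_isometric quot_isometric by blast

end
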